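(* Let $\mathcal{A},\mathcal{B},\mathcal{C}$ be finite-dimensional complex Hilbert spaces with $\dim\mathcal{C}\geq\dim(\mathcal{A}\otimes\mathcal{B})$, let $\ket{\mathrm{idle}}\in\mathcal{B}$ be a unit vector, and let $L$ be a subunitary operator on $\mathcal{A}\otimes\mathcal{B}$ with $L(\ket{\varphi}\otimes\ket{\mathrm{idle}})=\ket{\varphi}\otimes\ket{\mathrm{idle}}$ for all $\ket{\varphi}\in\mathcal{A}$. Let $\ket{\xi}\neq0$ and $\ket{\tau}$ be vectors in $\mathcal{A}\otimes\mathcal{B}\otimes\mathcal{C}$, and let $\mathrm{Adv}(\ket{\xi}\to\ket{\tau})$ be the adversary bound defined in the context. Then: (1) Every algorithm that transforms $\ket{\xi}$ exactly into $\ket{\tau}$ uses at least $\mathrm{Adv}(\ket{\xi}\to\ket{\tau})$ timesteps. (2) Suppose $\mathrm{Adv}(\ket{\xi}\to\ket{\tau})<\infty$. For every $\varepsilon>0$ there is an algorithm with ancilla space $\mathcal{C}\otimes\mathbb{C}^2$ using $$T'=\left\lceil\frac{\mathrm{Adv}(\ket{\xi}\to\ket{\tau})}{\varepsilon^2}\right\rceil$$ timesteps that transforms $\ket{\xi}\otimes\ket{0}$ into $\ket{\tau'}\otimes\ket{0}+\ket{\Delta}\otimes\ket{1}$ for some $\ket{\tau'},\ket{\Delta}\in\mathcal{A}\otimes\mathcal{B}\otimes\mathcal{C}$ with $\|\ket{\tau'}-\ket{\tau}\|/\|\ket{\xi}\|\leq\varepsilon$, and whose intermediate states $\ket{\Phi^j}$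 satisfy $$\sum_{j=0}^{T'-1}\bra{\Phi^j}(I-P_{\mathrm{idle}})\ket{\Phi^j}\big/\langle\xi|\xi\rangle\leq\mathrm{Adv}(\ket{\xi}\to\ket{\tau}).$$
   Context: A $T$-timestep algorithm with ancilla space $\mathcal{C}'$ consists of unitaries $U_0,\dots,U_T$ on $\mathcal{B}\otimes\mathcal{C}'$ and applies $E=(I_{\mathcal{A}}\otimes U_T)(L\otimes I_{\mathcal{C}'})(I_{\mathcal{A}}\otimes U_{T-1})\cdots(L\otimes I_{\mathcal{C}'})(I_{\mathcal{A}}\otimes U_0)$ to an initial state $\ket{x}$ in $\mathcal{A}\otimes\mathcal{B}\otimes\mathcal{C}'$; it transforms $\ket{x}$ into $E\ket{x}$. Its intermediate states are $\ket{\Phi^j}=(I_{\mathcal{A}}\otimes U_j)(L\otimes I)\cdots(L\otimes I)(I_{\mathcal{A}}\otimes U_0)\ket{x}$ for $0\leq j\leq T-1$ (the state directly before the $(j+1)$-th application of $L$). $P_{\mathrm{idle}}=I_{\mathcal{A}}\otimes\ket{\mathrm{idle}}\bra{\mathrm{idle}}\otimes I_{\mathcal{C}'}$. Subunitary means $\|L\ket{\varphi}\|\leq\|\ket{\varphi}\|$ for all $\ket{\varphi}$. States need not be normalized; $\mathrm{tr}_{\mathcal{B}}$ etc. are partial traces. The adversary bound $\mathrm{Adv}(\ket{\xi}\to\ket{\tau})$ is the optimal (infimum) value of: minimize $\mathrm{tr}(\overline{\pi})/\langle\xi|\xi\rangle$ over positive semidefinite operators $\overline{\pi}$ on $\mathcal{A}\otimes\mathcal{B}$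 subject to $\mathrm{tr}_{\mathcal{B}}(L\overline{\pi}L^\dagger-\overline{\pi})=\mathrm{tr}_{\mathcal{B}\mathcal{C}}(\ket{\tau}\bra{\tau}-\ket{\xi}\bra{\xi})$ (value $+\infty$ if infeasible). *)

theory Defs
  imports "HOL-Library.Extended_Real" "Jordan_Normal_Form.Matrix"
begin

text \<open>Finite-dimensional complex Hilbert spaces are modelled as coordinate spaces
  \<open>\<complex>^d\<close>; vectors are \<open>complex vec\<close>, operators \<open>complex mat\<close>.
  Tensor products are Kronecker products with the standard (row-major)
  index ordering, so \<open>A \<otimes> B \<otimes> C\<close> has index \<open>(a*dB + b)*dC + c\<close>.\<close>

definition adj :: "complex mat \<Rightarrow> complex mat" where
  "adj M = mat (dim_col M) (dim_row M) (\<lambda>(i,j). cnj (M $$ (j,i)))"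

definition mtrace :: "complex mat \<Rightarrow> complex" where
  "mtrace M = (\<Sum>i<dim_row M. M $$ (i,i))"

definition cinner :: "complex vec \<Rightarrow> complex vec \<Rightarrow> complex" where
  "cinner x y = (\<Sum>i<dim_vec x. cnj (x $ i) * y $ i)"

definition cnorm :: "complex vec \<Rightarrow> real" where
  "cnorm x = sqrt (Re (cinner x x))"

definition unitary_mat :: "nat \<Rightarrow> complex mat \<Rightarrow> bool" where
  "unitary_mat n U \<longleftrightarrow> U \<in> carrier_mat n n \<and> adj U * U = 1\<^sub>m n"

definition psd_mat :: "nat \<Rightarrow> complex mat \<Rightarrow> bool" where
  "psd_mat n P \<longleftrightarrow> P \<in> carrier_mat n n \<and>
     (\<forall>v\<in>carrier_vec n. cinner v (P *\<^sub>v v) \<in> \<real> \<and> Re (cinner v (P *\<^sub>v v)) \<ge> 0)"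

definition kron :: "complex mat \<Rightarrow> complex mat \<Rightarrow> complex mat" where
  "kron A B = mat (dim_row A * dim_row B) (dim_col A * dim_col B)
     (\<lambda>(i,j). A $$ (i div dim_row B, j div dim_col B) * B $$ (i mod dim_row B, j mod dim_col B))"

definition kron_vec :: "complex vec \<Rightarrow> complex vec \<Rightarrow> complex vec" where
  "kron_vec x y = vec (dim_vec x * dim_vec y) (\<lambda>i. x $ (i div dim_vec y) * y $ (i mod dim_vec y))"

definition outer :: "complex vec \<Rightarrow> complex vec \<Rightarrow> complex mat" where
  "outer x y = mat (dim_vec x) (dim_vec y) (\<lambda>(i,j). x $ i * cnj (y $ j))"

definition ptrace_right :: "nat \<Rightarrow> nat \<Rightarrow> complex mat \<Rightarrow> complex mat" where
  "ptrace_right d1 d2 M = mat d1 d1 (\<lambda>(i,j). \<Sum>k<d2. M $$ (i*d2 + k, j*d2 + k))"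

text \<open>Adversary bound \<open>Adv(\<xi> \<rightarrow> \<tau>)\<close>; \<open>\<xi>, \<tau>\<close> live in \<open>A \<otimes> B \<otimes> C\<close>,
  \<open>L\<close> acts on \<open>A \<otimes> B\<close>. Infimum of the empty set is \<open>\<infinity>\<close>.\<close>
definition Adv :: "nat \<Rightarrow> nat \<Rightarrow> nat \<Rightarrow> complex mat \<Rightarrow> complex vec \<Rightarrow> complex vec \<Rightarrow> ereal" where
  "Adv dA dB dC L \<xi> \<tau> = Inf {ereal (Re (mtrace P) / Re (cinner \<xi> \<xi>)) | P.
      psd_mat (dA*dB) P \<and>
      ptrace_right dA dB (L * P * adj L - P)
        = ptrace_right dA (dB*dC) (outer \<tau> \<tau> - outer \<xi> \<xi>)}"

text \<open>State of a \<open>T\<close>-timestep algorithm with ancilla dimension \<open>dC'\<close> and unitaries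
  \<open>U 0, ..., U T\<close> on \<open>B \<otimes> C'\<close>, after applying \<open>U j\<close>:
  \<open>alg_state \<dots> j x = (I \<otimes> U_j)(L \<otimes> I) \<dots> (L \<otimes> I)(I \<otimes> U_0) x\<close>.
  For \<open>j < T\<close> this is the intermediate state \<open>\<Phi>^j\<close>; for \<open>j = T\<close> it is \<open>E x\<close>.\<close>
fun alg_state :: "nat \<Rightarrow> nat \<Rightarrow> complex mat \<Rightarrow> (nat \<Rightarrow> complex mat) \<Rightarrow> nat \<Rightarrow> complex vec \<Rightarrow> complex vec" where
  "alg_state dA dC' L U 0 x = kron (1\<^sub>m dA) (U 0) *\<^sub>v x"
| "alg_state dA dC' L U (Suc j) x =
     kron (1\<^sub>m dA) (U (Suc j)) *\<^sub>v (kron L (1\<^sub>m dC') *\<^sub>v alg_state dA dC' L U j x)"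

definition is_algorithm :: "nat \<Rightarrow> nat \<Rightarrow> nat \<Rightarrow> (nat \<Rightarrow> complex mat) \<Rightarrow> bool" where
  "is_algorithm dB dC' T U \<longleftrightarrow> (\<forall>j\<le>T. unitary_mat (dB*dC') (U j))"

definition alg_output :: "nat \<Rightarrow> nat \<Rightarrow> complex mat \<Rightarrow> (nat \<Rightarrow> complex mat) \<Rightarrow> nat \<Rightarrow> complex vec \<Rightarrow> complex vec" where
  "alg_output dA dC' L U T x = alg_state dA dC' L U T x"

definition P_idle :: "nat \<Rightarrow> nat \<Rightarrow> complex vec \<Rightarrow> complex mat" where
  "P_idle dA dC' idle = kron (kron (1\<^sub>m dA) (outer idle idle)) (1\<^sub>m dC')"

end

theory Submission
  imports Defs
begin

text \<open>
  Lower bound: summing the reductions to \<open>A \<otimes> B\<close> of the intermediate states gives a feasible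
  \<open>\<pi>\<close> of trace at most \<open>T \<langle>\<xi>|\<xi>\<rangle>\<close>, because operations on \<open>B \<otimes> C'\<close> do not change the reduced operator
  on \<open>A\<close> and the differences telescope.

  Upper bound: by compactness the infimum is attained at some \<open>\<pi> = tr\<^sub>C |\<psi>\<rangle>\<langle>\<psi>|\<close>, and \<open>\<psi>\<close> may be taken
  orthogonal to the idle subspace. With \<open>z\<^sub>j = |idle\<rangle> \<Xi>\<^sub>j + \<psi>/\<surd>T\<close>, where \<open>\<Xi>\<^sub>j\<close> purifies
  \<open>(1 - j/T) tr |\<xi>\<rangle>\<langle>\<xi>| + (j/T) tr |\<tau>\<rangle>\<langle>\<tau>|\<close>, the states \<open>L z\<^sub>j\<close> and \<open>z\<^sub>j\<^sub>+\<^sub>1\<close> have the same reduced operator on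
  \<open>A\<close>, so a unitary on \<open>B \<otimes> C\<close> maps one to the other; this run needs the catalyst \<open>\<psi>/\<surd>T\<close>.
  The actual algorithm starts without the catalyst and follows \<open>z\<close> greedily: it moves to the
  point \<open>y\<^sub>j\<^sub>+\<^sub>1\<close> closest to \<open>z\<^sub>j\<^sub>+\<^sub>1\<close> among all \<open>(I \<otimes> K) L y\<^sub>j\<close> with \<open>K\<close> a contraction of \<open>B \<otimes> C\<close>, the lost
  part being stored idle behind the flag \<open>|1\<rangle>\<close>. Then \<open>\<parallel>z\<^sub>j - y\<^sub>j\<parallel>\<close> never exceeds its initial value
  \<open>\<parallel>\<psi>\<parallel>/\<surd>T\<close>, and first-order optimality of \<open>y\<^sub>j\<close> shows that its non-idle part is no longer than that
  of \<open>z\<^sub>j\<close>, which is \<open>\<psi>/\<surd>T\<close>.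
\<close>

section \<open>Coordinates and block structure\<close>

lemma index_less: "a < d \<Longrightarrow> h < n \<Longrightarrow> a * n + h < d * (n::nat)"
proof -
  assume "a < d" "h < n"
  then have "a * n + h < Suc a * n" by simp
  also have "\<dots> \<le> d * n" using \<open>a < d\<close> by (intro mult_le_mono1) simp
  finally show ?thesis .
qed

lemma sum_index_split:
  fixes f :: "nat \<Rightarrow> 'a::comm_monoid_add"
  shows "(\<Sum>i<d * n. f i) = (\<Sum>a<d. \<Sum>h<n. f (a * n + h))"
proof (cases "n = 0")
  case False
  have "(\<Sum>i<d * n. f i) = (\<Sum>p\<in>{..<d} \<times> {..<n}. f (fst p * n + snd p))"
    by (rule sum.reindex_bij_witness[where i = "\<lambda>p. fst p * n + snd p" and j = "\<lambda>i. (i div n, i mod n)"])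
      (use False in \<open>auto simp: index_less less_mult_imp_div_less\<close>)
  then show ?thesis by (simp add: sum.cartesian_product case_prod_unfold)
qed simp

lemma eq_vec_split:
  assumes "x \<in> carrier_vec (d * n)" "y \<in> carrier_vec (d * n)"
    and "\<And>a h. a < d \<Longrightarrow> h < n \<Longrightarrow> x $ (a * n + h) = y $ (a * n + h)"
  shows "x = y"
proof (rule eq_vecI)
  fix i assume "i < dim_vec y"
  then have i: "i < d * n" using assms by simp
  then have "n > 0" by (cases n) auto
  then have "i div n < d" "i mod n < n" using i by (auto simp: less_mult_imp_div_less)
  from assms(3)[OF this] show "x $ i = y $ i" by simp
qed (use assms in auto)

lemma mult_mat_vec_index:
  assumes "A \<in> carrier_mat m n" "x \<in> carrier_vec n" "i < m"
  shows "(A *\<^sub>v x) $ i = (\<Sum>k<n. A $$ (i, k) * x $ k)"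
  using assms by (auto simp: scalar_prod_def lessThan_atLeast0)

section \<open>Squared norms and the sesquilinear algebra of the inner product\<close>

definition nsq :: "complex vec \<Rightarrow> real" where
  "nsq x = (\<Sum>i<dim_vec x. (cmod (x $ i))\<^sup>2)"

lemma cinner_self: "cinner x x = of_real (nsq x)"
  unfolding cinner_def nsq_def of_real_sum
  by (intro sum.cong) (auto simp: complex_norm_square mult.commute simp del: of_real_power)

lemma nsq_nonneg [simp]: "nsq x \<ge> 0"
  by (simp add: nsq_def sum_nonneg)

lemma cnorm_sqrt: "cnorm x = sqrt (nsq x)"
  by (simp add: cnorm_def cinner_self)

lemma cnorm_le_iff: "cnorm x \<le> cnorm y \<longleftrightarrow> nsq x \<le> nsq y"
  by (simp add: cnorm_sqrt)

lemma nsq_eq_0: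
  assumes "x \<in> carrier_vec n" shows "nsq x = 0 \<longleftrightarrow> x = 0\<^sub>v n"
proof
  assume "nsq x = 0"
  then have "\<forall>i<n. x $ i = 0" using assms
    by (auto simp: nsq_def sum_nonneg_eq_0_iff)
  then show "x = 0\<^sub>v n" using assms by (intro eq_vecI) auto
qed (simp add: nsq_def)

lemma cinner_add_right:
  "x \<in> carrier_vec n \<Longrightarrow> y \<in> carrier_vec n \<Longrightarrow> z \<in> carrier_vec n \<Longrightarrow>
    cinner x (y + z) = cinner x y + cinner x z"
  by (simp add: cinner_def distrib_left sum.distrib)

lemma cinner_diff_right:
  "x \<in> carrier_vec n \<Longrightarrow> y \<in> carrier_vec n \<Longrightarrow> z \<in> carrier_vec n \<Longrightarrow>
    cinner x (y - z) = cinner x y - cinner x z"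
  by (simp add: cinner_def right_diff_distrib sum_subtractf)

lemma cinner_smult_right:
  "x \<in> carrier_vec n \<Longrightarrow> y \<in> carrier_vec n \<Longrightarrow> cinner x (c \<cdot>\<^sub>v y) = c * cinner x y"
  by (simp add: cinner_def sum_distrib_left mult.left_commute)

lemma cinner_commute:
  "x \<in> carrier_vec n \<Longrightarrow> y \<in> carrier_vec n \<Longrightarrow> cinner x y = cnj (cinner y x)"
  by (simp add: cinner_def mult.commute)

lemma cinner_add_left:
  "x \<in> carrier_vec n \<Longrightarrow> y \<in> carrier_vec n \<Longrightarrow> z \<in> carrier_vec n \<Longrightarrow>
    cinner (y + z) x = cinner y x + cinner z x"
  by (simp add: cinner_def distrib_right sum.distrib)

lemma cinner_diff_left:
  "x \<in> carrier_vec n \<Longrightarrow> y \<in> carrier_vec n \<Longrightarrow> z \<in> carrier_vec n \<Longrightarrow>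
    cinner (y - z) x = cinner y x - cinner z x"
  by (simp add: cinner_def left_diff_distrib sum_subtractf)

lemma cinner_smult_left:
  "x \<in> carrier_vec n \<Longrightarrow> y \<in> carrier_vec n \<Longrightarrow> cinner (c \<cdot>\<^sub>v y) x = cnj c * cinner y x"
  by (simp add: cinner_def sum_distrib_left mult.assoc)

lemma nsq_add:
  assumes "x \<in> carrier_vec n" "y \<in> carrier_vec n"
  shows "nsq (x + y) = nsq x + 2 * Re (cinner x y) + nsq y"
proof -
  have "of_real (nsq (x + y)) = cinner x x + (cinner x y + cnj (cinner x y)) + cinner y y"
    using assms cinner_commute[OF assms]
    by (simp add: cinner_self[symmetric] cinner_add_right[of _ n] cinner_add_left[of _ n])
  then have "of_real (nsq (x + y)) = complex_of_real (nsq x + 2 * Re (cinner x y) + nsq y)"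
    by (simp add: cinner_self complex_add_cnj)
  then show ?thesis by (simp only: of_real_eq_iff)
qed

lemma nsq_smult: "nsq (c \<cdot>\<^sub>v x) = (cmod c)\<^sup>2 * nsq x"
  by (simp add: nsq_def norm_mult power_mult_distrib sum_distrib_left)

lemma nsq_diff:
  assumes "x \<in> carrier_vec n" "y \<in> carrier_vec n"
  shows "nsq (x - y) = nsq x - 2 * Re (cinner x y) + nsq y"
proof -
  have "x - y = x + (-1) \<cdot>\<^sub>v y" using assms by (intro eq_vecI) auto
  then show ?thesis using assms
    by (simp add: nsq_add[of _ n] nsq_smult cinner_smult_right[of _ n])
qed

lemma nsq_split:
  assumes "x \<in> carrier_vec (d * n)"
  shows "nsq x = (\<Sum>a<d. \<Sum>h<n. (cmod (x $ (a * n + h)))\<^sup>2)"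
  using assms by (simp add: nsq_def sum_index_split)

lemma nsq_sub_commute:
  assumes "x \<in> carrier_vec n" "y \<in> carrier_vec n"
  shows "nsq (x - y) = nsq (y - x)"
  using assms by (simp add: nsq_def norm_minus_commute)

section \<open>Blocks along the first tensor factor, slices along the last one, and one-sided
  operators\<close>

definition blk :: "nat \<Rightarrow> complex vec \<Rightarrow> nat \<Rightarrow> complex vec" where
  "blk n x a = vec n (\<lambda>h. x $ (a * n + h))"

definition slc :: "nat \<Rightarrow> nat \<Rightarrow> complex vec \<Rightarrow> nat \<Rightarrow> complex vec" where
  "slc m n x c = vec m (\<lambda>i. x $ (i * n + c))"

lemma blk_carrier [simp]: "blk n x a \<in> carrier_vec n" and slc_carrier [simp]: "slc m n x c \<in> carrier_vec m"
  and dim_blk [simp]: "dim_vec (blk n x a) = n" and dim_slc [simp]: "dim_vec (slc m n x c) = m"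
  by (simp_all add: blk_def slc_def)

lemma nsq_blk: "x \<in> carrier_vec (d * n) \<Longrightarrow> nsq x = (\<Sum>a<d. nsq (blk n x a))"
  by (simp add: nsq_split) (simp add: nsq_def blk_def)

lemma nsq_slc: "x \<in> carrier_vec (m * n) \<Longrightarrow> nsq x = (\<Sum>c<n. nsq (slc m n x c))"
  by (simp add: nsq_split, subst sum.swap) (simp add: nsq_def slc_def)

lemma kron_carrier [simp]:
  "A \<in> carrier_mat m n \<Longrightarrow> B \<in> carrier_mat p q \<Longrightarrow> kron A B \<in> carrier_mat (m * p) (n * q)"
  by (auto simp: kron_def)

lemma dim_kron [simp]:
  "dim_row (kron A B) = dim_row A * dim_row B" "dim_col (kron A B) = dim_col A * dim_col B"
  by (simp_all add: kron_def)

lemma kron_one_left_index: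
  assumes U: "U \<in> carrier_mat n n" and x: "x \<in> carrier_vec (d * n)" and a: "a < d" and h: "h < n"
  shows "(kron (1\<^sub>m d) U *\<^sub>v x) $ (a * n + h) = (\<Sum>k<n. U $$ (h, k) * x $ (a * n + k))"
proof -
  have "(kron (1\<^sub>m d) U *\<^sub>v x) $ (a * n + h)
      = (\<Sum>b<d. \<Sum>k<n. kron (1\<^sub>m d) U $$ (a * n + h, b * n + k) * x $ (b * n + k))"
    using U x a h by (subst mult_mat_vec_index[where n = "d * n" and m = "d * n"])
      (auto simp: index_less sum_index_split)
  also have "\<dots> = (\<Sum>b<d. if a = b then (\<Sum>k<n. U $$ (h, k) * x $ (b * n + k)) else 0)"
    using U a h by (intro sum.cong) (auto simp: kron_def index_less)
  also have "\<dots> = (\<Sum>k<n. U $$ (h, k) * x $ (a * n + k))"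
    using a by simp
  finally show ?thesis .
qed

lemma kron_one_right_index:
  assumes L: "L \<in> carrier_mat m m" and x: "x \<in> carrier_vec (m * n)" and i: "i < m" and c: "c < n"
  shows "(kron L (1\<^sub>m n) *\<^sub>v x) $ (i * n + c) = (\<Sum>k<m. L $$ (i, k) * x $ (k * n + c))"
proof -
  have "(kron L (1\<^sub>m n) *\<^sub>v x) $ (i * n + c)
      = (\<Sum>k<m. \<Sum>e<n. kron L (1\<^sub>m n) $$ (i * n + c, k * n + e) * x $ (k * n + e))"
    using L x i c by (subst mult_mat_vec_index[where n = "m * n" and m = "m * n"])
      (auto simp: index_less sum_index_split)
  also have "\<dots> = (\<Sum>k<m. \<Sum>e<n. if c = e then L $$ (i, k) * x $ (k * n + e) else 0)"
    using L i c by (intro sum.cong) (auto simp: kron_def index_less)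
  also have "\<dots> = (\<Sum>k<m. L $$ (i, k) * x $ (k * n + c))"
    using c by simp
  finally show ?thesis .
qed

lemma kron_one_left_carrier [simp]:
  "U \<in> carrier_mat n n \<Longrightarrow> x \<in> carrier_vec (d * n) \<Longrightarrow> kron (1\<^sub>m d) U *\<^sub>v x \<in> carrier_vec (d * n)"
  by (rule mult_mat_vec_carrier) auto

lemma kron_one_right_carrier [simp]:
  "L \<in> carrier_mat m m \<Longrightarrow> x \<in> carrier_vec (m * n) \<Longrightarrow> kron L (1\<^sub>m n) *\<^sub>v x \<in> carrier_vec (m * n)"
  by (rule mult_mat_vec_carrier) auto

text \<open>A block fixes the index of the first factor, so I \<otimes> U acts on each block
  separately; dually, L \<otimes> I acts on each slice separately (\<open>slc_kron\<close>). Norm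
  bounds and identities for one-sided operators thereby reduce to the small operator.\<close>

lemma blk_kron:
  assumes "U \<in> carrier_mat n n" "x \<in> carrier_vec (d * n)" "a < d"
  shows "blk n (kron (1\<^sub>m d) U *\<^sub>v x) a = U *\<^sub>v blk n x a"
  using assms
  by (intro eq_vecI)
    (auto simp: blk_def kron_one_left_index mult_mat_vec_index[where m = n and n = n] simp del: index_mult_mat_vec)

lemma slc_kron:
  assumes "L \<in> carrier_mat m m" "x \<in> carrier_vec (m * n)" "c < n"
  shows "slc m n (kron L (1\<^sub>m n) *\<^sub>v x) c = L *\<^sub>v slc m n x c"
  using assms
  by (intro eq_vecI)
    (auto simp: slc_def kron_one_right_index mult_mat_vec_index[where m = m and n = m] simp del: index_mult_mat_vec)

lemma eq_vec_blk:
  assumes "x \<in> carrier_vec (d * n)" "y \<in> carrier_vec (d * n)"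
    and "\<And>a. a < d \<Longrightarrow> blk n x a = blk n y a"
  shows "x = y"
proof (rule eq_vec_split[OF assms(1,2)])
  fix a h assume "a < d" "h < n"
  then show "x $ (a * n + h) = y $ (a * n + h)"
    using arg_cong[OF assms(3), of a "\<lambda>v. v $ h"] by (simp add: blk_def)
qed

lemma eq_vec_slc:
  assumes "x \<in> carrier_vec (m * n)" "y \<in> carrier_vec (m * n)"
    and "\<And>c. c < n \<Longrightarrow> slc m n x c = slc m n y c"
  shows "x = y"
proof (rule eq_vec_split[OF assms(1,2)])
  fix a h assume "a < m" "h < n"
  then show "x $ (a * n + h) = y $ (a * n + h)"
    using arg_cong[OF assms(3), of h "\<lambda>v. v $ a"] by (simp add: slc_def)
qed

text \<open>Contractions, unlike unitaries, form a convex set, and they are closed under products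
  and limits. Closest points are therefore sought among contractions, and unitarity is restored
  afterwards with the flag qubit.\<close>

definition contraction_mat :: "nat \<Rightarrow> complex mat \<Rightarrow> bool" where
  "contraction_mat n K \<longleftrightarrow> K \<in> carrier_mat n n \<and> (\<forall>v\<in>carrier_vec n. nsq (K *\<^sub>v v) \<le> nsq v)"

lemma nsq_kron_left_le:
  assumes "contraction_mat n K" "x \<in> carrier_vec (d * n)"
  shows "nsq (kron (1\<^sub>m d) K *\<^sub>v x) \<le> nsq x"
  using assms by (auto simp: contraction_mat_def nsq_blk[of _ d n] blk_kron intro!: sum_mono)

lemma nsq_kron_right_le:
  assumes "contraction_mat m L" "x \<in> carrier_vec (m * n)"
  shows "nsq (kron L (1\<^sub>m n) *\<^sub>v x) \<le> nsq x"
  using assms by (auto simp: contraction_mat_def nsq_slc[of _ m n] slc_kron intro!: sum_mono)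

lemma contraction_mat_mult:
  assumes "contraction_mat n K" "contraction_mat n M"
  shows "contraction_mat n (K * M)"
  using assms unfolding contraction_mat_def
  by (auto simp: assoc_mult_mat_vec[of _ n n _ n]) (meson mult_mat_vec_carrier order_trans)

lemma kron_one_left_mult:
  assumes "K \<in> carrier_mat n n" "M \<in> carrier_mat n n" "x \<in> carrier_vec (d * n)"
  shows "kron (1\<^sub>m d) (K * M) *\<^sub>v x = kron (1\<^sub>m d) K *\<^sub>v (kron (1\<^sub>m d) M *\<^sub>v x)"
  by (rule eq_vec_blk[of _ d n]) (use assms in \<open>auto simp: blk_kron\<close>)

lemma kron_one_left_diff:
  assumes "K \<in> carrier_mat n n" "x \<in> carrier_vec (d * n)" "y \<in> carrier_vec (d * n)"
  shows "kron (1\<^sub>m d) K *\<^sub>v (x - y) = kron (1\<^sub>m d) K *\<^sub>v x - kron (1\<^sub>m d) K *\<^sub>v y"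
  using assms by (intro mult_minus_distrib_mat_vec[where nr = "d * n" and nc = "d * n"]) auto

lemma kron_one_right_diff:
  assumes "L \<in> carrier_mat m m" "x \<in> carrier_vec (m * n)" "y \<in> carrier_vec (m * n)"
  shows "kron L (1\<^sub>m n) *\<^sub>v (x - y) = kron L (1\<^sub>m n) *\<^sub>v x - kron L (1\<^sub>m n) *\<^sub>v y"
  using assms by (intro mult_minus_distrib_mat_vec[where nr = "m * n" and nc = "m * n"]) auto

text \<open>The entries of \<open>adj U * U = 1\<^sub>m n\<close> are the orthonormality relations
  of the columns of \<open>U\<close>; once the sum over the rows \<open>k\<close> stands innermost,
  they collapse the triple sum.\<close>

lemma unitary_cinner:
  assumes U: "unitary_mat n U" and v: "v \<in> carrier_vec n" and w: "w \<in> carrier_vec n"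
  shows "cinner (U *\<^sub>v v) (U *\<^sub>v w) = cinner v w"
proof -
  have U': "U \<in> carrier_mat n n" and UU: "adj U * U = 1\<^sub>m n" using U by (auto simp: unitary_mat_def)
  have e: "(\<Sum>k<n. cnj (U $$ (k, i)) * U $$ (k, j)) = (if i = j then 1 else 0)" if "i < n" "j < n" for i j
    using arg_cong[OF UU, of "\<lambda>M. M $$ (i, j)"] that U'
    by (simp add: adj_def scalar_prod_def lessThan_atLeast0)
  have "cinner (U *\<^sub>v v) (U *\<^sub>v w)
      = (\<Sum>k<n. (\<Sum>i<n. cnj (U $$ (k, i)) * cnj (v $ i)) * (\<Sum>j<n. U $$ (k, j) * w $ j))"
    using U' v w by (simp add: cinner_def mult_mat_vec_index[where m = n and n = n] del: index_mult_mat_vec)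
  also have "\<dots> = (\<Sum>k<n. \<Sum>i<n. \<Sum>j<n. cnj (v $ i) * w $ j * (cnj (U $$ (k, i)) * U $$ (k, j)))"
    by (simp only: sum_product) (intro sum.cong refl, simp add: mult_ac)
  also have "\<dots> = (\<Sum>i<n. \<Sum>k<n. \<Sum>j<n. cnj (v $ i) * w $ j * (cnj (U $$ (k, i)) * U $$ (k, j)))"
    by (rule sum.swap)
  also have "\<dots> = (\<Sum>i<n. \<Sum>j<n. \<Sum>k<n. cnj (v $ i) * w $ j * (cnj (U $$ (k, i)) * U $$ (k, j)))"
    by (rule sum.cong[OF refl]) (rule sum.swap)
  also have "\<dots> = (\<Sum>i<n. \<Sum>j<n. if i = j then cnj (v $ i) * w $ j else 0)"
    by (intro sum.cong refl) (simp add: sum_distrib_left[symmetric] e)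
  also have "\<dots> = cinner v w" using v w by (simp add: cinner_def)
  finally show ?thesis .
qed

lemma unitary_contraction: "unitary_mat n U \<Longrightarrow> contraction_mat n U"
  using unitary_cinner[of n U] unfolding contraction_mat_def
  by (metis cinner_self of_real_eq_iff order_refl unitary_mat_def)

text \<open>The entries of \<open>adj U * U\<close> are inner products of images of unit
  vectors.\<close>

lemma unitary_matI:
  assumes U: "U \<in> carrier_mat n n"
    and *: "\<And>v w. v \<in> carrier_vec n \<Longrightarrow> w \<in> carrier_vec n \<Longrightarrow> cinner (U *\<^sub>v v) (U *\<^sub>v w) = cinner v w"
  shows "unitary_mat n U"
  unfolding unitary_mat_def
proof (intro conjI U eq_matI)
  fix i j assume "i < dim_row (1\<^sub>m n)" "j < dim_col (1\<^sub>m n)"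
  then have ij: "i < n" "j < n" by auto
  have col: "(U *\<^sub>v unit_vec n l) $ k = U $$ (k, l)" if "k < n" "l < n" for k l
    using that U by simp
  have "(adj U * U) $$ (i, j) = cinner (U *\<^sub>v unit_vec n i) (U *\<^sub>v unit_vec n j)"
    using ij U by (simp add: cinner_def col adj_def scalar_prod_def lessThan_atLeast0 del: index_mult_mat_vec)
  also have "\<dots> = cinner (unit_vec n i) (unit_vec n j)" by (intro *) auto
  also have "\<dots> = (\<Sum>k<n. if k = i then (if k = j then 1 else 0) else 0)"
    unfolding cinner_def using ij by (intro sum.cong) (auto simp: unit_vec_def)
  also have "\<dots> = 1\<^sub>m n $$ (i, j)" using ij by simp
  finally show "(adj U * U) $$ (i, j) = 1\<^sub>m n $$ (i, j)" .
qed (use U in \<open>auto simp: adj_def\<close>)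

section \<open>Reduced operators\<close>

text \<open>The reduced operator, on the first factor of dimension \<open>d\<close>, of the pure
  unnormalized state \<open>x\<close>.\<close>

definition marg :: "nat \<Rightarrow> nat \<Rightarrow> complex vec \<Rightarrow> complex mat" where
  "marg d n x = ptrace_right d n (outer x x)"

lemma marg_carrier [simp]: "marg d n x \<in> carrier_mat d d"
  and dim_marg [simp]: "dim_row (marg d n x) = d" "dim_col (marg d n x) = d"
  by (simp_all add: marg_def ptrace_right_def)

lemma ptrace_right_carrier [simp]: "ptrace_right d n M \<in> carrier_mat d d"
  and dim_ptrace_right [simp]: "dim_row (ptrace_right d n M) = d" "dim_col (ptrace_right d n M) = d"
  by (simp_all add: ptrace_right_def)

lemma marg_index:
  assumes "x \<in> carrier_vec (d * n)" "i < d" "k < d"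
  shows "marg d n x $$ (i, k) = (\<Sum>h<n. x $ (i * n + h) * cnj (x $ (k * n + h)))"
  using assms by (simp add: marg_def ptrace_right_def outer_def index_less)

text \<open>The reduced operator is thus the Gram matrix of the blocks; the indices are swapped
  because \<open>cinner\<close> conjugates its first argument.\<close>

lemma marg_cinner:
  assumes "x \<in> carrier_vec (d * n)" "i < d" "k < d"
  shows "marg d n x $$ (i, k) = cinner (blk n x k) (blk n x i)"
  using assms by (simp add: marg_index cinner_def blk_def mult.commute)

lemma ptrace_right_add:
  assumes "M \<in> carrier_mat (d * n) (d * n)" "N \<in> carrier_mat (d * n) (d * n)"
  shows "ptrace_right d n (M + N) = ptrace_right d n M + ptrace_right d n N"
  using assms by (intro eq_matI) (auto simp: ptrace_right_def index_less sum.distrib)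

lemma ptrace_right_diff:
  assumes "M \<in> carrier_mat (d * n) (d * n)" "N \<in> carrier_mat (d * n) (d * n)"
  shows "ptrace_right d n (M - N) = ptrace_right d n M - ptrace_right d n N"
  using assms by (intro eq_matI) (auto simp: ptrace_right_def index_less sum_subtractf)

text \<open>This connects the variable of the adversary program, an operator on A \<otimes> B
  purified by C, with reduced operators on A. With row-major indices the two successive traces are
  one sum.\<close>

lemma ptrace_right_marg:
  assumes "x \<in> carrier_vec (a * b * c)"
  shows "ptrace_right a b (marg (a * b) c x) = marg a (b * c) x"
proof (rule eq_matI)
  fix i k assume "i < dim_row (marg a (b * c) x)" "k < dim_col (marg a (b * c) x)"
  then have ik: "i < a" "k < a" by auto
  have x': "x \<in> carrier_vec (a * (b * c))" using assms by (simp add: mult.assoc)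
  show "ptrace_right a b (marg (a * b) c x) $$ (i, k) = marg a (b * c) x $$ (i, k)"
    using ik marg_index[OF x' ik]
    by (simp add: ptrace_right_def marg_index[OF assms] index_less sum_index_split)
      (simp add: algebra_simps)
qed auto

text \<open>L acts on the factor that is kept, so it conjugates the reduced operator; the proof only
  reorders finite sums.\<close>

lemma marg_kron_right:
  assumes L: "L \<in> carrier_mat m m" and x: "x \<in> carrier_vec (m * n)"
  shows "L * marg m n x * adj L = marg m n (kron L (1\<^sub>m n) *\<^sub>v x)"
proof (rule eq_matI)
  fix i k assume "i < dim_row (marg m n (kron L (1\<^sub>m n) *\<^sub>v x))" "k < dim_col (marg m n (kron L (1\<^sub>m n) *\<^sub>v x))"
  then have ik: "i < m" "k < m" by auto
  have "(L * marg m n x * adj L) $$ (i, k)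
      = (\<Sum>q<m. (\<Sum>p<m. L $$ (i, p) * (\<Sum>h<n. x $ (p * n + h) * cnj (x $ (q * n + h)))) * cnj (L $$ (k, q)))"
    using L ik by (simp add: scalar_prod_def adj_def marg_index[OF x] lessThan_atLeast0)
  also have "\<dots> = (\<Sum>q<m. \<Sum>p<m. \<Sum>h<n. L $$ (i, p) * x $ (p * n + h) * cnj (L $$ (k, q) * x $ (q * n + h)))"
    by (simp add: sum_distrib_left sum_distrib_right mult_ac)
  also have "\<dots> = (\<Sum>q<m. \<Sum>h<n. \<Sum>p<m. L $$ (i, p) * x $ (p * n + h) * cnj (L $$ (k, q) * x $ (q * n + h)))"
    by (rule sum.cong[OF refl]) (rule sum.swap)
  also have "\<dots> = (\<Sum>h<n. \<Sum>q<m. \<Sum>p<m. L $$ (i, p) * x $ (p * n + h) * cnj (L $$ (k, q) * x $ (q * n + h)))"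
    by (rule sum.swap)
  also have "\<dots> = (\<Sum>h<n. \<Sum>p<m. \<Sum>q<m. L $$ (i, p) * x $ (p * n + h) * cnj (L $$ (k, q) * x $ (q * n + h)))"
    by (rule sum.cong[OF refl]) (rule sum.swap)
  also have "\<dots> = marg m n (kron L (1\<^sub>m n) *\<^sub>v x) $$ (i, k)"
    using L x ik by (simp add: marg_index kron_one_right_index sum_product)
  finally show "(L * marg m n x * adj L) $$ (i, k) = marg m n (kron L (1\<^sub>m n) *\<^sub>v x) $$ (i, k)" .
qed (use L in \<open>auto simp: adj_def\<close>)

text \<open>The unitary acts on all blocks alike and so preserves their Gram matrix.\<close>

lemma marg_unitary:
  assumes "unitary_mat n U" "x \<in> carrier_vec (d * n)"
  shows "marg d n (kron (1\<^sub>m d) U *\<^sub>v x) = marg d n x"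
proof -
  have U: "U \<in> carrier_mat n n" using assms by (simp add: unitary_mat_def)
  show ?thesis
    by (rule eq_matI) (use assms U in \<open>auto simp: marg_cinner blk_kron unitary_cinner[OF assms(1)]\<close>)
qed

lemma mtrace_marg:
  assumes "x \<in> carrier_vec (d * n)"
  shows "mtrace (marg d n x) = of_real (nsq x)"
  using assms by (simp add: mtrace_def marg_index nsq_split complex_norm_square del: of_real_power)

text \<open>The quadratic form is a sum of squared moduli, one for each basis vector of the
  traced-out factor, which makes positivity evident.\<close>

lemma cinner_marg:
  assumes x: "x \<in> carrier_vec (d * n)" and v: "v \<in> carrier_vec d"
  shows "cinner v (marg d n x *\<^sub>v v) = of_real (\<Sum>h<n. (cmod (\<Sum>a<d. cnj (v $ a) * x $ (a * n + h)))\<^sup>2)"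
proof -
  have "cinner v (marg d n x *\<^sub>v v)
      = (\<Sum>i<d. \<Sum>k<d. \<Sum>h<n. cnj (v $ i) * x $ (i * n + h) * cnj (cnj (v $ k) * x $ (k * n + h)))"
    using x v by (simp add: cinner_def mult_mat_vec_index[where m = d and n = d] marg_index
        sum_distrib_left sum_distrib_right mult_ac del: index_mult_mat_vec)
  also have "\<dots> = (\<Sum>i<d. \<Sum>h<n. \<Sum>k<d. cnj (v $ i) * x $ (i * n + h) * cnj (cnj (v $ k) * x $ (k * n + h)))"
    by (rule sum.cong[OF refl]) (rule sum.swap)
  also have "\<dots> = (\<Sum>h<n. \<Sum>i<d. \<Sum>k<d. cnj (v $ i) * x $ (i * n + h) * cnj (cnj (v $ k) * x $ (k * n + h)))"
    by (rule sum.swap)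
  also have "\<dots> = of_real (\<Sum>h<n. (cmod (\<Sum>a<d. cnj (v $ a) * x $ (a * n + h)))\<^sup>2)"
    by (simp only: of_real_sum complex_norm_square cnj_sum sum_product)
  finally show ?thesis .
qed

lemma psd_marg: "x \<in> carrier_vec (d * n) \<Longrightarrow> psd_mat d (marg d n x)"
  by (auto simp: psd_mat_def cinner_marg sum_nonneg)

lemma psd_add:
  assumes "psd_mat n P" "psd_mat n Q" shows "psd_mat n (P + Q)"
  using assms
  by (auto simp: psd_mat_def add_mult_distrib_mat_vec[of _ n n] cinner_add_right[of _ n])

lemma psd_smult:
  assumes "psd_mat n P" "c \<ge> 0" shows "psd_mat n (of_real c \<cdot>\<^sub>m P)"
proof -
  have "(complex_of_real c \<cdot>\<^sub>m P) *\<^sub>v v = of_real c \<cdot>\<^sub>v (P *\<^sub>v v)" if "v \<in> carrier_vec n" for v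
    using assms that by (intro eq_vecI) (auto simp: psd_mat_def scalar_prod_def sum_distrib_left mult.assoc)
  then show ?thesis using assms
    by (auto simp: psd_mat_def cinner_smult_right[of _ n])
qed


text \<open>A complex Householder reflection \<open>1 - c |d\<rangle>\<langle>d|\<close> with \<open>d = x - y\<close>: it maps \<open>x\<close> to \<open>y\<close> for \<open>c = 1/\<langle>d|x\<rangle>\<close>, and it
  is unitary since \<open>2 Re \<langle>d|x\<rangle> = \<parallel>d\<parallel>\<^sup>2\<close> when \<open>\<parallel>x\<parallel> = \<parallel>y\<parallel>\<close>.\<close>

lemma unitary_fixing_and_mapping:
  assumes x: "x \<in> carrier_vec n" and y: "y \<in> carrier_vec n" and eq: "cinner x x = cinner y y"
  shows "\<exists>R. unitary_mat n R \<and> R *\<^sub>v x = y \<and>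
     (\<forall>v\<in>carrier_vec n. cinner v x = cinner v y \<longrightarrow> R *\<^sub>v v = v)"
proof (cases "x = y")
  case True
  have "unitary_mat n (1\<^sub>m n)" by (intro unitary_matI) auto
  then show ?thesis using True x by (intro exI[of _ "1\<^sub>m n"]) auto
next
  case False
  define d where "d = x - y"
  have d: "d \<in> carrier_vec n" using x y by (simp add: d_def)
  have nd: "nsq d = 2 * Re (cinner d x)"
  proof -
    have "nsq x = nsq y" using eq by (simp add: cinner_self)
    then have "nsq d = 2 * nsq x - 2 * Re (cinner x y)"
      using nsq_diff[OF x y] by (simp add: d_def)
    moreover have "cinner d x = of_real (nsq x) - cinner y x"
      using x y by (simp add: d_def cinner_diff_left[of _ n] cinner_self)
    moreover have "Re (cinner y x) = Re (cinner x y)"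
      using cinner_commute[OF x y] by simp
    ultimately show ?thesis by simp
  qed
  have "d \<noteq> 0\<^sub>v n"
  proof
    assume "d = 0\<^sub>v n"
    then have "x $ i - y $ i = 0" if "i < n" for i
      using that x y unfolding d_def by (metis carrier_vecD index_minus_vec(1) index_zero_vec(1))
    then have "x $ i = y $ i" if "i < n" for i using that by simp
    then show False using False x y by (metis carrier_vecD eq_vecI)
  qed
  then have "nsq d \<noteq> 0" using nsq_eq_0[OF d] by simp
  then have dx: "cinner d x \<noteq> 0" using nd by auto
  define c where "c = 1 / cinner d x"
  define R where "R = 1\<^sub>m n - c \<cdot>\<^sub>m outer d d"
  have R: "R \<in> carrier_mat n n" using d by (auto simp: R_def outer_def)
  have Rv: "R *\<^sub>v v = v - (c * cinner d v) \<cdot>\<^sub>v d" if v: "v \<in> carrier_vec n" for v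
  proof (rule eq_vecI)
    fix i assume "i < dim_vec (v - (c * cinner d v) \<cdot>\<^sub>v d)"
    then have i: "i < n" using d v by simp
    have "(R *\<^sub>v v) $ i = (\<Sum>k<n. (if i = k then v $ k else 0) - c * d $ i * (cnj (d $ k) * v $ k))"
      using i d v R unfolding mult_mat_vec_index[OF R v i]
      by (intro sum.cong) (auto simp: R_def outer_def algebra_simps)
    also have "\<dots> = v $ i - c * d $ i * cinner d v"
      using i d v by (simp add: sum_subtractf cinner_def sum_distrib_left)
    finally show "(R *\<^sub>v v) $ i = (v - (c * cinner d v) \<cdot>\<^sub>v d) $ i"
      using i d v by simp
  qed (use R d v in auto)
  have cc: "c + cnj c = c * cnj c * of_real (nsq d)"
  proof -
    have "c + cnj c = (cinner d x + cnj (cinner d x)) / (cinner d x * cnj (cinner d x))"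
      using dx by (simp add: c_def field_simps)
    also have "cinner d x + cnj (cinner d x) = of_real (nsq d)"
      using nd by (simp add: complex_add_cnj)
    finally show ?thesis using dx by (simp add: c_def)
  qed
  have "unitary_mat n R"
  proof (rule unitary_matI[OF R])
    fix v w :: "complex vec" assume v: "v \<in> carrier_vec n" and w: "w \<in> carrier_vec n"
    have "cinner (R *\<^sub>v v) (R *\<^sub>v w) = cinner v w
       - (c + cnj c) * cnj (cinner d v) * cinner d w
       + c * cnj c * of_real (nsq d) * cnj (cinner d v) * cinner d w"
      using v w d cinner_commute[OF v d]
      by (simp add: Rv cinner_diff_left[of _ n] cinner_diff_right[of _ n] cinner_smult_left[of _ n]
          cinner_smult_right[of _ n] cinner_self algebra_simps)
    then show "cinner (R *\<^sub>v v) (R *\<^sub>v w) = cinner v w" by (simp add: cc)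
  qed
  moreover have "R *\<^sub>v x = y"
    using x y dx by (simp add: Rv c_def) (auto simp: d_def intro!: eq_vecI)
  \<comment> \<open>The condition says that \<open>v\<close> is orthogonal to \<open>d\<close>, and
    the reflection moves vectors only along \<open>d\<close>.\<close>
  moreover have "R *\<^sub>v v = v" if "v \<in> carrier_vec n" "cinner v x = cinner v y" for v
  proof -
    have "cinner v d = 0" using that x y by (simp add: d_def cinner_diff_right[of _ n])
    then have "cinner d v = 0" using cinner_commute[OF d that(1)] by simp
    then show ?thesis using that d by (simp add: Rv) (auto intro!: eq_vecI)
  qed
  ultimately show ?thesis by blast
qed

section \<open>Unitaries between families with equal Gram matrices\<close>

lemma unitary_mult:
  assumes "unitary_mat n U" "unitary_mat n V" shows "unitary_mat n (U * V)"
proof -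
  have c: "U \<in> carrier_mat n n" "V \<in> carrier_mat n n" using assms by (auto simp: unitary_mat_def)
  show ?thesis
    by (rule unitary_matI)
      (use c assms in \<open>auto simp: assoc_mult_mat_vec[of _ n n _ n] unitary_cinner[of n]\<close>)
qed

text \<open>Induction on the number of vectors: a unitary for the first \<open>m\<close> pairs is
  followed by a reflection taking the image of \<open>x m\<close> to \<open>y m\<close>. Equality of
  the Gram entries is exactly what makes this reflection fix the vectors \<open>y a\<close> already
  reached. Linearly dependent families are covered as well.\<close>

lemma unitary_of_gram_eq:
  fixes m :: nat and x y :: "nat \<Rightarrow> complex vec"
  assumes "\<forall>a<m. x a \<in> carrier_vec n \<and> y a \<in> carrier_vec n"
    and "\<forall>a<m. \<forall>b<m. cinner (x a) (x b) = cinner (y a) (y b)"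
  shows "\<exists>U. unitary_mat n U \<and> (\<forall>a<m. U *\<^sub>v x a = y a)"
  using assms
proof (induction m)
  case 0
  have "unitary_mat n (1\<^sub>m n)" by (intro unitary_matI) auto
  then show ?case by blast
next
  case (Suc m)
  then obtain U where U: "unitary_mat n U" and Ux: "\<forall>a<m. U *\<^sub>v x a = y a"
    by (meson less_SucI)
  have Uc: "U \<in> carrier_mat n n" using U by (simp add: unitary_mat_def)
  have xm: "x m \<in> carrier_vec n" and ym: "y m \<in> carrier_vec n" using Suc.prems by auto
  obtain R where R: "unitary_mat n R" and Rm: "R *\<^sub>v (U *\<^sub>v x m) = y m"
    and fixR: "\<forall>v\<in>carrier_vec n. cinner v (U *\<^sub>v x m) = cinner v (y m) \<longrightarrow> R *\<^sub>v v = v"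
    using unitary_fixing_and_mapping[of "U *\<^sub>v x m" n "y m"] Suc.prems(2) Uc xm ym
    by (auto simp: unitary_cinner[OF U])
  have Rc: "R \<in> carrier_mat n n" using R by (simp add: unitary_mat_def)
  have "(R * U) *\<^sub>v x a = y a" if "a < Suc m" for a
  proof (cases "a = m")
    case True
    then show ?thesis using Rm Rc Uc xm by (simp add: assoc_mult_mat_vec[of _ n n _ n])
  next
    case False
    then have a: "a < m" using that by simp
    have xa: "x a \<in> carrier_vec n" and ya: "y a \<in> carrier_vec n" using Suc.prems that by auto
    have "cinner (y a) (U *\<^sub>v x m) = cinner (x a) (x m)"
      using Ux a unitary_cinner[OF U xa xm] by simp
    also have "\<dots> = cinner (y a) (y m)" using Suc.prems(2) a by simp
    finally have "R *\<^sub>v y a = y a" using fixR ya by blast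
    then show ?thesis using Ux a xa Rc Uc by (simp add: assoc_mult_mat_vec[of _ n n _ n])
  qed
  then show ?case using unitary_mult[OF R U] by blast
qed

text \<open>Two purifications of one operator differ by a unitary on the purifying factor: the
  reduced operators are the Gram matrices of the blocks, so a single unitary matches all blocks at
  once.\<close>

lemma unitary_of_marg_eq:
  assumes x: "x \<in> carrier_vec (d * n)" and y: "y \<in> carrier_vec (d * n)" and eq: "marg d n x = marg d n y"
  obtains U where "unitary_mat n U" "kron (1\<^sub>m d) U *\<^sub>v x = y"
proof -
  have "cinner (blk n x a) (blk n x b) = cinner (blk n y a) (blk n y b)" if "a < d" "b < d" for a b
    using marg_cinner[OF x that(2,1)] marg_cinner[OF y that(2,1)] eq by metis
  then obtain U where U: "unitary_mat n U" "\<forall>a<d. U *\<^sub>v blk n x a = blk n y a"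
    using unitary_of_gram_eq[of d "blk n x" n "blk n y"] blk_carrier by blast
  have Uc: "U \<in> carrier_mat n n" using U(1) by (simp add: unitary_mat_def)
  have "kron (1\<^sub>m d) U *\<^sub>v x = y"
  proof (rule eq_vec_blk[OF _ y])
    show "kron (1\<^sub>m d) U *\<^sub>v x \<in> carrier_vec (d * n)" using Uc x by simp
    show "blk n (kron (1\<^sub>m d) U *\<^sub>v x) a = blk n y a" if "a < d" for a
      using that U(2) by (simp add: blk_kron[OF Uc x])
  qed
  then show ?thesis using that U by blast
qed

section \<open>Purification of positive operators\<close>

lemma cinner_unit_vec: "r < n \<Longrightarrow> x \<in> carrier_vec n \<Longrightarrow> cinner (unit_vec n r) x = x $ r"
proof -
  assume "r < n" "x \<in> carrier_vec n"
  then have "cinner (unit_vec n r) x = (\<Sum>i<n. if i = r then x $ i else 0)"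
    unfolding cinner_def by (intro sum.cong) (auto simp: unit_vec_def)
  then show ?thesis using \<open>r < n\<close> by simp
qed

text \<open>Polarization: \<open>psd_mat\<close> only demands real nonnegative values of the
  quadratic form. Its imaginary parts at \<open>v + w\<close> and \<open>v + \<i> w\<close> give the
  two real equations of Hermitian symmetry.\<close>

lemma psd_hermitian:
  assumes P: "psd_mat n P" and v: "v \<in> carrier_vec n" and w: "w \<in> carrier_vec n"
  shows "cinner w (P *\<^sub>v v) = cnj (cinner v (P *\<^sub>v w))"
proof -
  have Pc: "P \<in> carrier_mat n n"
    and real: "\<And>v. v \<in> carrier_vec n \<Longrightarrow> Im (cinner v (P *\<^sub>v v)) = 0"
    using P by (auto simp: psd_mat_def complex_is_Real_iff)
  have exp: "cinner (v + c \<cdot>\<^sub>v w) (P *\<^sub>v (v + c \<cdot>\<^sub>v w)) = cinner v (P *\<^sub>v v) + c * cinner v (P *\<^sub>v w)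
      + cnj c * cinner w (P *\<^sub>v v) + c * cnj c * cinner w (P *\<^sub>v w)" for c
    using Pc v w by (simp add: mult_add_distrib_mat_vec[of _ n n] mult_mat_vec[of _ n n]
        cinner_add_left[of _ n] cinner_add_right[of _ n] cinner_smult_left[of _ n]
        cinner_smult_right[of _ n] algebra_simps)
  have "Im (cinner v (P *\<^sub>v w)) + Im (cinner w (P *\<^sub>v v)) = 0"
    using real[of "v + 1 \<cdot>\<^sub>v w"] real[of v] real[of w] v w exp[of 1] by simp
  moreover have "Re (cinner v (P *\<^sub>v w)) - Re (cinner w (P *\<^sub>v v)) = 0"
    using real[of "v + \<i> \<cdot>\<^sub>v w"] real[of v] real[of w] v w exp[of \<i>] by simp
  ultimately show ?thesis by (simp add: complex_eq_iff)
qed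

lemma psd_quadratic_update:
  assumes P: "psd_mat n P" and v: "v \<in> carrier_vec n" and w: "w \<in> carrier_vec n"
  shows "Re (cinner v (P *\<^sub>v v)) + 2 * Re (c * cinner v (P *\<^sub>v w))
      + (cmod c)\<^sup>2 * Re (cinner w (P *\<^sub>v w)) \<ge> 0"
proof -
  have Pc: "P \<in> carrier_mat n n" using P by (auto simp: psd_mat_def)
  have "cinner (v + c \<cdot>\<^sub>v w) (P *\<^sub>v (v + c \<cdot>\<^sub>v w)) = cinner v (P *\<^sub>v v) + c * cinner v (P *\<^sub>v w)
      + cnj (c * cinner v (P *\<^sub>v w)) + c * cnj c * cinner w (P *\<^sub>v w)"
    using Pc v w psd_hermitian[OF P v w] by (simp add: mult_add_distrib_mat_vec[of _ n n] mult_mat_vec[of _ n n]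
        cinner_add_left[of _ n] cinner_add_right[of _ n] cinner_smult_left[of _ n]
        cinner_smult_right[of _ n] algebra_simps)
  moreover have "Re (cinner (v + c \<cdot>\<^sub>v w) (P *\<^sub>v (v + c \<cdot>\<^sub>v w))) \<ge> 0"
    using P v w by (auto simp: psd_mat_def)
  ultimately show ?thesis
    by (simp add: complex_norm_square[symmetric] del: of_real_power)
qed

text \<open>One step of Cholesky elimination: \<open>u\<close> is column \<open>r\<close> divided by
  the root of the pivot, and the remainder is the Schur complement. With zero pivot the whole column
  vanishes and \<open>u = 0\<close> works. The last clause keeps rows cleared earlier at
  zero.\<close>

lemma psd_factor_step:
  assumes P: "psd_mat n P" and r: "r < n"
  shows "\<exists>u\<in>carrier_vec n. psd_mat n (P - outer u u) \<and>
     (\<forall>i<n. (P - outer u u) $$ (i, r) = 0 \<and> (P - outer u u) $$ (r, i) = 0) \<and>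
     (\<forall>i<n. P $$ (i, r) = 0 \<longrightarrow> u $ i = 0)"
proof -
  have Pc: "P \<in> carrier_mat n n" using P by (auto simp: psd_mat_def)
  define e where "e = (unit_vec n r :: complex vec)"
  have e: "e \<in> carrier_vec n" by (simp add: e_def)
  define w where "w = P *\<^sub>v e"
  have w: "w \<in> carrier_vec n" using Pc e by (simp add: w_def)
  have wi: "w $ i = P $$ (i, r)" if "i < n" for i
    using that r Pc by (simp add: w_def e_def)
  define p where "p = Re (P $$ (r, r))"
  have pe: "cinner e (P *\<^sub>v e) = P $$ (r, r)"
    using r w wi[OF r] by (simp add: e_def[symmetric] w_def[symmetric]) (simp add: e_def cinner_unit_vec)
  have Prr: "P $$ (r, r) = of_real p" "p \<ge> 0"
    using P e pe by (auto simp: psd_mat_def p_def complex_is_Real_iff complex_eq_iff)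
  have herm: "P $$ (r, i) = cnj (P $$ (i, r))" if "i < n" for i
    using psd_hermitian[OF P, of "unit_vec n i" "unit_vec n r"] that r Pc by (simp add: cinner_unit_vec)
  show ?thesis
  proof (cases "p = 0")
    case True
    have "w $ i = 0" if "i < n" for i
    proof (rule ccontr)
      assume "w $ i \<noteq> 0"
      define z where "z = w $ i"
      have z: "(cmod z)\<^sup>2 > 0" using \<open>w $ i \<noteq> 0\<close> by (simp add: z_def)
      define q where "q = Re (cinner (unit_vec n i) (P *\<^sub>v unit_vec n i))"
      \<comment> \<open>With \<open>p = 0\<close> the quadratic term in \<open>c\<close> disappears
        and the form at \<open>unit_vec n i + c e\<close> is \<open>q + 2 Re (c z)\<close>. For
        \<open>c = - s cnj z\<close> it equals \<open>q - 2 (\<bar>q\<bar> + 1)\<close>, which is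
        negative.\<close>
      define s where "s = (\<bar>q\<bar> + 1) / (cmod z)\<^sup>2"
      have "cinner (unit_vec n i) (P *\<^sub>v e) = z"
        using that w by (simp add: cinner_unit_vec z_def w_def)
      moreover have "Re (- of_real s * cnj z * z) = - (\<bar>q\<bar> + 1)"
      proof -
        have "cnj z * z = of_real ((cmod z)\<^sup>2)" by (metis complex_norm_square mult.commute)
        then have "- of_real s * cnj z * z = of_real (- (s * (cmod z)\<^sup>2))"
          by (simp only: mult.assoc mult_minus_left of_real_minus of_real_mult)
        then show ?thesis using z by (simp add: s_def del: of_real_power)
      qed
      ultimately show False
        using psd_quadratic_update[OF P _ e, of "unit_vec n i" "- of_real s * cnj z"] that pe Prr True
        by (simp add: q_def)
    qed
    then have "P - outer (0\<^sub>v n) (0\<^sub>v n) = P" "\<And>i. i < n \<Longrightarrow> P $$ (i, r) = 0"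
      using Pc wi by (auto simp: outer_def intro!: eq_matI)
    then show ?thesis using P herm by (intro bexI[of _ "0\<^sub>v n"]) auto
  next
    case False
    then have p: "p > 0" using Prr by simp
    define u where "u = of_real (1 / sqrt p) \<cdot>\<^sub>v w"
    have u: "u \<in> carrier_vec n" using w by (simp add: u_def)
    have sq: "of_real (1 / sqrt p) * of_real (1 / sqrt p) = (1 / of_real p :: complex)"
      using p by (simp add: of_real_mult[symmetric] del: of_real_mult)
    have ou: "outer u u $$ (i, j) = w $ i * cnj (w $ j) / of_real p" if "i < n" "j < n" for i j
    proof -
      have "outer u u $$ (i, j) = (of_real (1 / sqrt p) * of_real (1 / sqrt p)) * (w $ i * cnj (w $ j))"
        using that w by (simp add: outer_def u_def)
      then show ?thesis by (simp only: sq) simp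
    qed
    have uc: "outer u u \<in> carrier_mat n n" using u by (simp add: outer_def)
    have "psd_mat n (P - outer u u)"
      unfolding psd_mat_def
    proof (intro conjI ballI)
      show "P - outer u u \<in> carrier_mat n n" using uc by (rule minus_carrier_mat)
      fix v :: "complex vec" assume v: "v \<in> carrier_vec n"
      have ov: "outer u u *\<^sub>v v = cinner u v \<cdot>\<^sub>v u"
        using u v by (intro eq_vecI) (auto simp: outer_def scalar_prod_def cinner_def lessThan_atLeast0 sum_distrib_left mult_ac)
      have "cinner v u = cnj (cinner u v)" using cinner_commute[OF v u] .
      then have q: "cinner v ((P - outer u u) *\<^sub>v v) = cinner v (P *\<^sub>v v) - of_real ((cmod (cinner u v))\<^sup>2)"
        using Pc uc v u by (simp add: minus_mult_distrib_mat_vec[of _ n n] ov cinner_diff_right[of _ n]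
            cinner_smult_right[of _ n] complex_norm_square del: of_real_power)
      have real: "cinner v (P *\<^sub>v v) \<in> \<real>" using P v by (auto simp: psd_mat_def)
      then show "cinner v ((P - outer u u) *\<^sub>v v) \<in> \<real>" by (auto simp: q simp del: of_real_power)
      define t where "t = cinner v w"
      have t: "(cmod (cinner u v))\<^sup>2 = (cmod t)\<^sup>2 / p"
        using w v p cinner_commute[OF v w]
        by (simp add: u_def cinner_smult_left[of _ n] t_def norm_mult norm_divide power_mult_distrib power_divide)
      \<comment> \<open>The factor \<open>- cnj t / p\<close> minimizes the quadratic of
        \<open>psd_quadratic_update\<close> in \<open>c\<close>; the minimum is the form of
        \<open>P\<close> at \<open>v\<close> minus \<open>(cmod t)\<^sup>2 / p\<close>, that is, the
        form of the Schur complement.\<close>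
      have a1: "Re (- (cnj t / of_real p) * t) = - (cmod t)\<^sup>2 / p"
      proof -
        have "cnj t * t = of_real ((cmod t)\<^sup>2)" by (metis complex_norm_square mult.commute)
        then have "- (cnj t / of_real p) * t = of_real (- ((cmod t)\<^sup>2 / p))"
          by (simp only: mult_minus_left times_divide_eq_left of_real_minus of_real_divide)
        then show ?thesis by (simp only: Re_complex_of_real minus_divide_left)
      qed
      have a2: "(cmod (- (cnj t / of_real p)))\<^sup>2 * p = (cmod t)\<^sup>2 / p"
        using p by (simp add: norm_divide power_divide power2_eq_square)
      have "Re (cinner e w) = p" using pe Prr by (simp add: w_def)
      then have "0 \<le> Re (cinner v (P *\<^sub>v v)) + 2 * Re (- (cnj t / of_real p) * t)
          + (cmod (- (cnj t / of_real p)))\<^sup>2 * p"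
        using psd_quadratic_update[OF P v e, of "- (cnj t / of_real p)"]
        by (simp only: w_def[symmetric] t_def[symmetric])
      then have "Re (cinner v (P *\<^sub>v v)) + 2 * (- (cmod t)\<^sup>2 / p) + (cmod t)\<^sup>2 / p \<ge> 0"
        by (simp only: a1 a2)
      then show "0 \<le> Re (cinner v ((P - outer u u) *\<^sub>v v))"
        by (simp add: q t del: of_real_power)
    qed
    moreover have "(P - outer u u) $$ (i, r) = 0 \<and> (P - outer u u) $$ (r, i) = 0" if "i < n" for i
      using that r Pc uc p Prr herm[OF that] by (simp add: ou wi)
    moreover have "u $ i = 0" if "i < n" "P $$ (i, r) = 0" for i
      using that w by (simp add: u_def wi)
    ultimately show ?thesis using u by blast
  qed
qed

text \<open>Cholesky factorization by induction on \<open>k\<close>, the number of trailing rows and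
  columns that may be nonzero; each step clears the first of them. For \<open>k = n\<close> the
  support condition is void.\<close>

lemma psd_factor:
  assumes "psd_mat n P" "\<forall>i<n. \<forall>j<n. i < n - k \<or> j < n - k \<longrightarrow> P $$ (i, j) = 0"
  shows "\<exists>X. \<forall>i<n. \<forall>j<n. P $$ (i, j) = (\<Sum>h<k. X i h * cnj (X j h))"
  using assms
proof (induction k arbitrary: P)
  case 0
  then show ?case by auto
next
  case (Suc k)
  show ?case
  proof (cases "k < n")
    case False
    then obtain X where "\<forall>i<n. \<forall>j<n. P $$ (i, j) = (\<Sum>h<k. X i h * cnj (X j h))"
      using Suc.IH[of P] Suc.prems by auto
    \<comment> \<open>Here both \<open>n - k\<close> and \<open>n - Suc k\<close> are 0 by truncated
      subtraction, so a factor with \<open>k\<close> columns exists and is padded with a zero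
      column.\<close>
    then show ?thesis
      by (intro exI[of _ "\<lambda>i h. if h = k then 0 else X i h"]) (auto intro!: sum.cong)
  next
    case True
    define r where "r = n - Suc k"
    have r: "r < n" "n - k = Suc r" using True by (auto simp: r_def)
    have Pc: "P \<in> carrier_mat n n" using Suc.prems by (auto simp: psd_mat_def)
    obtain u where u: "u \<in> carrier_vec n" and psd: "psd_mat n (P - outer u u)"
      and zr: "\<forall>i<n. (P - outer u u) $$ (i, r) = 0 \<and> (P - outer u u) $$ (r, i) = 0"
      and zu: "\<forall>i<n. P $$ (i, r) = 0 \<longrightarrow> u $ i = 0"
      using psd_factor_step[OF Suc.prems(1) r(1)] by blast
    have ui: "u $ i = 0" if "i < r" for i using that zu Suc.prems(2) r by (auto simp: r_def)
    have Q: "(P - outer u u) $$ (i, j) = P $$ (i, j) - u $ i * cnj (u $ j)" if "i < n" "j < n" for i j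
      using that u Pc by (simp add: outer_def)
    have "\<forall>i<n. \<forall>j<n. i < n - k \<or> j < n - k \<longrightarrow> (P - outer u u) $$ (i, j) = 0"
    proof (intro allI impI)
      fix i j assume ij: "i < n" "j < n" "i < n - k \<or> j < n - k"
      then consider "i = r" | "j = r" | "i < r \<or> j < r" using r by linarith
      then show "(P - outer u u) $$ (i, j) = 0"
      proof cases
        case 3
        then have "P $$ (i, j) = 0" using Suc.prems(2) ij by (auto simp: r_def)
        then show ?thesis using 3 ij ui Q by auto
      qed (use zr ij in auto)
    qed
    then obtain X where X: "\<forall>i<n. \<forall>j<n. (P - outer u u) $$ (i, j) = (\<Sum>h<k. X i h * cnj (X j h))"
      using Suc.IH[OF psd] by blast
    have "P $$ (i, j) = (\<Sum>h<Suc k. ((X i)(k := u $ i)) h * cnj (((X j)(k := u $ j)) h))" if "i < n" "j < n" for i j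
    proof -
      have "(\<Sum>h<k. ((X i)(k := u $ i)) h * cnj (((X j)(k := u $ j)) h)) = (\<Sum>h<k. X i h * cnj (X j h))"
        by (intro sum.cong) auto
      then show ?thesis using X Q[OF that] that by (simp add: algebra_simps)
    qed
    then show ?thesis by (intro exI[of _ "\<lambda>i. (X i)(k := u $ i)"]) blast
  qed
qed

text \<open>The columns of a factor become the components along the purifying factor, padded with
  zeros from \<open>n\<close> to \<open>m\<close>.\<close>

lemma psd_purification:
  assumes "psd_mat n P" "n \<le> m"
  obtains x where "x \<in> carrier_vec (n * m)" "marg n m x = P"
proof -
  have Pc: "P \<in> carrier_mat n n" using assms by (simp add: psd_mat_def)
  obtain X where X: "\<forall>i<n. \<forall>j<n. P $$ (i, j) = (\<Sum>h<n. X i h * cnj (X j h))"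
    using psd_factor[OF assms(1), of n] by auto
  define x where "x = vec (n * m) (\<lambda>t. if t mod m < n then X (t div m) (t mod m) else 0)"
  have x: "x \<in> carrier_vec (n * m)" by (simp add: x_def)
  have "marg n m x $$ (i, j) = P $$ (i, j)" if "i < n" "j < n" for i j
  proof -
    have "marg n m x $$ (i, j) = (\<Sum>h<m. x $ (i * m + h) * cnj (x $ (j * m + h)))"
      using that by (rule marg_index[OF x])
    also have "\<dots> = (\<Sum>h<m. if h < n then X i h * cnj (X j h) else 0)"
      using that by (intro sum.cong) (auto simp: x_def index_less)
    also have "\<dots> = (\<Sum>h\<in>{..<m} \<inter> {h. h < n}. X i h * cnj (X j h))"
      by (simp add: sum.inter_restrict)
    also have "{..<m} \<inter> {h. h < n} = {..<n}" using assms by auto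
    finally show ?thesis using X that by simp
  qed
  then have "marg n m x = P" using Pc by (intro eq_matI) auto
  then show ?thesis using x that by blast
qed

text \<open>The partial inner product (\<langle>v| \<otimes> I) x.\<close>

definition contract_left :: "nat \<Rightarrow> nat \<Rightarrow> complex vec \<Rightarrow> complex vec \<Rightarrow> complex vec" where
  "contract_left d n v x = vec n (\<lambda>h. \<Sum>a<d. cnj (v $ a) * x $ (a * n + h))"

lemma contract_left_kron:
  assumes K: "K \<in> carrier_mat n n" and x: "x \<in> carrier_vec (d * n)"
  shows "contract_left d n v (kron (1\<^sub>m d) K *\<^sub>v x) = K *\<^sub>v contract_left d n v x"
proof (rule eq_vecI)
  fix h assume "h < dim_vec (K *\<^sub>v contract_left d n v x)"
  then have h: "h < n" using K by simp
  have "contract_left d n v (kron (1\<^sub>m d) K *\<^sub>v x) $ h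
      = (\<Sum>a<d. \<Sum>k<n. K $$ (h, k) * (cnj (v $ a) * x $ (a * n + k)))"
    using h K x by (simp add: contract_left_def kron_one_left_index sum_distrib_left mult_ac)
  also have "\<dots> = (\<Sum>k<n. \<Sum>a<d. K $$ (h, k) * (cnj (v $ a) * x $ (a * n + k)))"
    by (rule sum.swap)
  also have "\<dots> = (K *\<^sub>v contract_left d n v x) $ h"
    using h K by (subst mult_mat_vec_index[where m = n and n = n]) (auto simp: contract_left_def sum_distrib_left)
  finally show "contract_left d n v (kron (1\<^sub>m d) K *\<^sub>v x) $ h = (K *\<^sub>v contract_left d n v x) $ h" .
qed (use K in \<open>auto simp: contract_left_def\<close>)

text \<open>The form of the reduced operator at \<open>v\<close> is the squared norm of (\<langle>v|
  \<otimes> I) x. Partial inner products commute with the action of \<open>K\<close>, which shortens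
  them. What is lost is thus a positive operator and can be purified.\<close>

lemma psd_marg_deficit:
  assumes K: "contraction_mat n K" and x: "x \<in> carrier_vec (d * n)"
  shows "psd_mat d (marg d n x - marg d n (kron (1\<^sub>m d) K *\<^sub>v x))"
proof -
  have Kc: "K \<in> carrier_mat n n" using K by (simp add: contraction_mat_def)
  have cm: "cinner v (marg d n y *\<^sub>v v) = of_real (nsq (contract_left d n v y))"
    if "v \<in> carrier_vec d" "y \<in> carrier_vec (d * n)" for v y
    using cinner_marg[OF that(2,1)] by (simp add: nsq_def contract_left_def)
  have le: "nsq (contract_left d n v (kron (1\<^sub>m d) K *\<^sub>v x)) \<le> nsq (contract_left d n v x)" for v
    using K contract_left_kron[OF Kc x] by (auto simp: contraction_mat_def contract_left_def)
  have "cinner v ((marg d n x - marg d n (kron (1\<^sub>m d) K *\<^sub>v x)) *\<^sub>v v)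
      = of_real (nsq (contract_left d n v x) - nsq (contract_left d n v (kron (1\<^sub>m d) K *\<^sub>v x)))"
    if v: "v \<in> carrier_vec d" for v
  proof -
    have "(marg d n x - marg d n (kron (1\<^sub>m d) K *\<^sub>v x)) *\<^sub>v v
        = marg d n x *\<^sub>v v - marg d n (kron (1\<^sub>m d) K *\<^sub>v x) *\<^sub>v v"
      using v by (intro minus_mult_distrib_mat_vec[of _ d d]) auto
    moreover have "marg d n y *\<^sub>v v \<in> carrier_vec d" for y
      using v by (intro mult_mat_vec_carrier[of _ d d]) auto
    ultimately show ?thesis using v Kc x by (simp add: cinner_diff_right[of _ d] cm)
  qed
  then show ?thesis using le by (auto simp: psd_mat_def)
qed

section \<open>Compactness and closest points\<close>

text \<open>Bolzano-Weierstrass from monotone subsequences, first for the real and then for the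
  imaginary parts.\<close>

lemma bounded_complex_subseq:
  fixes f :: "nat \<Rightarrow> complex"
  assumes "\<And>k. cmod (f k) \<le> B"
  shows "\<exists>r l. strict_mono r \<and> (\<lambda>k. f (r k)) \<longlonglongrightarrow> l"
proof -
  obtain r1 :: "nat \<Rightarrow> nat" where r1: "strict_mono r1" "monoseq (\<lambda>k. Re (f (r1 k)))"
    using seq_monosub[of "\<lambda>k. Re (f k)"] by auto
  obtain r2 :: "nat \<Rightarrow> nat" where r2: "strict_mono r2" "monoseq (\<lambda>k. Im (f (r1 (r2 k))))"
    using seq_monosub[of "\<lambda>k. Im (f (r1 k))"] by auto
  have "Bseq (\<lambda>k. Re (f (r1 k)))" "Bseq (\<lambda>k. Im (f (r1 (r2 k))))"
    using order_trans[OF abs_Re_le_cmod assms] order_trans[OF abs_Im_le_cmod assms] by (auto intro!: BseqI'[of _ B])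
  then obtain a b where "(\<lambda>k. Re (f (r1 k))) \<longlonglongrightarrow> a" and b: "(\<lambda>k. Im (f (r1 (r2 k)))) \<longlonglongrightarrow> b"
    using Bseq_monoseq_convergent r1 r2 unfolding convergent_def by blast
  then have "(\<lambda>k. Re (f (r1 (r2 k)))) \<longlonglongrightarrow> a"
    using LIMSEQ_subseq_LIMSEQ[OF _ r2(1), of "\<lambda>k. Re (f (r1 k))" a] by (simp add: o_def)
  then have "(\<lambda>k. f (r1 (r2 k))) \<longlonglongrightarrow> Complex a b"
    using b by (simp add: tendsto_complex_iff)
  moreover have "strict_mono (r1 \<circ> r2)" using r1 r2 by (simp add: strict_mono_o)
  ultimately show ?thesis by (intro exI[of _ "r1 \<circ> r2"] exI[of _ "Complex a b"]) simp
qed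

text \<open>Subsequences are refined once per index; limits already obtained survive each
  refinement.\<close>

lemma bounded_family_subseq:
  fixes f :: "nat \<Rightarrow> 'i \<Rightarrow> complex"
  assumes "finite I" "\<forall>k. \<forall>i\<in>I. cmod (f k i) \<le> B"
  shows "\<exists>r l. strict_mono r \<and> (\<forall>i\<in>I. (\<lambda>k. f (r k) i) \<longlonglongrightarrow> l i)"
  using assms
proof (induction I rule: finite_induct)
  case empty
  show ?case by (intro exI[of _ id]) (simp add: strict_mono_def)
next
  case (insert j I)
  then obtain r l where r: "strict_mono r" and l: "\<forall>i\<in>I. (\<lambda>k. f (r k) i) \<longlonglongrightarrow> l i"
    by auto
  obtain r' m where r': "strict_mono r'" and m: "(\<lambda>k. f (r (r' k)) j) \<longlonglongrightarrow> m"
    using bounded_complex_subseq[of "\<lambda>k. f (r k) j" B] insert.prems by auto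
  have "(\<lambda>k. f (r (r' k)) i) \<longlonglongrightarrow> l i" if "i \<in> I" for i
    using LIMSEQ_subseq_LIMSEQ[OF _ r', of "\<lambda>k. f (r k) i" "l i"] l that by (simp add: o_def)
  moreover have "strict_mono (\<lambda>k. r (r' k))" using strict_mono_o[OF r r'] by (simp add: o_def)
  ultimately show ?case using m insert.hyps
    by (intro exI[of _ "\<lambda>k. r (r' k)"] exI[of _ "l(j := m)"]) auto
qed

text \<open>Compactness: the entries of contractions are bounded, entrywise limits of contractions
  are contractions, and the distance is continuous in the entries. A minimizing sequence therefore
  has a subsequence converging to a minimizer.\<close>

lemma closest_contraction:
  assumes x: "x \<in> carrier_vec (d * n)" and z: "z \<in> carrier_vec (d * n)"
  obtains K where "contraction_mat n K"
    and "\<And>M. contraction_mat n M \<Longrightarrow> nsq (z - kron (1\<^sub>m d) K *\<^sub>v x) \<le> nsq (z - kron (1\<^sub>m d) M *\<^sub>v x)"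
proof -
  define g where "g M = nsq (z - kron (1\<^sub>m d) M *\<^sub>v x)" for M
  have g: "g M = (\<Sum>a<d. \<Sum>h<n. (cmod (z $ (a * n + h) - (\<Sum>k<n. M $$ (h, k) * x $ (a * n + k))))\<^sup>2)"
    if "M \<in> carrier_mat n n" for M
  proof -
    have "z - kron (1\<^sub>m d) M *\<^sub>v x \<in> carrier_vec (d * n)" using that x z by simp
    from nsq_split[OF this] show ?thesis
      using that x z by (simp add: g_def index_less kron_one_left_index del: index_mult_mat_vec)
  qed
  have one: "contraction_mat n (1\<^sub>m n)" by (auto simp: contraction_mat_def)
  define S where "S = g ` {M. contraction_mat n M}"
  have S: "S \<noteq> {}" "bdd_below S" using one by (auto simp: S_def g_def intro!: bdd_belowI[of _ 0])
  have "\<exists>M. contraction_mat n M \<and> g M < Inf S + 1 / real (Suc k)" for k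
    using cInf_lessD[OF S(1), of "Inf S + 1 / real (Suc k)"] by (auto simp: S_def)
  then obtain Ms where Ms: "\<And>k. contraction_mat n (Ms k)" "\<And>k. g (Ms k) < Inf S + 1 / real (Suc k)"
    by metis
  have Mc: "Ms k \<in> carrier_mat n n" for k using Ms(1) by (auto simp: contraction_mat_def)
  have bound: "cmod (Ms k $$ (i, j)) \<le> 1" if "i < n" "j < n" for k i j
  \<comment> \<open>Column \<open>j\<close> is the image of a unit vector and so has norm at most
    1.\<close>
  proof -
    have "(cmod ((Ms k *\<^sub>v unit_vec n j) $ i))\<^sup>2 \<le> nsq (Ms k *\<^sub>v unit_vec n j)"
      unfolding nsq_def using Mc[of k] that by (intro member_le_sum[of i]) auto
    also have "\<dots> \<le> nsq (unit_vec n j)" using Ms(1)[of k] by (simp add: contraction_mat_def)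
    also have "\<dots> = (\<Sum>i<n. if i = j then 1 else 0)"
      unfolding nsq_def by (intro sum.cong) (auto simp: unit_vec_def)
    also have "\<dots> = 1" using that by simp
    finally show ?thesis using Mc[of k] that by (simp add: power_le_one_iff)
  qed
  have "\<forall>k. \<forall>p\<in>{..<n} \<times> {..<n}. cmod (Ms k $$ p) \<le> 1" using bound by auto
  then obtain r l where r: "strict_mono r"
    and l: "\<forall>p\<in>{..<n} \<times> {..<n}. (\<lambda>k. Ms (r k) $$ p) \<longlonglongrightarrow> l p"
    using bounded_family_subseq[of "{..<n} \<times> {..<n}" "\<lambda>k p. Ms k $$ p" 1] by auto
  have lim: "(\<lambda>k. Ms (r k) $$ (i, j)) \<longlonglongrightarrow> l (i, j)" if "i < n" "j < n" for i j
    using l that by auto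
  define K where "K = mat n n l"
  have Kc: "K \<in> carrier_mat n n" by (simp add: K_def)
  have "contraction_mat n K"
    unfolding contraction_mat_def
  proof (intro conjI Kc ballI)
    fix v :: "complex vec" assume v: "v \<in> carrier_vec n"
    have nv: "nsq (M *\<^sub>v v) = (\<Sum>i<n. (cmod (\<Sum>j<n. M $$ (i, j) * v $ j))\<^sup>2)" if "M \<in> carrier_mat n n" for M
      using that v by (simp add: nsq_def mult_mat_vec_index[where m = n and n = n] del: index_mult_mat_vec)
    have "(\<lambda>k. nsq (Ms (r k) *\<^sub>v v)) \<longlonglongrightarrow> nsq (K *\<^sub>v v)"
      unfolding nv[OF Mc] nv[OF Kc]
      by (intro tendsto_intros) (auto simp: K_def intro!: lim)
    moreover have "\<forall>k. nsq (Ms (r k) *\<^sub>v v) \<le> nsq v"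
      using Ms(1) v by (auto simp: contraction_mat_def)
    ultimately show "nsq (K *\<^sub>v v) \<le> nsq v" by (intro LIMSEQ_le_const2) auto
  qed
  moreover have "g K \<le> g M" if "contraction_mat n M" for M
  proof -
    have 1: "(\<lambda>k. g (Ms (r k))) \<longlonglongrightarrow> g K"
      unfolding g[OF Mc] g[OF Kc]
      by (intro tendsto_intros) (auto simp: K_def intro!: lim)
    have "(\<lambda>k. 1 / real (Suc (r k))) \<longlonglongrightarrow> 0"
      using LIMSEQ_subseq_LIMSEQ[OF lim_1_over_n[THEN LIMSEQ_Suc] r] by (simp add: o_def)
    then have 2: "(\<lambda>k. Inf S + 1 / real (Suc (r k))) \<longlonglongrightarrow> Inf S + 0"
      by (intro tendsto_intros)
    have "g K \<le> Inf S + 0"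
      by (rule LIMSEQ_le[OF 1 2]) (use Ms(2) in \<open>auto intro!: exI[of _ 0] less_imp_le\<close>)
    also have "\<dots> \<le> g M" using that S by (auto simp: S_def intro: cInf_lower)
    finally show ?thesis .
  qed
  ultimately show ?thesis using that unfolding g_def by blast
qed

section \<open>The idle subspace\<close>

text \<open>The index is read as ((a,b),c) when L acts on A \<otimes> B and as (a,(b,c)) when an
  operator acts on B \<otimes> C; this switches between the two.\<close>

lemma index3: "(a * m + b) * n + c = a * (m * n) + (b * n + (c::nat))"
  by (simp add: algebra_simps)

lemma index3_div_mod:
  assumes "b < m" "c < (n::nat)"
  shows "((a * m + b) * n + c) div n div m = a" "((a * m + b) * n + c) div n mod m = b"
    "((a * m + b) * n + c) mod n = c"
  using assms by auto

lemma eq_vec_split3: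
  assumes "x \<in> carrier_vec (d * m * n)" "y \<in> carrier_vec (d * m * n)"
    and "\<And>a b c. a < d \<Longrightarrow> b < m \<Longrightarrow> c < n \<Longrightarrow> x $ ((a * m + b) * n + c) = y $ ((a * m + b) * n + c)"
  shows "x = y"
proof (rule eq_vec_split[OF assms(1,2)])
  fix i c assume i: "i < d * m" and c: "c < n"
  then have "m > 0" by (cases m) auto
  then have "i div m < d" "i mod m < m" using i by (auto simp: less_mult_imp_div_less)
  from assms(3)[OF this c] show "x $ (i * n + c) = y $ (i * n + c)" by simp
qed

text \<open>\<open>put_idle J\<close> is \<open>|idle\<rangle> \<otimes> J\<close> and \<open>take_idle\<close> is its adjoint \<open>\<langle>idle|\<close>, both
  acting on the middle tensor factor.\<close>

definition put_idle :: "nat \<Rightarrow> nat \<Rightarrow> nat \<Rightarrow> complex vec \<Rightarrow> complex vec \<Rightarrow> complex vec" where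
  "put_idle d m n idle J = vec (d * m * n) (\<lambda>t. idle $ (t div n mod m) * J $ (t div n div m * n + t mod n))"

definition take_idle :: "nat \<Rightarrow> nat \<Rightarrow> nat \<Rightarrow> complex vec \<Rightarrow> complex vec \<Rightarrow> complex vec" where
  "take_idle d m n idle x = vec (d * n) (\<lambda>t. \<Sum>b<m. cnj (idle $ b) * x $ ((t div n * m + b) * n + t mod n))"

text \<open>For a unit vector \<open>idle\<close>, the component orthogonal to the idle
  subspace.\<close>

definition non_idle :: "nat \<Rightarrow> nat \<Rightarrow> nat \<Rightarrow> complex vec \<Rightarrow> complex vec \<Rightarrow> complex vec" where
  "non_idle d m n idle x = x - put_idle d m n idle (take_idle d m n idle x)"

lemma put_idle_carrier [simp]: "put_idle d m n idle J \<in> carrier_vec (d * m * n)"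
  and dim_put_idle [simp]: "dim_vec (put_idle d m n idle J) = d * m * n"
  by (simp_all add: put_idle_def)

lemma take_idle_carrier [simp]: "take_idle d m n idle x \<in> carrier_vec (d * n)"
  and dim_take_idle [simp]: "dim_vec (take_idle d m n idle x) = d * n"
  by (simp_all add: take_idle_def)

lemma non_idle_carrier [simp]: "x \<in> carrier_vec (d * m * n) \<Longrightarrow> non_idle d m n idle x \<in> carrier_vec (d * m * n)"
  by (simp add: non_idle_def)

lemma put_idle_index:
  assumes "a < d" "b < m" "c < n"
  shows "put_idle d m n idle J $ ((a * m + b) * n + c) = idle $ b * J $ (a * n + c)"
  using assms index3_div_mod[OF assms(2,3), of a] by (simp add: put_idle_def index_less)

lemma take_idle_index:
  assumes "a < d" "c < n"
  shows "take_idle d m n idle x $ (a * n + c) = (\<Sum>b<m. cnj (idle $ b) * x $ ((a * m + b) * n + c))"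
  using assms by (simp add: take_idle_def index_less)

lemma cinner_put_idle:
  assumes "J \<in> carrier_vec (d * n)" "x \<in> carrier_vec (d * m * n)"
  shows "cinner (put_idle d m n idle J) x = cinner J (take_idle d m n idle x)"
proof -
  have "cinner (put_idle d m n idle J) x
      = (\<Sum>a<d. \<Sum>b<m. \<Sum>c<n. cnj (J $ (a * n + c)) * (cnj (idle $ b) * x $ ((a * m + b) * n + c)))"
    unfolding cinner_def dim_put_idle sum_index_split
    by (intro sum.cong refl) (simp add: put_idle_index)
  also have "\<dots> = (\<Sum>a<d. \<Sum>c<n. \<Sum>b<m. cnj (J $ (a * n + c)) * (cnj (idle $ b) * x $ ((a * m + b) * n + c)))"
    by (rule sum.cong[OF refl]) (rule sum.swap)
  also have "\<dots> = cinner J (take_idle d m n idle x)"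
    using assms by (simp add: cinner_def sum_index_split take_idle_index sum_distrib_left)
  finally show ?thesis .
qed

lemma idle_sum_one:
  assumes "idle \<in> carrier_vec m" "cnorm idle = 1"
  shows "(\<Sum>b<m. cnj (idle $ b) * idle $ b) = 1"
proof -
  have "nsq idle = 1" using assms(2) by (simp add: cnorm_sqrt)
  then show ?thesis using assms(1) cinner_self[of idle] by (simp add: cinner_def)
qed

lemma take_put_idle:
  assumes "idle \<in> carrier_vec m" "cnorm idle = 1" "J \<in> carrier_vec (d * n)"
  shows "take_idle d m n idle (put_idle d m n idle J) = J"
proof (rule eq_vec_split[OF _ assms(3)])
  fix a c assume ac: "a < d" "c < n"
  have "take_idle d m n idle (put_idle d m n idle J) $ (a * n + c)
      = (\<Sum>b<m. cnj (idle $ b) * idle $ b) * J $ (a * n + c)"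
    using ac by (simp add: take_idle_index put_idle_index sum_distrib_right mult.assoc)
  then show "take_idle d m n idle (put_idle d m n idle J) $ (a * n + c) = J $ (a * n + c)"
    by (simp add: idle_sum_one[OF assms(1,2)])
qed simp

lemma take_idle_diff:
  assumes "x \<in> carrier_vec (d * m * n)" "y \<in> carrier_vec (d * m * n)"
  shows "take_idle d m n idle (x - y) = take_idle d m n idle x - take_idle d m n idle y"
  by (rule eq_vec_split[of _ d n])
    (use assms in \<open>auto simp: take_idle_index index_less right_diff_distrib sum_subtractf\<close>)

lemma take_idle_add:
  assumes "x \<in> carrier_vec (d * m * n)" "y \<in> carrier_vec (d * m * n)"
  shows "take_idle d m n idle (x + y) = take_idle d m n idle x + take_idle d m n idle y"
  by (rule eq_vec_split[of _ d n])
    (use assms in \<open>auto simp: take_idle_index index_less distrib_left sum.distrib\<close>)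

lemma take_idle_smult:
  assumes "x \<in> carrier_vec (d * m * n)"
  shows "take_idle d m n idle (c \<cdot>\<^sub>v x) = c \<cdot>\<^sub>v take_idle d m n idle x"
  by (rule eq_vec_split[of _ d n])
    (use assms in \<open>auto simp: take_idle_index index_less sum_distrib_left mult.left_commute\<close>)

lemma take_non_idle:
  assumes "idle \<in> carrier_vec m" "cnorm idle = 1" "x \<in> carrier_vec (d * m * n)"
  shows "take_idle d m n idle (non_idle d m n idle x) = 0\<^sub>v (d * n)"
  using assms by (simp add: non_idle_def take_idle_diff take_put_idle)

lemma nsq_put_idle:
  assumes "idle \<in> carrier_vec m" "cnorm idle = 1" "J \<in> carrier_vec (d * n)"
  shows "nsq (put_idle d m n idle J) = nsq J"
  using cinner_put_idle[of J d n "put_idle d m n idle J" m idle] assms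
  by (simp add: take_put_idle cinner_self)

lemma nsq_non_idle:
  assumes "idle \<in> carrier_vec m" "cnorm idle = 1" "x \<in> carrier_vec (d * m * n)"
  shows "nsq (non_idle d m n idle x) = nsq x - nsq (take_idle d m n idle x)"
proof -
  have "cinner x (put_idle d m n idle (take_idle d m n idle x)) = of_real (nsq (take_idle d m n idle x))"
    using cinner_commute[of x "d * m * n" "put_idle d m n idle (take_idle d m n idle x)"]
      cinner_put_idle[of "take_idle d m n idle x" d n x m idle] assms
    by (simp add: cinner_self)
  then show ?thesis
    using nsq_diff[of x "d * m * n" "put_idle d m n idle (take_idle d m n idle x)"] assms
    by (simp add: non_idle_def nsq_put_idle)
qed

text \<open>\<open>non_idle\<close> is an orthogonal projection, so the idle component of
  \<open>x\<close> contributes nothing.\<close>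

lemma cinner_non_idle:
  assumes "idle \<in> carrier_vec m" "cnorm idle = 1" "x \<in> carrier_vec (d * m * n)" "y \<in> carrier_vec (d * m * n)"
  shows "cinner x (non_idle d m n idle y) = cinner (non_idle d m n idle x) (non_idle d m n idle y)"
proof -
  have "cinner (put_idle d m n idle (take_idle d m n idle x)) (non_idle d m n idle y) = 0"
    using assms by (simp add: cinner_put_idle take_non_idle) (simp add: cinner_def)
  moreover have "cinner (non_idle d m n idle x) (non_idle d m n idle y) = cinner x (non_idle d m n idle y)
      - cinner (put_idle d m n idle (take_idle d m n idle x)) (non_idle d m n idle y)"
    unfolding non_idle_def[of d m n idle x] by (intro cinner_diff_left) (use assms in auto)
  ultimately show ?thesis by simp
qed

lemma P_idle_mult:
  assumes idle: "idle \<in> carrier_vec m" and x: "x \<in> carrier_vec (d * m * n)"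
  shows "P_idle d n idle *\<^sub>v x = put_idle d m n idle (take_idle d m n idle x)"
proof -
  have oc: "outer idle idle \<in> carrier_mat m m" using idle by (simp add: outer_def)
  have kc: "kron (1\<^sub>m d) (outer idle idle) \<in> carrier_mat (d * m) (d * m)" using oc by simp
  have col: "(kron (1\<^sub>m d) (outer idle idle)) $$ (a * m + b, a' * m + b') = (if a = a' then idle $ b * cnj (idle $ b') else 0)"
    if "a < d" "b < m" "a' < d" "b' < m" for a b a' b'
    using that idle by (simp add: kron_def index_less outer_def)
  show ?thesis
  proof (rule eq_vec_split3[of _ d m n])
    show "P_idle d n idle *\<^sub>v x \<in> carrier_vec (d * m * n)" using kc x by (simp add: P_idle_def)
    fix a b c assume abc: "a < d" "b < m" "c < n"
    have "(P_idle d n idle *\<^sub>v x) $ ((a * m + b) * n + c)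
        = (\<Sum>a'<d. if a = a' then (\<Sum>b'<m. idle $ b * cnj (idle $ b') * x $ ((a' * m + b') * n + c)) else 0)"
      unfolding P_idle_def kron_one_right_index[OF kc x index_less[OF abc(1,2)] abc(3)] sum_index_split
      by (intro sum.cong refl) (use abc in \<open>auto simp: col\<close>)
    also have "\<dots> = (\<Sum>b'<m. idle $ b * cnj (idle $ b') * x $ ((a * m + b') * n + c))"
      using abc by simp
    finally show "(P_idle d n idle *\<^sub>v x) $ ((a * m + b) * n + c)
        = put_idle d m n idle (take_idle d m n idle x) $ ((a * m + b) * n + c)"
      using abc by (simp add: put_idle_index take_idle_index sum_distrib_left mult.assoc)
  qed simp
qed

text \<open>Bracketed this way the idle projection is a local operation on B \<otimes> C, and so it
  may compete in minimizations over contractions of B \<otimes> C.\<close>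

lemma idle_projection_left:
  assumes idle: "idle \<in> carrier_vec m" and x: "x \<in> carrier_vec (d * m * n)"
  shows "kron (1\<^sub>m d) (kron (outer idle idle) (1\<^sub>m n)) *\<^sub>v x = put_idle d m n idle (take_idle d m n idle x)"
proof -
  have Qc: "kron (outer idle idle) (1\<^sub>m n) \<in> carrier_mat (m * n) (m * n)" using idle by (simp add: outer_def)
  have x': "x \<in> carrier_vec (d * (m * n))" using x by (simp add: mult.assoc)
  have Q: "kron (outer idle idle) (1\<^sub>m n) $$ (b * n + c, b' * n + c') = (if c = c' then idle $ b * cnj (idle $ b') else 0)"
    if "b < m" "c < n" "b' < m" "c' < n" for b c b' c'
    using that idle by (simp add: kron_def index_less outer_def)
  show ?thesis
  proof (rule eq_vec_split3[of _ d m n])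
    show "kron (1\<^sub>m d) (kron (outer idle idle) (1\<^sub>m n)) *\<^sub>v x \<in> carrier_vec (d * m * n)"
      using kron_one_left_carrier[OF Qc x'] by (simp add: mult.assoc)
    fix a b c assume abc: "a < d" "b < m" "c < n"
    have "(kron (1\<^sub>m d) (kron (outer idle idle) (1\<^sub>m n)) *\<^sub>v x) $ ((a * m + b) * n + c)
        = (\<Sum>b'<m. \<Sum>c'<n. if c = c' then idle $ b * cnj (idle $ b') * x $ (a * (m * n) + (b' * n + c')) else 0)"
      unfolding index3 kron_one_left_index[OF Qc x' abc(1) index_less[OF abc(2,3)]] sum_index_split
      by (intro sum.cong refl) (use abc in \<open>auto simp: Q\<close>)
    also have "\<dots> = (\<Sum>b'<m. idle $ b * cnj (idle $ b') * x $ ((a * m + b') * n + c))"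
      using abc by (simp add: index3)
    finally show "(kron (1\<^sub>m d) (kron (outer idle idle) (1\<^sub>m n)) *\<^sub>v x) $ ((a * m + b) * n + c)
        = put_idle d m n idle (take_idle d m n idle x) $ ((a * m + b) * n + c)"
      using abc by (simp add: put_idle_index take_idle_index sum_distrib_left mult.assoc)
  qed simp
qed

section \<open>The idle projection as a local contraction and the optimality condition it
  yields\<close>

lemma kron_one_one:
  assumes "U \<in> carrier_mat n n" "v \<in> carrier_vec n"
  shows "kron (1\<^sub>m 1) U *\<^sub>v v = U *\<^sub>v v"
proof -
  have v: "v \<in> carrier_vec (1 * n)" using assms by simp
  have "blk n w 0 = w" if "w \<in> carrier_vec n" for w using that by (auto simp: blk_def)
  moreover have "kron (1\<^sub>m 1) U *\<^sub>v v \<in> carrier_vec n" using kron_one_left_carrier[OF assms(1) v] by simp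
  ultimately show ?thesis using blk_kron[OF assms(1) v, of 0] assms by simp
qed

text \<open>With a trivial first factor, \<open>d = 1\<close>, the norm identities for
  \<open>put_idle\<close> and \<open>take_idle\<close> apply to the operator on B \<otimes> C
  itself.\<close>

lemma contraction_idle_projection:
  assumes idle: "idle \<in> carrier_vec m" "cnorm idle = 1"
  shows "contraction_mat (m * n) (kron (outer idle idle) (1\<^sub>m n))"
proof -
  have Qc: "kron (outer idle idle) (1\<^sub>m n) \<in> carrier_mat (m * n) (m * n)" using idle by (simp add: outer_def)
  show ?thesis
    unfolding contraction_mat_def
  proof (intro conjI Qc ballI)
    fix v :: "complex vec" assume v: "v \<in> carrier_vec (m * n)"
    then have v': "v \<in> carrier_vec (1 * m * n)" by simp
    have "nsq (kron (outer idle idle) (1\<^sub>m n) *\<^sub>v v) = nsq (take_idle 1 m n idle v)"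
      unfolding kron_one_one[OF Qc v, symmetric] idle_projection_left[OF idle(1) v']
      by (rule nsq_put_idle[OF idle take_idle_carrier])
    also have "\<dots> \<le> nsq v"
      using nsq_non_idle[OF idle v'] nsq_nonneg[of "non_idle 1 m n idle v"] by linarith
    finally show "nsq (kron (outer idle idle) (1\<^sub>m n) *\<^sub>v v) \<le> nsq v" .
  qed
qed

text \<open>The segment from the identity to \<open>Q\<close> stays among contractions, by convexity
  of the squared norm; the mixed term is bounded using that \<open>v - w\<close> has nonnegative
  squared norm.\<close>

lemma contraction_convex_one:
  assumes Q: "contraction_mat n Q" and t: "0 \<le> t" "t \<le> 1"
  shows "contraction_mat n (of_real (1 - t) \<cdot>\<^sub>m 1\<^sub>m n + of_real t \<cdot>\<^sub>m Q)"
proof -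
  have Qc: "Q \<in> carrier_mat n n" using Q by (simp add: contraction_mat_def)
  show ?thesis
    unfolding contraction_mat_def
  proof (intro conjI ballI)
    show "of_real (1 - t) \<cdot>\<^sub>m 1\<^sub>m n + of_real t \<cdot>\<^sub>m Q \<in> carrier_mat n n" using Qc by simp
    fix v :: "complex vec" assume v: "v \<in> carrier_vec n"
    define w where "w = Q *\<^sub>v v"
    have w: "w \<in> carrier_vec n" "nsq w \<le> nsq v" using Q v Qc by (auto simp: w_def contraction_mat_def)
    have "(of_real (1 - t) \<cdot>\<^sub>m 1\<^sub>m n + of_real t \<cdot>\<^sub>m Q) *\<^sub>v v = of_real (1 - t) \<cdot>\<^sub>v v + of_real t \<cdot>\<^sub>v w"
    proof (rule eq_vecI)
      fix i assume "i < dim_vec (of_real (1 - t) \<cdot>\<^sub>v v + of_real t \<cdot>\<^sub>v w)"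
      then have i: "i < n" using w by simp
      have "((of_real (1 - t) \<cdot>\<^sub>m 1\<^sub>m n + of_real t \<cdot>\<^sub>m Q) *\<^sub>v v) $ i
          = (\<Sum>k<n. (if i = k then of_real (1 - t) * v $ k else 0) + of_real t * (Q $$ (i, k) * v $ k))"
        using i v Qc by (subst mult_mat_vec_index[where m = n and n = n]) (auto intro!: sum.cong simp: algebra_simps)
      also have "\<dots> = of_real (1 - t) * v $ i + of_real t * w $ i"
        using i unfolding w_def mult_mat_vec_index[OF Qc v i] by (simp add: sum.distrib sum_distrib_left)
      finally show "((of_real (1 - t) \<cdot>\<^sub>m 1\<^sub>m n + of_real t \<cdot>\<^sub>m Q) *\<^sub>v v) $ i = (of_real (1 - t) \<cdot>\<^sub>v v + of_real t \<cdot>\<^sub>v w) $ i"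
        using i v w by simp
    qed (use Qc v w in auto)
    moreover have "nsq (of_real (1 - t) \<cdot>\<^sub>v v + of_real t \<cdot>\<^sub>v w)
        = (1 - t)\<^sup>2 * nsq v + 2 * ((1 - t) * t) * Re (cinner v w) + t\<^sup>2 * nsq w"
      using v w by (simp add: nsq_add[of _ n] nsq_smult cinner_smult_left[of _ n] cinner_smult_right[of _ n]
          del: of_real_diff)
    moreover have "\<dots> \<le> nsq v"
    proof -
      have "2 * Re (cinner v w) \<le> nsq v + nsq w"
        using nsq_diff[OF v w(1)] nsq_nonneg[of "v - w"] by linarith
      then have "(1 - t) * t * (2 * Re (cinner v w)) \<le> (1 - t) * t * (nsq v + nsq w)"
        using t by (intro mult_left_mono) auto
      then have "(1 - t)\<^sup>2 * nsq v + 2 * ((1 - t) * t) * Re (cinner v w) + t\<^sup>2 * nsq w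
          \<le> (1 - t)\<^sup>2 * nsq v + (1 - t) * t * (nsq v + nsq w) + t\<^sup>2 * nsq w"
        by (simp add: algebra_simps)
      also have "\<dots> = (1 - t) * nsq v + t * nsq w" by (simp add: algebra_simps power2_eq_square)
      also have "\<dots> \<le> (1 - t) * nsq v + t * nsq v" using w t by (intro add_left_mono mult_left_mono)
      finally show ?thesis by (simp add: algebra_simps)
    qed
    ultimately show "nsq ((of_real (1 - t) \<cdot>\<^sub>m 1\<^sub>m n + of_real t \<cdot>\<^sub>m Q) *\<^sub>v v) \<le> nsq v" by simp
  qed
qed

text \<open>For the idle projection \<open>Q\<close>, the right side damps the non-idle part of
  \<open>x\<close> by the factor \<open>1 - t\<close> and keeps the idle part.\<close>

lemma kron_convex_one:
  assumes Qc: "Q \<in> carrier_mat n n" and x: "x \<in> carrier_vec (d * n)"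
  shows "kron (1\<^sub>m d) (of_real (1 - t) \<cdot>\<^sub>m 1\<^sub>m n + of_real t \<cdot>\<^sub>m Q) *\<^sub>v x
    = x - of_real t \<cdot>\<^sub>v (x - kron (1\<^sub>m d) Q *\<^sub>v x)"
proof (rule eq_vec_split[of _ d n])
  show "kron (1\<^sub>m d) (of_real (1 - t) \<cdot>\<^sub>m 1\<^sub>m n + of_real t \<cdot>\<^sub>m Q) *\<^sub>v x \<in> carrier_vec (d * n)"
    using assms by (intro kron_one_left_carrier) auto
  show "x - of_real t \<cdot>\<^sub>v (x - kron (1\<^sub>m d) Q *\<^sub>v x) \<in> carrier_vec (d * n)"
    using assms by simp
  fix a h assume ah: "a < d" "h < n"
  have "(kron (1\<^sub>m d) (of_real (1 - t) \<cdot>\<^sub>m 1\<^sub>m n + of_real t \<cdot>\<^sub>m Q) *\<^sub>v x) $ (a * n + h)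
      = (\<Sum>k<n. (if h = k then of_real (1 - t) * x $ (a * n + k) else 0) + of_real t * (Q $$ (h, k) * x $ (a * n + k)))"
    using ah assms by (subst kron_one_left_index) (auto intro!: sum.cong simp: algebra_simps)
  also have "\<dots> = of_real (1 - t) * x $ (a * n + h) + of_real t * (kron (1\<^sub>m d) Q *\<^sub>v x) $ (a * n + h)"
    using ah unfolding kron_one_left_index[OF Qc x ah] by (simp add: sum.distrib sum_distrib_left)
  also have "\<dots> = x $ (a * n + h) - of_real t * (x $ (a * n + h) - (kron (1\<^sub>m d) Q *\<^sub>v x) $ (a * n + h))"
    by (simp add: left_diff_distrib right_diff_distrib)
  also have "\<dots> = (x - of_real t \<cdot>\<^sub>v (x - kron (1\<^sub>m d) Q *\<^sub>v x)) $ (a * n + h)"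
  proof -
    have "(u - k \<cdot>\<^sub>v (u - w)) $ i = u $ i - k * (u $ i - w $ i)"
      if "u \<in> carrier_vec r" "w \<in> carrier_vec r" "i < r" for u w :: "complex vec" and k i r
      using that by auto
    from this[OF x kron_one_left_carrier[OF Qc x] index_less[OF ah]] show ?thesis by simp
  qed
  finally show "(kron (1\<^sub>m d) (of_real (1 - t) \<cdot>\<^sub>m 1\<^sub>m n + of_real t \<cdot>\<^sub>m Q) *\<^sub>v x) $ (a * n + h)
      = (x - of_real t \<cdot>\<^sub>v (x - kron (1\<^sub>m d) Q *\<^sub>v x)) $ (a * n + h)" .
qed

text \<open>Let N be the non-idle part of the closest point y. Damping N gives another image of
  \<open>x\<close> under a contraction, which cannot be closer to \<open>z\<close>. To first order
  this says Re \<langle>z - y, N\<rangle> \<ge> 0, so the squared norm of N is at most Re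
  \<langle>z, N\<rangle>. Here \<open>z\<close> may be replaced by its non-idle part, which is
  therefore at least as long as N.\<close>

lemma closest_contraction_non_idle:
  assumes idle: "idle \<in> carrier_vec m" "cnorm idle = 1"
    and x: "x \<in> carrier_vec (d * m * n)" and z: "z \<in> carrier_vec (d * m * n)"
  obtains K where "contraction_mat (m * n) K"
    and "\<And>M. contraction_mat (m * n) M \<Longrightarrow> nsq (z - kron (1\<^sub>m d) K *\<^sub>v x) \<le> nsq (z - kron (1\<^sub>m d) M *\<^sub>v x)"
    and "nsq (non_idle d m n idle (kron (1\<^sub>m d) K *\<^sub>v x)) \<le> nsq (non_idle d m n idle z)"
proof -
  have x': "x \<in> carrier_vec (d * (m * n))" and z': "z \<in> carrier_vec (d * (m * n))"
    using x z by (auto simp: mult.assoc)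
  obtain K where K: "contraction_mat (m * n) K"
    and min: "\<And>M. contraction_mat (m * n) M \<Longrightarrow> nsq (z - kron (1\<^sub>m d) K *\<^sub>v x) \<le> nsq (z - kron (1\<^sub>m d) M *\<^sub>v x)"
    using closest_contraction[OF x' z'] by blast
  have Kc: "K \<in> carrier_mat (m * n) (m * n)" using K by (simp add: contraction_mat_def)
  define y where "y = kron (1\<^sub>m d) K *\<^sub>v x"
  have y': "y \<in> carrier_vec (d * (m * n))" unfolding y_def by (rule kron_one_left_carrier[OF Kc x'])
  then have y: "y \<in> carrier_vec (d * m * n)" by (simp add: mult.assoc)
  define Q where "Q = kron (outer idle idle) (1\<^sub>m n)"
  have Q: "contraction_mat (m * n) Q" unfolding Q_def by (rule contraction_idle_projection[OF idle])
  then have Qc: "Q \<in> carrier_mat (m * n) (m * n)" by (simp add: contraction_mat_def)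
  define N where "N = non_idle d m n idle y"
  have N: "N \<in> carrier_vec (d * m * n)" using y by (simp add: N_def)
  define c where "c = Re (cinner (z - y) N)"
  have step: "0 \<le> 2 * c + t * nsq N" if t: "0 < t" "t \<le> 1" for t
  proof -
    define R where "R = of_real (1 - t) \<cdot>\<^sub>m 1\<^sub>m (m * n) + of_real t \<cdot>\<^sub>m Q"
    have R: "contraction_mat (m * n) R" unfolding R_def using t by (intro contraction_convex_one[OF Q]) auto
    then have Rc: "R \<in> carrier_mat (m * n) (m * n)" by (simp add: contraction_mat_def)
    have "kron (1\<^sub>m d) (R * K) *\<^sub>v x = kron (1\<^sub>m d) R *\<^sub>v y"
      unfolding y_def by (rule kron_one_left_mult[OF Rc Kc x'])
    also have "\<dots> = y - of_real t \<cdot>\<^sub>v (y - kron (1\<^sub>m d) Q *\<^sub>v y)"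
      unfolding R_def by (rule kron_convex_one[OF Qc y'])
    also have "y - kron (1\<^sub>m d) Q *\<^sub>v y = N"
      unfolding N_def non_idle_def Q_def idle_projection_left[OF idle(1) y] ..
    finally have "kron (1\<^sub>m d) (R * K) *\<^sub>v x = y - of_real t \<cdot>\<^sub>v N" .
    then have "nsq (z - y) \<le> nsq (z - (y - of_real t \<cdot>\<^sub>v N))"
      using min[OF contraction_mat_mult[OF R K]] by (simp add: y_def)
    also have "z - (y - of_real t \<cdot>\<^sub>v N) = (z - y) + of_real t \<cdot>\<^sub>v N"
      using z y N by (intro eq_vecI) auto
    also have "nsq \<dots> = nsq (z - y) + 2 * (t * c) + t\<^sup>2 * nsq N"
      using z y N by (simp add: nsq_add[of _ "d * m * n"] nsq_smult cinner_smult_right[of _ "d * m * n"] c_def)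
    finally have "0 \<le> t * (2 * c + t * nsq N)" by (simp add: algebra_simps power2_eq_square)
    then show ?thesis using t by (simp add: zero_le_mult_iff)
  qed
  have "0 \<le> c"
  proof (rule ccontr)
    assume "\<not> 0 \<le> c"
    then have c: "c < 0" by simp
    \<comment> \<open>Small enough that \<open>t * nsq N \<le> - c\<close>, so that
      \<open>2 * c + t * nsq N \<le> c < 0\<close> contradicts \<open>step\<close>.\<close>
    define t where "t = min 1 (- c / (nsq N + 1))"
    have N1: "0 < nsq N + 1" using nsq_nonneg[of N] by linarith
    then have "0 < - c / (nsq N + 1)" using c by (intro divide_pos_pos) auto
    then have t: "0 < t" "t \<le> 1" by (auto simp: t_def)
    have "t * nsq N \<le> t * (nsq N + 1)" using t by simp
    also have "\<dots> \<le> (- c / (nsq N + 1)) * (nsq N + 1)"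
      using N1 by (intro mult_right_mono) (auto simp: t_def)
    also have "\<dots> = - c" using N1 by simp
    finally show False using step[OF t] c by linarith
  qed
  moreover have "c = Re (cinner (non_idle d m n idle z) N) - nsq N"
    using z y N cinner_non_idle[OF idle z y] cinner_non_idle[OF idle y y]
    by (simp add: c_def cinner_diff_left[of _ "d * m * n"] N_def cinner_self)
  moreover have "0 \<le> nsq (non_idle d m n idle z) - 2 * Re (cinner (non_idle d m n idle z) N) + nsq N"
    using nsq_diff[of "non_idle d m n idle z" "d * m * n" N] z N nsq_nonneg[of "non_idle d m n idle z - N"] by simp
  ultimately have "nsq N \<le> nsq (non_idle d m n idle z)" by linarith
  then show ?thesis using that K min unfolding N_def y_def by blast
qed

section \<open>States extended by a flag qubit as last tensor factor\<close>

definition flag :: "complex vec \<Rightarrow> complex vec \<Rightarrow> complex vec" where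
  "flag y w = kron_vec y (unit_vec 2 0) + kron_vec w (unit_vec 2 1)"

lemma sum_two: "(\<Sum>q<(2::nat). f q) = f 0 + (f 1 :: 'a::comm_monoid_add)"
  by (simp add: numeral_2_eq_2)

lemma kron_vec_index:
  assumes "x \<in> carrier_vec m" "y \<in> carrier_vec n" "i < m" "k < n"
  shows "kron_vec x y $ (i * n + k) = x $ i * y $ k"
  using assms by (simp add: kron_vec_def index_less)

lemma kron_vec_carrier [simp]: "x \<in> carrier_vec m \<Longrightarrow> y \<in> carrier_vec n \<Longrightarrow> kron_vec x y \<in> carrier_vec (m * n)"
  by (intro carrier_vecI) (simp add: kron_vec_def)

lemma flag_carrier [simp]: "y \<in> carrier_vec n \<Longrightarrow> w \<in> carrier_vec n \<Longrightarrow> flag y w \<in> carrier_vec (n * 2)"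
  by (simp add: flag_def)

lemma flag_index:
  assumes "y \<in> carrier_vec n" "w \<in> carrier_vec n" "i < n" "q < 2"
  shows "flag y w $ (i * 2 + q) = (if q = 0 then y $ i else w $ i)"
proof -
  have c: "kron_vec y (unit_vec 2 0) \<in> carrier_vec (n * 2)" "kron_vec w (unit_vec 2 1) \<in> carrier_vec (n * 2)"
    using assms by (auto intro!: kron_vec_carrier)
  have "flag y w $ (i * 2 + q) = kron_vec y (unit_vec 2 0) $ (i * 2 + q) + kron_vec w (unit_vec 2 1) $ (i * 2 + q)"
    unfolding flag_def by (rule index_add_vec(1)) (use c(2) index_less[OF assms(3,4)] in simp)
  then have "flag y w $ (i * 2 + q) = y $ i * unit_vec 2 0 $ q + w $ i * unit_vec 2 1 $ q"
    by (simp only: kron_vec_index[OF assms(1) unit_vec_carrier assms(3,4)]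
        kron_vec_index[OF assms(2) unit_vec_carrier assms(3,4)])
  then show ?thesis using assms(4) by (auto simp: less_2_cases_iff)
qed

lemma nsq_flag:
  assumes "y \<in> carrier_vec n" "w \<in> carrier_vec n"
  shows "nsq (flag y w) = nsq y + nsq w"
proof -
  have "nsq (flag y w) = (\<Sum>i<n. \<Sum>q<2. (cmod (flag y w $ (i * 2 + q)))\<^sup>2)"
    by (rule nsq_split[OF flag_carrier[OF assms]])
  also have "\<dots> = (\<Sum>i<n. \<Sum>q<(2::nat). (cmod (if q = 0 then y $ i else w $ i))\<^sup>2)"
    by (intro sum.cong refl) (simp only: flag_index[OF assms] lessThan_iff)
  finally show ?thesis using assms by (simp add: sum_two sum.distrib) (simp add: nsq_def)
qed

text \<open>The two flag branches are orthogonal on the traced-out side, so there are no cross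
  terms.\<close>

lemma marg_flag:
  assumes y: "y \<in> carrier_vec (d * n)" and w: "w \<in> carrier_vec (d * n)"
  shows "marg d (n * 2) (flag y w) = marg d n y + marg d n w"
proof (rule eq_matI)
  fix i k assume "i < dim_row (marg d n y + marg d n w)" "k < dim_col (marg d n y + marg d n w)"
  then have ik: "i < d" "k < d" by auto
  have f: "flag y w \<in> carrier_vec (d * (n * 2))" using y w flag_carrier[of y "d * n" w] by (simp add: mult.assoc)
  have idx: "flag y w $ (j * (n * 2) + (h * 2 + q)) = (if q = 0 then y $ (j * n + h) else w $ (j * n + h))"
    if "j < d" "h < n" "q < 2" for j h q
    unfolding index3[symmetric] using y w that by (intro flag_index) (auto simp: index_less)
  have "marg d (n * 2) (flag y w) $$ (i, k)
      = (\<Sum>h<n. \<Sum>q<2. flag y w $ (i * (n * 2) + (h * 2 + q)) * cnj (flag y w $ (k * (n * 2) + (h * 2 + q))))"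
    unfolding marg_index[OF f ik] sum_index_split ..
  also have "\<dots> = (\<Sum>h<n. \<Sum>q<(2::nat). (if q = 0 then y $ (i * n + h) else w $ (i * n + h))
       * cnj (if q = 0 then y $ (k * n + h) else w $ (k * n + h)))"
    by (intro sum.cong refl) (use ik in \<open>simp only: idx lessThan_iff\<close>)
  also have "\<dots> = (\<Sum>h<n. y $ (i * n + h) * cnj (y $ (k * n + h)) + w $ (i * n + h) * cnj (w $ (k * n + h)))"
    by (simp add: sum_two)
  also have "\<dots> = (marg d n y + marg d n w) $$ (i, k)"
    using ik by (simp add: marg_index[OF y] marg_index[OF w] sum.distrib)
  finally show "marg d (n * 2) (flag y w) $$ (i, k) = (marg d n y + marg d n w) $$ (i, k)" .
qed auto

lemma kron_right_flag:
  assumes L: "L \<in> carrier_mat m m" and y: "y \<in> carrier_vec (m * n)" and w: "w \<in> carrier_vec (m * n)"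
  shows "kron L (1\<^sub>m (n * 2)) *\<^sub>v flag y w = flag (kron L (1\<^sub>m n) *\<^sub>v y) (kron L (1\<^sub>m n) *\<^sub>v w)"
proof (rule eq_vec_split3[of _ m n 2])
  have f: "flag y w \<in> carrier_vec (m * (n * 2))" using y w flag_carrier[of y "m * n" w] by (simp add: mult.assoc)
  show "kron L (1\<^sub>m (n * 2)) *\<^sub>v flag y w \<in> carrier_vec (m * n * 2)"
    using kron_one_right_carrier[OF L f] by (simp add: mult.assoc)
  show "flag (kron L (1\<^sub>m n) *\<^sub>v y) (kron L (1\<^sub>m n) *\<^sub>v w) \<in> carrier_vec (m * n * 2)"
    using L y w by simp
  fix i c q :: nat assume icq: "i < m" "c < n" "q < 2"
  have "(kron L (1\<^sub>m (n * 2)) *\<^sub>v flag y w) $ ((i * n + c) * 2 + q)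
      = (\<Sum>k<m. L $$ (i, k) * flag y w $ ((k * n + c) * 2 + q))"
    unfolding index3 by (rule kron_one_right_index[OF L f icq(1) index_less[OF icq(2,3)]])
  also have "\<dots> = (\<Sum>k<m. L $$ (i, k) * (if q = 0 then y $ (k * n + c) else w $ (k * n + c)))"
    by (rule sum.cong[OF refl]) (use icq in \<open>simp only: flag_index[OF y w] index_less lessThan_iff\<close>)
  also have "\<dots> = flag (kron L (1\<^sub>m n) *\<^sub>v y) (kron L (1\<^sub>m n) *\<^sub>v w) $ ((i * n + c) * 2 + q)"
    using icq L y w by (subst flag_index[of _ "m * n"])
      (auto simp: index_less kron_one_right_index simp del: index_mult_mat_vec)
  finally show "(kron L (1\<^sub>m (n * 2)) *\<^sub>v flag y w) $ ((i * n + c) * 2 + q)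
      = flag (kron L (1\<^sub>m n) *\<^sub>v y) (kron L (1\<^sub>m n) *\<^sub>v w) $ ((i * n + c) * 2 + q)" .
qed

lemma take_idle_flag:
  assumes y: "y \<in> carrier_vec (d * m * n)" and w: "w \<in> carrier_vec (d * m * n)"
  shows "take_idle d m (n * 2) idle (flag y w) = flag (take_idle d m n idle y) (take_idle d m n idle w)"
proof (rule eq_vec_split3[of _ d n 2])
  show "take_idle d m (n * 2) idle (flag y w) \<in> carrier_vec (d * n * 2)"
    using take_idle_carrier[of d m "n * 2"] by (simp add: mult.assoc)
  show "flag (take_idle d m n idle y) (take_idle d m n idle w) \<in> carrier_vec (d * n * 2)" by simp
  fix a c q :: nat assume acq: "a < d" "c < n" "q < 2"
  have "take_idle d m (n * 2) idle (flag y w) $ ((a * n + c) * 2 + q)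
      = (\<Sum>b<m. cnj (idle $ b) * flag y w $ (((a * m + b) * n + c) * 2 + q))"
    unfolding index3[of _ n c 2 q] by (rule take_idle_index[OF acq(1) index_less[OF acq(2,3)]])
  also have "\<dots> = (\<Sum>b<m. cnj (idle $ b) * (if q = 0 then y $ ((a * m + b) * n + c) else w $ ((a * m + b) * n + c)))"
    by (rule sum.cong[OF refl]) (use acq in \<open>simp only: flag_index[OF y w] index_less lessThan_iff\<close>)
  also have "\<dots> = flag (take_idle d m n idle y) (take_idle d m n idle w) $ ((a * n + c) * 2 + q)"
    using acq by (subst flag_index[of _ "d * n"]) (auto simp: index_less take_idle_index)
  finally show "take_idle d m (n * 2) idle (flag y w) $ ((a * n + c) * 2 + q)
      = flag (take_idle d m n idle y) (take_idle d m n idle w) $ ((a * n + c) * 2 + q)" .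
qed

section \<open>Idle weight, reduced operators of idle states, and queries on them\<close>

lemma non_idle_weight:
  assumes idle: "idle \<in> carrier_vec m" "cnorm idle = 1" and x: "x \<in> carrier_vec (d * m * n)"
  shows "Re (cinner x ((1\<^sub>m (d * m * n) - P_idle d n idle) *\<^sub>v x)) = nsq (non_idle d m n idle x)"
proof -
  have P: "P_idle d n idle \<in> carrier_mat (d * m * n) (d * m * n)"
    using idle by (auto simp: P_idle_def outer_def)
  have "(1\<^sub>m (d * m * n) - P_idle d n idle) *\<^sub>v x = non_idle d m n idle x"
    using P x by (simp add: minus_mult_distrib_mat_vec[of _ "d * m * n" "d * m * n"] P_idle_mult[OF idle(1) x] non_idle_def)
  then show ?thesis using cinner_non_idle[OF idle x x] by (simp add: cinner_self)
qed

text \<open>Every cross term contains the overlap of \<open>idle\<close> with \<open>y\<close> or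
  its conjugate, hence vanishes; in the first term the norm of \<open>idle\<close> drops
  out.\<close>

lemma marg_put_idle_add:
  assumes idle: "idle \<in> carrier_vec m" "cnorm idle = 1" and J: "J \<in> carrier_vec (d * n)"
    and y: "y \<in> carrier_vec (d * m * n)" and 0: "take_idle d m n idle y = 0\<^sub>v (d * n)"
  shows "marg d (m * n) (put_idle d m n idle J + y) = marg d n J + marg d (m * n) y"
proof (rule eq_matI)
  fix i k assume "i < dim_row (marg d n J + marg d (m * n) y)" "k < dim_col (marg d n J + marg d (m * n) y)"
  then have ik: "i < d" "k < d" by auto
  have y': "y \<in> carrier_vec (d * (m * n))" using y by (simp add: mult.assoc)
  have s': "put_idle d m n idle J + y \<in> carrier_vec (d * (m * n))"
    using y add_carrier_vec[OF put_idle_carrier y] by (simp add: mult.assoc)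
  have orth: "(\<Sum>b<m. cnj (idle $ b) * y $ ((a * m + b) * n + c)) = 0" if "a < d" "c < n" for a c
    using take_idle_index[OF that, of m idle y] that by (simp add: 0 index_less)
  have orth': "(\<Sum>b<m. idle $ b * cnj (y $ ((a * m + b) * n + c))) = 0" if "a < d" "c < n" for a c
    using arg_cong[OF orth[OF that], of cnj] by simp
  have "marg d (m * n) (put_idle d m n idle J + y) $$ (i, k)
      = (\<Sum>b<m. \<Sum>c<n. (idle $ b * J $ (i * n + c) + y $ ((i * m + b) * n + c))
          * cnj (idle $ b * J $ (k * n + c) + y $ ((k * m + b) * n + c)))"
    unfolding marg_index[OF s' ik] sum_index_split index3[symmetric]
    by (intro sum.cong refl) (use ik y in \<open>simp add: index_less put_idle_index\<close>)
  also have "\<dots> = (\<Sum>c<n. \<Sum>b<m. (idle $ b * J $ (i * n + c) + y $ ((i * m + b) * n + c))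
          * cnj (idle $ b * J $ (k * n + c) + y $ ((k * m + b) * n + c)))"
    by (rule sum.swap)
  also have "\<dots> = (\<Sum>c<n. J $ (i * n + c) * cnj (J $ (k * n + c)) * (\<Sum>b<m. cnj (idle $ b) * idle $ b)
       + J $ (i * n + c) * (\<Sum>b<m. idle $ b * cnj (y $ ((k * m + b) * n + c)))
       + cnj (J $ (k * n + c)) * (\<Sum>b<m. cnj (idle $ b) * y $ ((i * m + b) * n + c))
       + (\<Sum>b<m. y $ ((i * m + b) * n + c) * cnj (y $ ((k * m + b) * n + c))))"
    unfolding sum_distrib_left sum.distrib[symmetric]
    by (rule sum.cong[OF refl], rule sum.cong[OF refl]) (simp add: ring_distribs)
  also have "\<dots> = (\<Sum>c<n. J $ (i * n + c) * cnj (J $ (k * n + c)))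
      + (\<Sum>c<n. \<Sum>b<m. y $ ((i * m + b) * n + c) * cnj (y $ ((k * m + b) * n + c)))"
    unfolding sum.distrib[symmetric]
    by (rule sum.cong[OF refl]) (use ik in \<open>simp add: orth orth' idle_sum_one[OF idle]\<close>)
  also have "(\<Sum>c<n. \<Sum>b<m. y $ ((i * m + b) * n + c) * cnj (y $ ((k * m + b) * n + c)))
      = (\<Sum>b<m. \<Sum>c<n. y $ ((i * m + b) * n + c) * cnj (y $ ((k * m + b) * n + c)))"
    by (rule sum.swap)
  also have "\<dots> = marg d (m * n) y $$ (i, k)"
    unfolding marg_index[OF y' ik] sum_index_split index3 ..
  finally show "marg d (m * n) (put_idle d m n idle J + y) $$ (i, k) = (marg d n J + marg d (m * n) y) $$ (i, k)"
    using ik by (simp add: marg_index[OF J])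
qed auto

lemma take_idle_zero [simp]: "take_idle d m n idle (0\<^sub>v (d * m * n)) = 0\<^sub>v (d * n)"
  by (rule eq_vec_split[of _ d n]) (auto simp: take_idle_index index_less)

lemma put_idle_zero [simp]: "put_idle d m n idle (0\<^sub>v (d * n)) = 0\<^sub>v (d * m * n)"
  by (rule eq_vec_split3[of _ d m n]) (auto simp: put_idle_index index_less)

lemma marg_zero: "marg d n (0\<^sub>v (d * n)) = 0\<^sub>m d d"
  by (rule eq_matI) (auto simp: marg_index[of _ d n] index_less)

lemma marg_put_idle:
  assumes "idle \<in> carrier_vec m" "cnorm idle = 1" "J \<in> carrier_vec (d * n)"
  shows "marg d (m * n) (put_idle d m n idle J) = marg d n J"
proof -
  have z: "marg d (m * n) (0\<^sub>v (d * m * n)) = 0\<^sub>m d d" using marg_zero[of d "m * n"] by (simp add: mult.assoc)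
  have "put_idle d m n idle J + 0\<^sub>v (d * m * n) = put_idle d m n idle J"
    by (rule right_zero_vec[OF put_idle_carrier])
  then show ?thesis
    using marg_put_idle_add[OF assms zero_carrier_vec take_idle_zero]
    by (simp only: z right_add_zero_mat[OF marg_carrier])
qed

text \<open>Each slice over C is a product of a vector of A with \<open>idle\<close>, which L
  fixes.\<close>

lemma kron_right_put_idle:
  assumes L: "L \<in> carrier_mat (d * m) (d * m)" and idle: "idle \<in> carrier_vec m"
    and fixed: "\<forall>\<phi>\<in>carrier_vec d. L *\<^sub>v kron_vec \<phi> idle = kron_vec \<phi> idle"
  shows "kron L (1\<^sub>m n) *\<^sub>v put_idle d m n idle J = put_idle d m n idle J"
proof (rule eq_vec_slc[of _ "d * m" n])
  fix c assume c: "c < n"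
  have "slc (d * m) n (put_idle d m n idle J) c = kron_vec (slc d n J c) idle"
    by (rule eq_vec_split[of _ d m])
      (use c idle in \<open>auto simp: put_idle_index kron_vec_index[of _ d _ m] index_less slc_def mult.commute[of "idle $ h" for h] intro!: kron_vec_carrier\<close>)
  then show "slc (d * m) n (kron L (1\<^sub>m n) *\<^sub>v put_idle d m n idle J) c = slc (d * m) n (put_idle d m n idle J) c"
    using slc_kron[OF L put_idle_carrier c] fixed by simp
qed (use L in auto)

text \<open>If \<open>M\<close> sent \<open>w\<close> partly onto the fixed vector \<open>v\<close>,
  then for small \<open>c\<close> of the right phase \<open>v + c w\<close> would gain squared norm
  of first order under \<open>M\<close>, while its own excess over \<open>v\<close> is only of
  second order.\<close>

lemma contraction_fixed_orthogonal:
  assumes M: "contraction_mat n M" and v: "v \<in> carrier_vec n" "M *\<^sub>v v = v"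
    and w: "w \<in> carrier_vec n" "cinner v w = 0"
  shows "cinner v (M *\<^sub>v w) = 0"
proof (rule ccontr)
  have Mc: "M \<in> carrier_mat n n" using M by (simp add: contraction_mat_def)
  define z where "z = cinner v (M *\<^sub>v w)"
  assume "cinner v (M *\<^sub>v w) \<noteq> 0"
  then have z: "(cmod z)\<^sup>2 > 0" by (simp add: z_def)
  \<comment> \<open>This gives \<open>s * nsq w < 1\<close>, whereas the norm comparison would force
    \<open>2 \<le> s * nsq w\<close>.\<close>
  define s where "s = 1 / (nsq w + 1)"
  have "0 < nsq w + 1" using nsq_nonneg[of w] by linarith
  then have s: "s > 0" "s * (nsq w + 1) = 1" by (auto simp: s_def)
  define c where "c = of_real s * cnj z"
  have cz: "Re (c * z) = s * (cmod z)\<^sup>2"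
  proof -
    have "c * z = of_real (s * (cmod z)\<^sup>2)"
      unfolding c_def of_real_mult complex_norm_square by (simp add: mult_ac)
    then show ?thesis by (simp only: Re_complex_of_real)
  qed
  have cc: "(cmod c)\<^sup>2 = s\<^sup>2 * (cmod z)\<^sup>2" by (simp add: c_def norm_mult power_mult_distrib)
  have Mw: "M *\<^sub>v w \<in> carrier_vec n" using Mc w by simp
  have "nsq (v + c \<cdot>\<^sub>v (M *\<^sub>v w)) \<le> nsq (v + c \<cdot>\<^sub>v w)"
  proof -
    have "M *\<^sub>v (v + c \<cdot>\<^sub>v w) = v + c \<cdot>\<^sub>v (M *\<^sub>v w)"
      using Mc v w by (simp add: mult_add_distrib_mat_vec[of _ n n] mult_mat_vec[of _ n n])
    moreover have "nsq (M *\<^sub>v (v + c \<cdot>\<^sub>v w)) \<le> nsq (v + c \<cdot>\<^sub>v w)"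
      using M v w by (auto simp: contraction_mat_def)
    ultimately show ?thesis by simp
  qed
  then have "2 * Re (c * z) + (cmod c)\<^sup>2 * nsq (M *\<^sub>v w) \<le> (cmod c)\<^sup>2 * nsq w"
    using v w Mw by (simp add: nsq_add[of _ n] nsq_smult cinner_smult_right[of _ n] z_def)
  moreover have "0 \<le> (cmod c)\<^sup>2 * nsq (M *\<^sub>v w)" by simp
  ultimately have "2 * (s * (cmod z)\<^sup>2) \<le> s\<^sup>2 * (cmod z)\<^sup>2 * nsq w" unfolding cz cc by linarith
  then have "s * (cmod z)\<^sup>2 * 2 \<le> s * (cmod z)\<^sup>2 * (s * nsq w)" by (simp add: power2_eq_square mult_ac)
  then have "2 \<le> s * nsq w" using s z by (simp only: mult_le_cancel_left_pos mult_pos_pos)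
  then show False using s by (simp add: distrib_left)
qed

section \<open>Feasible solutions of the adversary bound\<close>

text \<open>Moves the negative terms of the trace constraint across, so that feasibility compares
  sums of positive operators.\<close>

lemma mat_diff_eq_iff:
  assumes "A \<in> carrier_mat m n" "B \<in> carrier_mat m n" "C \<in> carrier_mat m n" "D \<in> carrier_mat m n"
  shows "A - B = C - D \<longleftrightarrow> A + D = C + (B :: complex mat)"
proof -
  have "A - B = C - D \<longleftrightarrow> (\<forall>i<m. \<forall>j<n. A $$ (i, j) - B $$ (i, j) = C $$ (i, j) - D $$ (i, j))"
    using assms by (subst mat_eq_iff) auto
  also have "\<dots> \<longleftrightarrow> (\<forall>i<m. \<forall>j<n. A $$ (i, j) + D $$ (i, j) = C $$ (i, j) + B $$ (i, j))"
    by (simp add: algebra_simps)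
  also have "\<dots> \<longleftrightarrow> A + D = C + B"
    using assms by (subst mat_eq_iff) auto
  finally show ?thesis .
qed

section \<open>The fixed query operator and its action on states\<close>

locale idle_query =
  fixes dA dB dC :: nat and idle :: "complex vec" and L :: "complex mat"
  assumes dimC: "dC \<ge> dA * dB"
    and idle: "idle \<in> carrier_vec dB" "cnorm idle = 1"
    and contr: "contraction_mat (dA * dB) L"
    and idle_fix: "\<forall>\<phi>\<in>carrier_vec dA. L *\<^sub>v kron_vec \<phi> idle = kron_vec \<phi> idle"
begin

abbreviation "put \<equiv> put_idle dA dB dC idle"
abbreviation "take' \<equiv> take_idle dA dB dC idle"
abbreviation "nid \<equiv> non_idle dA dB dC idle"
abbreviation "mg \<equiv> marg dA (dB * dC)"
abbreviation "query x \<equiv> kron L (1\<^sub>m dC) *\<^sub>v x"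
abbreviation "local K x \<equiv> kron (1\<^sub>m dA) K *\<^sub>v x"
abbreviation "states \<equiv> carrier_vec (dA * dB * dC) :: complex vec set"

lemma L: "L \<in> carrier_mat (dA * dB) (dA * dB)"
  using contr by (simp add: contraction_mat_def)

text \<open>Ensures that every positive operator on A has a purification in A \<otimes> C; the unit
  vector \<open>idle\<close> forces \<open>dB > 0\<close>.\<close>

lemma dA_le_dC: "dA \<le> dC"
proof -
  have "dB > 0"
  proof (rule ccontr)
    assume "\<not> dB > 0"
    then have "cnorm idle = 0" using idle by (simp add: cnorm_sqrt nsq_def)
    then show False using idle by simp
  qed
  then have "dA \<le> dA * dB" by simp
  then show ?thesis using dimC by linarith
qed

lemma states_assoc: "x \<in> states \<longleftrightarrow> x \<in> carrier_vec (dA * (dB * dC))"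
  by (simp add: mult.assoc)

lemma query_carrier [simp]: "x \<in> states \<Longrightarrow> query x \<in> states"
  by (rule kron_one_right_carrier[OF L])

lemma local_carrier: "K \<in> carrier_mat (dB * dC) (dB * dC) \<Longrightarrow> x \<in> states \<Longrightarrow> local K x \<in> states"
  unfolding states_assoc by (rule kron_one_left_carrier)

lemma query_diff: "x \<in> states \<Longrightarrow> y \<in> states \<Longrightarrow> query (x - y) = query x - query y"
  by (rule kron_one_right_diff[OF L])

lemma query_add: "x \<in> states \<Longrightarrow> y \<in> states \<Longrightarrow> query (x + y) = query x + query y"
  by (rule mult_add_distrib_mat_vec[OF kron_carrier[OF L one_carrier_mat]])

lemma query_smult: "x \<in> states \<Longrightarrow> query (c \<cdot>\<^sub>v x) = c \<cdot>\<^sub>v query x"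
  by (rule mult_mat_vec[OF kron_carrier[OF L one_carrier_mat]])

lemma nsq_query_le: "x \<in> states \<Longrightarrow> nsq (query x) \<le> nsq x"
  by (rule nsq_kron_right_le[OF contr])

lemma query_put: "query (put J) = put J"
  by (rule kron_right_put_idle[OF L idle(1) idle_fix])

text \<open>Idle states are fixed points of a contraction, so states orthogonal to all of them stay
  orthogonal. Testing against the idle component J of the result itself gives that J has norm
  0.\<close>

lemma take_query:
  assumes x: "x \<in> states" and 0: "take' x = 0\<^sub>v (dA * dC)"
  shows "take' (query x) = 0\<^sub>v (dA * dC)"
proof -
  define J where "J = take' (query x)"
  have M: "contraction_mat (dA * dB * dC) (kron L (1\<^sub>m dC))"
    unfolding contraction_mat_def using nsq_query_le kron_carrier[OF L one_carrier_mat[of dC]] by auto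
  have J: "J \<in> carrier_vec (dA * dC)" by (simp add: J_def)
  have "cinner (put J) x = 0"
    using cinner_put_idle[OF J x] J by (simp add: 0) (simp add: cinner_def)
  then have "cinner (put J) (query x) = 0"
    by (rule contraction_fixed_orthogonal[OF M put_idle_carrier query_put x])
  then have "nsq J = 0" using cinner_put_idle[OF J query_carrier[OF x]] J_def[symmetric] by (simp add: cinner_self)
  then show ?thesis using nsq_eq_0[OF J] by (simp add: J_def)
qed

lemma mg_put_add:
  assumes "J \<in> carrier_vec (dA * dC)" "x \<in> states" "take' x = 0\<^sub>v (dA * dC)"
  shows "mg (put J + x) = marg dA dC J + mg x"
  by (rule marg_put_idle_add[OF idle assms])

text \<open>A solution of the adversary program is represented by a purification
  \<open>\<psi>\<close> in A \<otimes> B \<otimes> C; its objective value is then the squared norm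
  of \<open>\<psi>\<close> divided by that of \<open>\<xi>\<close>.\<close>

definition feasible :: "complex vec \<Rightarrow> complex vec \<Rightarrow> complex vec \<Rightarrow> bool" where
  "feasible \<xi> \<tau> \<psi> \<longleftrightarrow> \<psi> \<in> states \<and> mg (query \<psi>) + mg \<xi> = mg \<tau> + mg \<psi>"

lemma constraint_iff_feasible:
  assumes \<xi>: "\<xi> \<in> states" and \<tau>: "\<tau> \<in> states" and \<psi>: "\<psi> \<in> states"
  shows "ptrace_right dA dB (L * marg (dA * dB) dC \<psi> * adj L - marg (dA * dB) dC \<psi>)
      = ptrace_right dA (dB * dC) (outer \<tau> \<tau> - outer \<xi> \<xi>) \<longleftrightarrow> feasible \<xi> \<tau> \<psi>"
proof -
  have "ptrace_right dA dB (L * marg (dA * dB) dC \<psi> * adj L - marg (dA * dB) dC \<psi>) = mg (query \<psi>) - mg \<psi>"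
    unfolding marg_kron_right[OF L \<psi>]
    by (simp only: ptrace_right_diff[OF marg_carrier marg_carrier] ptrace_right_marg[OF \<psi>]
        ptrace_right_marg[OF query_carrier[OF \<psi>]])
  moreover have "ptrace_right dA (dB * dC) (outer \<tau> \<tau> - outer \<xi> \<xi>) = mg \<tau> - mg \<xi>"
    unfolding marg_def using \<xi> \<tau> by (intro ptrace_right_diff) (auto simp: outer_def mult.assoc)
  moreover have "mg (query \<psi>) - mg \<psi> = mg \<tau> - mg \<xi> \<longleftrightarrow> mg (query \<psi>) + mg \<xi> = mg \<tau> + mg \<psi>"
    by (rule mat_diff_eq_iff[OF marg_carrier marg_carrier marg_carrier marg_carrier])
  ultimately show ?thesis using \<psi> by (simp add: feasible_def)
qed

lemma Adv_le_feasible: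
  assumes \<xi>: "\<xi> \<in> states" and \<tau>: "\<tau> \<in> states" and f: "feasible \<xi> \<tau> \<psi>"
  shows "Adv dA dB dC L \<xi> \<tau> \<le> ereal (nsq \<psi> / nsq \<xi>)"
proof -
  have \<psi>: "\<psi> \<in> states" using f by (simp add: feasible_def)
  have "nsq \<psi> / nsq \<xi> = Re (mtrace (marg (dA * dB) dC \<psi>)) / Re (cinner \<xi> \<xi>)"
    by (simp add: mtrace_marg[OF \<psi>] cinner_self)
  moreover have "psd_mat (dA * dB) (marg (dA * dB) dC \<psi>)" by (rule psd_marg[OF \<psi>])
  ultimately show ?thesis
    unfolding Adv_def using constraint_iff_feasible[OF \<xi> \<tau> \<psi>] f by (intro Inf_lower) blast
qed

text \<open>The dimension of C is at least that of A \<otimes> B, so every program variable has a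
  purification in the given space.\<close>

lemma feasible_of_program:
  assumes "\<xi> \<in> states" "\<tau> \<in> states" "psd_mat (dA * dB) P"
    and "ptrace_right dA dB (L * P * adj L - P) = ptrace_right dA (dB * dC) (outer \<tau> \<tau> - outer \<xi> \<xi>)"
  obtains \<psi> where "feasible \<xi> \<tau> \<psi>" "Re (mtrace P) = nsq \<psi>"
proof -
  obtain \<psi> where \<psi>: "\<psi> \<in> states" "marg (dA * dB) dC \<psi> = P"
    using psd_purification[OF assms(3) dimC] by blast
  then show ?thesis
    using that constraint_iff_feasible[OF assms(1,2) \<psi>(1)] assms(4) mtrace_marg[OF \<psi>(1)] by auto
qed

text \<open>Entries of reduced operators are polynomials in the coordinates and their conjugates, so
  the constraint passes to entrywise limits.\<close>

lemma feasible_limit: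
  assumes f: "\<And>k. feasible \<xi> \<tau> (\<psi>s k)" and \<psi>: "\<psi> \<in> states"
    and lim: "\<And>i. i < dA * dB * dC \<Longrightarrow> (\<lambda>k. \<psi>s k $ i) \<longlonglongrightarrow> \<psi> $ i"
  shows "feasible \<xi> \<tau> \<psi>"
proof -
  have s: "\<psi>s k \<in> states" for k using f by (simp add: feasible_def)
  have lim3: "(\<lambda>k. \<psi>s k $ (p * dC + c)) \<longlonglongrightarrow> \<psi> $ (p * dC + c)" if "p < dA * dB" "c < dC" for p c
    using that by (intro lim index_less)
  have limq: "(\<lambda>k. query (\<psi>s k) $ i) \<longlonglongrightarrow> query \<psi> $ i" if "i < dA * dB * dC" for i
  proof -
    have "dC > 0" using that by (cases dC) auto
    then have pc: "i div dC < dA * dB" "i mod dC < dC" using that by (auto simp: less_mult_imp_div_less)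
    have "(\<lambda>k. query (\<psi>s k) $ (i div dC * dC + i mod dC)) \<longlonglongrightarrow> query \<psi> $ (i div dC * dC + i mod dC)"
      unfolding kron_one_right_index[OF L s pc] kron_one_right_index[OF L \<psi> pc]
      by (intro tendsto_intros lim3) (use pc in auto)
    then show ?thesis by simp
  qed
  have marg_lim: "(\<lambda>k. mg (xs k) $$ (i, j)) \<longlonglongrightarrow> mg x $$ (i, j)"
    if "\<And>k. xs k \<in> states" "x \<in> states" "\<And>i. i < dA * dB * dC \<Longrightarrow> (\<lambda>k. xs k $ i) \<longlonglongrightarrow> x $ i"
      "i < dA" "j < dA" for xs x i j
  proof -
    have 1: "xs k \<in> carrier_vec (dA * (dB * dC))" "x \<in> carrier_vec (dA * (dB * dC))" for k
      using that by (auto simp: mult.assoc)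
    have 2: "a * (dB * dC) + h < dA * dB * dC" if "a < dA" "h < dB * dC" for a h
      using index_less[OF that] by (simp add: mult.assoc)
    show ?thesis
      unfolding marg_index[OF 1(1) that(4,5)] marg_index[OF 1(2) that(4,5)]
      by (intro tendsto_intros that(3) 2) (use that in auto)
  qed
  have "mg (query \<psi>) + mg \<xi> = mg \<tau> + mg \<psi>"
  proof (rule eq_matI)
    fix i j assume "i < dim_row (mg \<tau> + mg \<psi>)" "j < dim_col (mg \<tau> + mg \<psi>)"
    then have ij: "i < dA" "j < dA" by auto
    have "mg (query (\<psi>s k)) $$ (i, j) + mg \<xi> $$ (i, j) = mg \<tau> $$ (i, j) + mg (\<psi>s k) $$ (i, j)" for k
    proof -
      have e: "mg (query (\<psi>s k)) + mg \<xi> = mg \<tau> + mg (\<psi>s k)" using f by (simp add: feasible_def)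
      have "(mg (query (\<psi>s k)) + mg \<xi>) $$ (i, j) = (mg \<tau> + mg (\<psi>s k)) $$ (i, j)" by (simp only: e)
      then show ?thesis using ij by simp
    qed
    moreover have "(\<lambda>k. mg (query (\<psi>s k)) $$ (i, j) + mg \<xi> $$ (i, j)) \<longlonglongrightarrow> mg (query \<psi>) $$ (i, j) + mg \<xi> $$ (i, j)"
      by (intro tendsto_intros marg_lim query_carrier s \<psi> limq ij)
    moreover have "(\<lambda>k. mg \<tau> $$ (i, j) + mg (\<psi>s k) $$ (i, j)) \<longlonglongrightarrow> mg \<tau> $$ (i, j) + mg \<psi> $$ (i, j)"
      by (intro tendsto_intros marg_lim s \<psi> lim ij)
    ultimately have "mg (query \<psi>) $$ (i, j) + mg \<xi> $$ (i, j) = mg \<tau> $$ (i, j) + mg \<psi> $$ (i, j)"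
      using LIMSEQ_unique by simp
    then show "(mg (query \<psi>) + mg \<xi>) $$ (i, j) = (mg \<tau> + mg \<psi>) $$ (i, j)"
      using ij by simp
  qed auto
  then show ?thesis using \<psi> by (simp add: feasible_def)
qed

text \<open>A finite value provides a feasible vector. A minimizing sequence has bounded norms,
  hence a convergent subsequence; its limit is feasible and its squared norm is the infimum.\<close>

lemma Adv_attained:
  assumes \<xi>: "\<xi> \<in> states" and \<tau>: "\<tau> \<in> states" and fin: "Adv dA dB dC L \<xi> \<tau> < \<infinity>"
  obtains \<psi> where "feasible \<xi> \<tau> \<psi>" "Adv dA dB dC L \<xi> \<tau> = ereal (nsq \<psi> / nsq \<xi>)"
proof -
  define S where "S = nsq ` {\<psi>. feasible \<xi> \<tau> \<psi>}"
  have "S \<noteq> {}"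
  proof
    assume "S = {}"
    then have none: "\<not> feasible \<xi> \<tau> \<psi>" for \<psi> by (auto simp: S_def)
    have "Adv dA dB dC L \<xi> \<tau> = Inf {}"
      unfolding Adv_def by (rule arg_cong[of _ _ Inf]) (use none feasible_of_program[OF \<xi> \<tau>] in blast)
    then show False using fin by (simp add: top_ereal_def)
  qed
  moreover have "bdd_below S" by (auto simp: S_def intro!: bdd_belowI[of _ 0])
  ultimately have S: "S \<noteq> {}" "bdd_below S" .
  have "\<exists>\<psi>. feasible \<xi> \<tau> \<psi> \<and> nsq \<psi> < Inf S + 1 / real (Suc k)" for k
    using cInf_lessD[OF S(1), of "Inf S + 1 / real (Suc k)"] by (auto simp: S_def)
  then obtain \<psi>s where \<psi>s: "\<And>k. feasible \<xi> \<tau> (\<psi>s k)" "\<And>k. nsq (\<psi>s k) < Inf S + 1 / real (Suc k)"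
    by metis
  have sc: "\<psi>s k \<in> states" for k using \<psi>s(1) by (simp add: feasible_def)
  have bound: "cmod (\<psi>s k $ i) \<le> sqrt (Inf S + 1)" if "i < dA * dB * dC" for k i
  proof -
    have "(cmod (\<psi>s k $ i))\<^sup>2 \<le> nsq (\<psi>s k)"
      unfolding nsq_def using sc[of k] that by (intro member_le_sum[of i]) auto
    also have "\<dots> \<le> Inf S + 1 / real (Suc k)" using \<psi>s(2) by (intro less_imp_le)
    also have "\<dots> \<le> Inf S + 1" by simp
    finally show ?thesis by (rule real_le_rsqrt)
  qed
  obtain r l where r: "strict_mono r"
    and l: "\<forall>i\<in>{..<dA * dB * dC}. (\<lambda>k. \<psi>s (r k) $ i) \<longlonglongrightarrow> l i"
    using bounded_family_subseq[of "{..<dA * dB * dC}" "\<lambda>k i. \<psi>s k $ i" "sqrt (Inf S + 1)"] bound by auto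
  define \<psi> where "\<psi> = vec (dA * dB * dC) l"
  have \<psi>: "\<psi> \<in> states" by (simp add: \<psi>_def)
  have lim: "(\<lambda>k. \<psi>s (r k) $ i) \<longlonglongrightarrow> \<psi> $ i" if "i < dA * dB * dC" for i
    using l that by (simp add: \<psi>_def)
  have f: "feasible \<xi> \<tau> \<psi>" by (rule feasible_limit[of _ _ "\<lambda>k. \<psi>s (r k)"]) (use \<psi>s \<psi> lim in auto)
  have "nsq \<psi> \<le> Inf S"
  proof -
    have n: "nsq x = (\<Sum>i<dA * dB * dC. (cmod (x $ i))\<^sup>2)" if "x \<in> states" for x
      using that by (simp add: nsq_def)
    have 1: "(\<lambda>k. nsq (\<psi>s (r k))) \<longlonglongrightarrow> nsq \<psi>"
      unfolding n[OF sc] n[OF \<psi>] by (intro tendsto_intros lim) auto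
    have "(\<lambda>k. 1 / real (Suc (r k))) \<longlonglongrightarrow> 0"
      using LIMSEQ_subseq_LIMSEQ[OF lim_1_over_n[THEN LIMSEQ_Suc] r] by (simp add: o_def)
    then have 2: "(\<lambda>k. Inf S + 1 / real (Suc (r k))) \<longlonglongrightarrow> Inf S + 0"
      by (intro tendsto_intros)
    have "nsq \<psi> \<le> Inf S + 0"
      by (rule LIMSEQ_le[OF 1 2]) (use \<psi>s(2) in \<open>auto intro!: exI[of _ 0] less_imp_le\<close>)
    then show ?thesis by simp
  qed
  then have min: "nsq \<psi> \<le> nsq \<phi>" if "feasible \<xi> \<tau> \<phi>" for \<phi>
    using cInf_lower[OF _ S(2), of "nsq \<phi>"] that by (auto simp: S_def)
  have "ereal (nsq \<psi> / nsq \<xi>) \<le> Adv dA dB dC L \<xi> \<tau>"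
    unfolding Adv_def
  proof (rule Inf_greatest, clarsimp)
    fix P assume "psd_mat (dA * dB) P"
      "ptrace_right dA dB (L * P * adj L - P) = ptrace_right dA (dB * dC) (outer \<tau> \<tau> - outer \<xi> \<xi>)"
    then obtain \<phi> where "feasible \<xi> \<tau> \<phi>" "Re (mtrace P) = nsq \<phi>" by (rule feasible_of_program[OF \<xi> \<tau>])
    then show "nsq \<psi> / nsq \<xi> \<le> Re (mtrace P) / Re (cinner \<xi> \<xi>)"
      using min by (simp add: cinner_self divide_right_mono)
  qed
  then show ?thesis using that f Adv_le_feasible[OF \<xi> \<tau> f] by (simp add: order_antisym)
qed

text \<open>The idle part of \<open>\<psi>\<close> passes unchanged through the query, and the
  non-idle part stays non-idle. Hence the idle part contributes the same operator to both sides of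
  the constraint and cancels.\<close>

lemma feasible_non_idle:
  assumes f: "feasible \<xi> \<tau> \<psi>"
  shows "feasible \<xi> \<tau> (nid \<psi>)" "take' (nid \<psi>) = 0\<^sub>v (dA * dC)" "nsq (nid \<psi>) \<le> nsq \<psi>"
proof -
  have \<psi>: "\<psi> \<in> states" using f by (simp add: feasible_def)
  define \<phi> where "\<phi> = nid \<psi>"
  define J where "J = take' \<psi>"
  have \<phi>: "\<phi> \<in> states" "take' \<phi> = 0\<^sub>v (dA * dC)" and J: "J \<in> carrier_vec (dA * dC)"
    using \<psi> take_non_idle[OF idle \<psi>] by (auto simp: \<phi>_def J_def)
  have split: "\<psi> = put J + \<phi>" using \<psi> by (auto simp: \<phi>_def J_def non_idle_def)
  have "query \<psi> = put J + query \<phi>"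
    using query_add[OF put_idle_carrier \<phi>(1)] by (simp add: split query_put)
  then have "mg (query \<psi>) = marg dA dC J + mg (query \<phi>)" "mg \<psi> = marg dA dC J + mg \<phi>"
    using mg_put_add[OF J query_carrier[OF \<phi>(1)] take_query[OF \<phi>]] mg_put_add[OF J \<phi>] split by simp_all
  then have *: "marg dA dC J + mg (query \<phi>) + mg \<xi> = mg \<tau> + (marg dA dC J + mg \<phi>)"
    using f by (simp add: feasible_def)
  have "mg (query \<phi>) + mg \<xi> = mg \<tau> + mg \<phi>"
  proof (rule eq_matI)
    fix i j assume "i < dim_row (mg \<tau> + mg \<phi>)" "j < dim_col (mg \<tau> + mg \<phi>)"
    then show "(mg (query \<phi>) + mg \<xi>) $$ (i, j) = (mg \<tau> + mg \<phi>) $$ (i, j)"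
      using arg_cong[OF *, of "\<lambda>M. M $$ (i, j)"] by (simp add: algebra_simps)
  qed auto
  then show "feasible \<xi> \<tau> (nid \<psi>)" "take' (nid \<psi>) = 0\<^sub>v (dA * dC)"
    using \<phi> by (auto simp: feasible_def \<phi>_def)
  show "nsq (nid \<psi>) \<le> nsq \<psi>" using nsq_non_idle[OF idle \<psi>] by simp
qed

section \<open>The lower bound on the number of timesteps\<close>

lemma Adv_le_timesteps:
  assumes \<xi>: "\<xi> \<in> states" "\<xi> \<noteq> 0\<^sub>v (dA * dB * dC)"
    and alg: "is_algorithm dB dC T U" "alg_output dA dC L U T \<xi> = \<tau>"
  shows "Adv dA dB dC L \<xi> \<tau> \<le> ereal (real T)"
proof -
  define \<Phi> where "\<Phi> j = alg_state dA dC L U j \<xi>" for j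
  have U: "unitary_mat (dB * dC) (U j)" if "j \<le> T" for j using alg that by (simp add: is_algorithm_def)
  have Uc: "U j \<in> carrier_mat (dB * dC) (dB * dC)" if "j \<le> T" for j using U[OF that] by (simp add: unitary_mat_def)
  have local_mg: "mg (local (U j) x) = mg x" if "j \<le> T" "x \<in> states" for j x
    using that(2) unfolding states_assoc by (rule marg_unitary[OF U[OF that(1)]])
  have local_nsq: "nsq (local (U j) x) \<le> nsq x" if "j \<le> T" "x \<in> states" for j x
    using that(2) unfolding states_assoc by (rule nsq_kron_left_le[OF unitary_contraction[OF U[OF that(1)]]])
  have \<Phi>: "\<Phi> j \<in> states \<and> nsq (\<Phi> j) \<le> nsq \<xi>" if "j \<le> T" for j
    using that
  proof (induction j)
    case 0
    then show ?case using \<xi> local_carrier[OF Uc \<xi>(1), of 0] local_nsq[OF _ \<xi>(1), of 0] by (simp add: \<Phi>_def)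
  next
    case (Suc j)
    then have IH: "\<Phi> j \<in> states" "nsq (\<Phi> j) \<le> nsq \<xi>" by auto
    have "\<Phi> (Suc j) = local (U (Suc j)) (query (\<Phi> j))" by (simp add: \<Phi>_def)
    then show ?case
      using local_carrier[OF Uc[OF Suc.prems] query_carrier[OF IH(1)]]
        local_nsq[OF Suc.prems query_carrier[OF IH(1)]] nsq_query_le[OF IH(1)] IH by simp
  qed
  \<comment> \<open>The witness is the sum of the reduced operators on A \<otimes> B of the first
    \<open>j\<close> intermediate states. Each has trace at most \<open>nsq \<xi>\<close>, and the
    constraint telescopes.\<close>
  have "\<exists>P. psd_mat (dA * dB) P \<and> Re (mtrace P) \<le> real j * nsq \<xi> \<and>
      ptrace_right dA dB (L * P * adj L - P) = mg (\<Phi> j) - mg \<xi>" if "j \<le> T" for j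
    using that
  proof (induction j)
    case 0
    have "mg (\<Phi> 0) = mg \<xi>" using local_mg[OF 0 \<xi>(1)] by (simp add: \<Phi>_def)
    then show ?case
      using L by (intro exI[of _ "0\<^sub>m (dA * dB) (dA * dB)"])
        (auto simp: psd_mat_def mtrace_def cinner_def ptrace_right_def adj_def index_less intro!: eq_matI)
  next
    case (Suc j)
    then obtain P where P: "psd_mat (dA * dB) P" "Re (mtrace P) \<le> real j * nsq \<xi>"
      "ptrace_right dA dB (L * P * adj L - P) = mg (\<Phi> j) - mg \<xi>" by auto
    have Pc: "P \<in> carrier_mat (dA * dB) (dA * dB)" using P by (simp add: psd_mat_def)
    have \<Phi>j: "\<Phi> j \<in> states" "nsq (\<Phi> j) \<le> nsq \<xi>" using \<Phi>[of j] Suc.prems by auto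
    define Q where "Q = marg (dA * dB) dC (\<Phi> j)"
    have Qc: "Q \<in> carrier_mat (dA * dB) (dA * dB)" by (simp add: Q_def)
    have adj: "adj L \<in> carrier_mat (dA * dB) (dA * dB)" using L by (simp add: adj_def)
    \<comment> \<open>The unitary after the query acts on B \<otimes> C only and cannot be seen on
      A.\<close>
    have step: "mg (\<Phi> (Suc j)) = mg (query (\<Phi> j))"
      using local_mg[OF Suc.prems query_carrier[OF \<Phi>j(1)]] by (simp add: \<Phi>_def)
    have "L * (P + Q) * adj L - (P + Q) = (L * P * adj L - P) + (L * Q * adj L - Q)"
    proof -
      have "L * (P + Q) * adj L = L * P * adj L + L * Q * adj L"
        using L Pc Qc adj by (simp add: mult_add_distrib_mat[of _ "dA * dB" "dA * dB"]
            add_mult_distrib_mat[of _ "dA * dB" "dA * dB"])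
      moreover have "L * P * adj L \<in> carrier_mat (dA * dB) (dA * dB)" "L * Q * adj L \<in> carrier_mat (dA * dB) (dA * dB)"
        using L Pc Qc adj by (auto intro!: mult_carrier_mat)
      moreover have "(X + Y) - (P + Q) = (X - P) + (Y - Q)"
        if "X \<in> carrier_mat (dA * dB) (dA * dB)" "Y \<in> carrier_mat (dA * dB) (dA * dB)" for X Y
        using that Pc Qc by (intro eq_matI) auto
      ultimately show ?thesis by simp
    qed
    moreover have "ptrace_right dA dB (L * Q * adj L - Q) = mg (\<Phi> (Suc j)) - mg (\<Phi> j)"
      unfolding Q_def marg_kron_right[OF L \<Phi>j(1)] step
      by (simp only: ptrace_right_diff[OF marg_carrier marg_carrier] ptrace_right_marg[OF \<Phi>j(1)]
          ptrace_right_marg[OF query_carrier[OF \<Phi>j(1)]])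
    moreover have "ptrace_right dA dB ((L * P * adj L - P) + (L * Q * adj L - Q))
        = ptrace_right dA dB (L * P * adj L - P) + ptrace_right dA dB (L * Q * adj L - Q)"
      using Pc Qc by (intro ptrace_right_add minus_carrier_mat) auto
    ultimately have "ptrace_right dA dB (L * (P + Q) * adj L - (P + Q)) = mg (\<Phi> (Suc j)) - mg \<xi>"
      using P(3) by (intro eq_matI) auto
    moreover have "psd_mat (dA * dB) (P + Q)"
      unfolding Q_def by (rule psd_add[OF P(1) psd_marg[OF \<Phi>j(1)]])
    moreover have "mtrace (P + Q) = mtrace P + mtrace Q"
      using Pc Qc by (simp add: mtrace_def sum.distrib)
    then have "Re (mtrace (P + Q)) \<le> real (Suc j) * nsq \<xi>"
      using P(2) \<Phi>j(2) mtrace_marg[OF \<Phi>j(1)] by (simp add: Q_def algebra_simps)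
    ultimately show ?case by blast
  qed
  from this[of T] obtain P where P: "psd_mat (dA * dB) P" "Re (mtrace P) \<le> real T * nsq \<xi>"
      "ptrace_right dA dB (L * P * adj L - P) = mg (\<Phi> T) - mg \<xi>" by auto
  have out: "\<Phi> T = \<tau>" using alg by (simp add: \<Phi>_def alg_output_def)
  then have \<tau>: "\<tau> \<in> states" using \<Phi>[of T] by simp
  have "mg \<tau> - mg \<xi> = ptrace_right dA (dB * dC) (outer \<tau> \<tau> - outer \<xi> \<xi>)"
    unfolding marg_def using \<xi> \<tau> by (intro ptrace_right_diff[symmetric]) (auto simp: outer_def mult.assoc)
  then have "Adv dA dB dC L \<xi> \<tau> \<le> ereal (Re (mtrace P) / Re (cinner \<xi> \<xi>))"
    unfolding Adv_def using P out by (intro Inf_lower) auto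
  moreover have "nsq \<xi> > 0" using nsq_eq_0[OF \<xi>(1)] \<xi>(2) nsq_nonneg[of \<xi>] by linarith
  then have "Re (mtrace P) / Re (cinner \<xi> \<xi>) \<le> real T"
    using P(2) by (simp add: cinner_self pos_divide_le_eq)
  ultimately show ?thesis by (meson ereal_less_eq(3) order_trans)
qed

section \<open>From a feasible solution to an algorithm\<close>

text \<open>The operation found is a unitary, but only its contraction property is kept: it will be
  composed with the idle projection and compared with closest points.\<close>

lemma local_of_mg_eq:
  assumes "x \<in> states" "y \<in> states" "mg x = mg y"
  obtains V where "contraction_mat (dB * dC) V" "local V x = y"
proof -
  have "x \<in> carrier_vec (dA * (dB * dC))" "y \<in> carrier_vec (dA * (dB * dC))"
    using assms by (auto simp: mult.assoc)
  then obtain V where "unitary_mat (dB * dC) V" "local V x = y"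
    using assms(3) by (rule unitary_of_marg_eq)
  then show ?thesis using that unitary_contraction by blast
qed

text \<open>The part of the state destroyed by \<open>K\<close> is parked behind the flag \<open>1\<close> with
  the middle register idle, where later queries do not touch it.\<close>

lemma dilate_contraction:
  assumes K: "contraction_mat (dB * dC) K" and x: "x \<in> states" and J: "J \<in> carrier_vec (dA * dC)"
  obtains U J' where "unitary_mat (dB * (dC * 2)) U" "J' \<in> carrier_vec (dA * dC)"
    "kron (1\<^sub>m dA) U *\<^sub>v flag x (put J) = flag (local K x) (put J')"
proof -
  have Kc: "K \<in> carrier_mat (dB * dC) (dB * dC)" using K by (simp add: contraction_mat_def)
  have x': "x \<in> carrier_vec (dA * (dB * dC))" using x by (simp add: mult.assoc)
  have Kx: "local K x \<in> states" by (rule local_carrier[OF Kc x])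
  then have Kx': "local K x \<in> carrier_vec (dA * (dB * dC))" by (simp add: mult.assoc)
  have put': "put I \<in> carrier_vec (dA * (dB * dC))" for I
    using put_idle_carrier[of dA dB dC idle I] by (simp add: mult.assoc)
  \<comment> \<open>The operator lost under \<open>K\<close> plus the one already parked; with a
    purification of it behind the flag both flagged states have the same reduced operator on
    A.\<close>
  define D where "D = (mg x - mg (local K x)) + marg dA dC J"
  have "psd_mat dA D"
    unfolding D_def by (rule psd_add[OF psd_marg_deficit[OF K x'] psd_marg[OF J]])
  then obtain J' where J': "J' \<in> carrier_vec (dA * dC)" "marg dA dC J' = D"
    using psd_purification[OF _ dA_le_dC] by blast
  have assoc: "dB * dC * 2 = dB * (dC * 2)" "dA * dB * dC * 2 = dA * (dB * (dC * 2))" by simp_all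
  have fc: "flag a (put I) \<in> carrier_vec (dA * (dB * (dC * 2)))" if "a \<in> states" for a I
    using flag_carrier[OF that put_idle_carrier] by (simp only: assoc)
  have "marg dA (dB * dC * 2) (flag x (put J)) = marg dA (dB * dC * 2) (flag (local K x) (put J'))"
    unfolding marg_flag[OF x' put'] marg_flag[OF Kx' put'] marg_put_idle[OF idle J] marg_put_idle[OF idle J'(1)] J'(2) D_def
    by (intro eq_matI) auto
  then have "marg dA (dB * (dC * 2)) (flag x (put J)) = marg dA (dB * (dC * 2)) (flag (local K x) (put J'))"
    by (simp only: assoc)
  then obtain U where "unitary_mat (dB * (dC * 2)) U" "kron (1\<^sub>m dA) U *\<^sub>v flag x (put J) = flag (local K x) (put J')"
    using unitary_of_marg_eq[OF fc[OF x] fc[OF Kx]] by blast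
  then show ?thesis using that J' by blast
qed

lemma query_flag:
  assumes "y \<in> states"
  shows "kron L (1\<^sub>m (dC * 2)) *\<^sub>v (flag y (put J)) = flag (query y) (put J)"
  using kron_right_flag[OF L assms put_idle_carrier] by (simp only: query_put)

text \<open>The branch with flag 1 is entirely idle, so it only adds \<open>nsq J\<close> to both
  the total and the idle weight.\<close>

lemma non_idle_weight_flag:
  assumes y: "y \<in> states" and J: "J \<in> carrier_vec (dA * dC)"
  shows "Re (cinner (flag y (put J)) ((1\<^sub>m (dA * dB * (dC * 2)) - P_idle dA (dC * 2) idle) *\<^sub>v flag y (put J)))
     = nsq (nid y)"
proof -
  have f: "flag y (put J) \<in> carrier_vec (dA * dB * (dC * 2))"
    using flag_carrier[OF y put_idle_carrier] by (simp only: mult.assoc)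
  have "nsq (flag y (put J)) = nsq y + nsq J"
    using nsq_flag[OF y put_idle_carrier] nsq_put_idle[OF idle J] by simp
  moreover have "nsq (take_idle dA dB (dC * 2) idle (flag y (put J))) = nsq (take' y) + nsq J"
    unfolding take_idle_flag[OF y put_idle_carrier] take_put_idle[OF idle J]
    by (rule nsq_flag[OF take_idle_carrier J])
  ultimately show ?thesis
    unfolding non_idle_weight[OF idle f] nsq_non_idle[OF idle f] nsq_non_idle[OF idle y] by simp
qed

text \<open>By linearity a contraction is nonexpansive; this keeps the distance to the ideal
  trajectory from growing.\<close>

lemma local_contract_dist:
  assumes K: "contraction_mat (dB * dC) K" and "x \<in> states" "y \<in> states"
  shows "nsq (local K x - local K y) \<le> nsq (x - y)"
proof -
  have Kc: "K \<in> carrier_mat (dB * dC) (dB * dC)" using K by (simp add: contraction_mat_def)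
  have xy: "x \<in> carrier_vec (dA * (dB * dC))" "y \<in> carrier_vec (dA * (dB * dC))"
    using assms by (auto simp: mult.assoc)
  show ?thesis
    using nsq_kron_left_le[OF K minus_carrier_vec[OF xy]] kron_one_left_diff[OF Kc xy] by simp
qed

lemma query_contract_dist:
  assumes "x \<in> states" "y \<in> states"
  shows "nsq (query x - query y) \<le> nsq (x - y)"
  using nsq_query_le[OF minus_carrier_vec[OF assms]] query_diff[OF assms] by simp

text \<open>The trajectory \<open>z\<close> of the run that starts with the catalyst \<open>\<psi>/\<surd>T\<close> added to the input.\<close>

lemma ideal_trajectory:
  assumes \<xi>: "\<xi> \<in> states" and \<tau>: "\<tau> \<in> states" and f: "feasible \<xi> \<tau> \<psi>"
    and \<psi>: "take' \<psi> = 0\<^sub>v (dA * dC)" and T: "T > 0"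
  obtains z where "\<And>j. j \<le> T \<Longrightarrow> z j \<in> states"
    and "\<And>j. j \<le> T \<Longrightarrow> nsq (nid (z j)) = nsq \<psi> / real T"
    and "\<And>j. j < T \<Longrightarrow> mg (query (z j)) = mg (z (Suc j))"
    and "\<exists>K. contraction_mat (dB * dC) K \<and> nsq (z 0 - local K \<xi>) \<le> nsq \<psi> / real T"
    and "\<exists>K. contraction_mat (dB * dC) K \<and> local K (z T) = \<tau>"
proof -
  have \<psi>s: "\<psi> \<in> states" using f by (simp add: feasible_def)
  \<comment> \<open>The reduced operator intended for the idle part after \<open>j\<close> steps.
    Both weights are nonnegative for \<open>j \<le> T\<close>, so it is positive and can be
    purified.\<close>
  define R where "R j = complex_of_real (1 - real j / real T) \<cdot>\<^sub>m mg \<xi> + complex_of_real (real j / real T) \<cdot>\<^sub>m mg \<tau>" for j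
  have "\<exists>J. J \<in> carrier_vec (dA * dC) \<and> marg dA dC J = R j" if "j \<le> T" for j
  proof -
    have "psd_mat dA (R j)"
      unfolding R_def using \<xi> \<tau> that T unfolding states_assoc
      by (intro psd_add psd_smult psd_marg) (auto simp: divide_le_eq_1)
    then show ?thesis using psd_purification[OF _ dA_le_dC] by blast
  qed
  then obtain \<Xi> where \<Xi>: "\<And>j. j \<le> T \<Longrightarrow> \<Xi> j \<in> carrier_vec (dA * dC)" "\<And>j. j \<le> T \<Longrightarrow> marg dA dC (\<Xi> j) = R j"
    by metis
  \<comment> \<open>Scaling by \<open>s\<close> multiplies reduced operators by
    \<open>1 / T\<close>, the amount by which the weights in \<open>R\<close> change per
    step.\<close>
  define s where "s = complex_of_real (1 / sqrt (real T))"
  have ss: "s * cnj s = of_real (1 / real T)" "(cmod s)\<^sup>2 = 1 / real T"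
    using T by (simp_all add: s_def power_divide of_real_mult[symmetric] of_real_divide[symmetric] norm_divide del: of_real_mult of_real_divide)
  define c where "c = s \<cdot>\<^sub>v \<psi>"
  have c: "c \<in> states" "take' c = 0\<^sub>v (dA * dC)"
    using \<psi>s \<psi> take_idle_smult[OF \<psi>s, of idle s] by (auto simp: c_def)
  have nc: "nsq c = nsq \<psi> / real T" by (simp add: c_def nsq_smult ss)
  have mgs: "mg (s \<cdot>\<^sub>v x) $$ (i, k) = of_real (1 / real T) * mg x $$ (i, k)" if "x \<in> states" "i < dA" "k < dA" for x i k
  proof -
    have x: "x \<in> carrier_vec (dA * (dB * dC))" "s \<cdot>\<^sub>v x \<in> carrier_vec (dA * (dB * dC))" using that by (auto simp: mult.assoc)
    show ?thesis
      unfolding marg_index[OF x(1) that(2,3)] marg_index[OF x(2) that(2,3)] ss(1)[symmetric] sum_distrib_left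
      by (rule sum.cong[OF refl]) (use x that in \<open>simp add: index_less\<close>)
  qed
  define z where "z j = put (\<Xi> j) + c" for j
  have z: "z j \<in> states" for j using c by (simp add: z_def)
  have mz: "mg (z j) = R j + mg c" if "j \<le> T" for j
    using mg_put_add[OF \<Xi>(1)[OF that] c] \<Xi>(2)[OF that] by (simp add: z_def)
  have nz: "nid (z j) = c" if "j \<le> T" for j
  proof -
    have "take' (z j) = \<Xi> j"
      using take_idle_add[OF put_idle_carrier[of dA dB dC idle "\<Xi> j"] c(1), of idle] take_put_idle[OF idle \<Xi>(1)[OF that]] c(2) \<Xi>(1)[OF that]
      by (simp add: z_def)
    then show ?thesis using c by (auto simp: non_idle_def z_def)
  qed
  have "mg (query (z j)) = mg (z (Suc j))" if j: "j < T" for j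
  proof (rule eq_matI)
    fix i k assume "i < dim_row (mg (z (Suc j)))" "k < dim_col (mg (z (Suc j)))"
    then have ik: "i < dA" "k < dA" by auto
    have "query (z j) = put (\<Xi> j) + query c"
      using query_add[OF put_idle_carrier c(1)] by (simp add: z_def query_put)
    then have q: "mg (query (z j)) = R j + mg (query c)"
      using mg_put_add[OF \<Xi>(1) query_carrier[OF c(1)] take_query[OF c]] \<Xi>(2)[of j] j by simp
    have qc: "query c = s \<cdot>\<^sub>v query \<psi>" unfolding c_def by (rule query_smult[OF \<psi>s])
    have e: "mg (query \<psi>) + mg \<xi> = mg \<tau> + mg \<psi>" using f by (simp add: feasible_def)
    have "(mg (query \<psi>) + mg \<xi>) $$ (i, k) = (mg \<tau> + mg \<psi>) $$ (i, k)" by (simp only: e)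
    then have e': "mg (query \<psi>) $$ (i, k) = mg \<tau> $$ (i, k) + mg \<psi> $$ (i, k) - mg \<xi> $$ (i, k)"
      using ik by (simp add: algebra_simps)
    have "mg (query (z j)) $$ (i, k) = of_real (1 - real j / real T) * mg \<xi> $$ (i, k)
        + of_real (real j / real T) * mg \<tau> $$ (i, k) + of_real (1 / real T) * mg (query \<psi>) $$ (i, k)"
      using ik unfolding q qc by (simp add: R_def mgs[OF query_carrier[OF \<psi>s]])
    \<comment> \<open>By feasibility the query changes the reduced operator of the catalyst by (mg
      \<tau> - mg \<xi>)/T, which is exactly the difference of two consecutive
      \<open>R\<close>.\<close>
    also have "\<dots> = of_real (1 - real (Suc j) / real T) * mg \<xi> $$ (i, k)
        + of_real (real (Suc j) / real T) * mg \<tau> $$ (i, k) + of_real (1 / real T) * mg \<psi> $$ (i, k)"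
      unfolding e' using T by (simp add: field_simps)
    also have "\<dots> = mg (z (Suc j)) $$ (i, k)"
      using ik j unfolding mz[OF Suc_leI[OF j]] c_def by (simp add: R_def mgs[OF \<psi>s])
    finally show "mg (query (z j)) $$ (i, k) = mg (z (Suc j)) $$ (i, k)" .
  qed auto
  \<comment> \<open>Since \<open>R 0\<close> is the reduced operator of \<open>\<xi>\<close>, the
    idle part of \<open>z 0\<close> can be reached locally; only the catalyst is missing.\<close>
  moreover have "\<exists>K. contraction_mat (dB * dC) K \<and> nsq (z 0 - local K \<xi>) \<le> nsq \<psi> / real T"
  proof -
    have "mg \<xi> = mg (put (\<Xi> 0))"
      using marg_put_idle[OF idle \<Xi>(1)[of 0]] \<Xi>(2)[of 0] by (simp add: R_def) (auto intro!: eq_matI)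
    then obtain K where K: "contraction_mat (dB * dC) K" "local K \<xi> = put (\<Xi> 0)"
      using local_of_mg_eq[OF \<xi> put_idle_carrier] by metis
    moreover have "z 0 - put (\<Xi> 0) = c" using c by (intro eq_vecI) (auto simp: z_def)
    ultimately show ?thesis using nc by (intro exI[of _ K]) simp
  qed
  \<comment> \<open>Since \<open>R T\<close> is the reduced operator of \<open>\<tau>\<close>, the
    idle projection first removes the catalyst and a unitary then produces
    \<open>\<tau>\<close>.\<close>
  moreover have "\<exists>K. contraction_mat (dB * dC) K \<and> local K (z T) = \<tau>"
  proof -
    have "mg (put (\<Xi> T)) = mg \<tau>"
      using marg_put_idle[OF idle \<Xi>(1)[of T]] \<Xi>(2)[of T] T by (simp add: R_def) (auto intro!: eq_matI)
    then obtain V where V: "contraction_mat (dB * dC) V" "local V (put (\<Xi> T)) = \<tau>"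
      using local_of_mg_eq[OF put_idle_carrier \<tau>] by metis
    define Q where "Q = kron (outer idle idle) (1\<^sub>m dC)"
    have Q: "contraction_mat (dB * dC) Q" unfolding Q_def by (rule contraction_idle_projection[OF idle])
    have "local Q (z T) = put (take' (z T))" unfolding Q_def by (rule idle_projection_left[OF idle(1) z])
    also have "take' (z T) = \<Xi> T"
      using take_idle_add[OF put_idle_carrier[of dA dB dC idle "\<Xi> T"] c(1), of idle] take_put_idle[OF idle \<Xi>(1)[of T]] c(2) \<Xi>(1)[of T]
      by (simp add: z_def)
    finally have "local Q (z T) = put (\<Xi> T)" .
    moreover have "local (V * Q) (z T) = local V (local Q (z T))"
      using V(1) Q z[of T] unfolding states_assoc by (intro kron_one_left_mult) (auto simp: contraction_mat_def)
    ultimately have "local (V * Q) (z T) = \<tau>" using V by simp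
    then show ?thesis using contraction_mat_mult[OF V(1) Q] by blast
  qed
  ultimately show ?thesis using that[of z] z nz nc by simp
qed

text \<open>Greedy pursuit of the ideal trajectory by closest contractions, each dilated to a
  unitary on the space with flag. The last step does not approach \<open>z T\<close> but goes
  directly for \<open>\<tau>\<close>.\<close>

lemma algorithm_of_feasible:
  assumes \<xi>: "\<xi> \<in> states" and \<tau>: "\<tau> \<in> states" and f: "feasible \<xi> \<tau> \<psi>"
    and \<psi>: "take' \<psi> = 0\<^sub>v (dA * dC)" and T0: "T = 0 \<Longrightarrow> nsq \<psi> = 0"
  obtains U y J where "\<And>j. unitary_mat (dB * (dC * 2)) (U j)"
    and "\<And>j. y j \<in> states" "\<And>j. J j \<in> carrier_vec (dA * dC)"
    and "\<And>j. alg_state dA (dC * 2) L U j (kron_vec \<xi> (unit_vec 2 0)) = flag (y j) (put (J j))"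
    and "\<And>j. j < T \<Longrightarrow> nsq (nid (y j)) \<le> nsq \<psi> / real T"
    and "nsq (y T - \<tau>) \<le> nsq \<psi> / real T"
proof -
  have \<psi>s: "\<psi> \<in> states" using f by (simp add: feasible_def)
  \<comment> \<open>For \<open>T = 0\<close> division by zero makes this 0, so the output must then
    be exact.\<close>
  define \<delta> where "\<delta> = nsq \<psi> / real T"
  have ex: "\<exists>z. T > 0 \<longrightarrow> (\<forall>j\<le>T. z j \<in> states \<and> nsq (nid (z j)) = \<delta>) \<and> (\<forall>j<T. mg (query (z j)) = mg (z (Suc j))) \<and>
     (\<exists>K. contraction_mat (dB * dC) K \<and> nsq (z 0 - local K \<xi>) \<le> \<delta>) \<and>
     (\<exists>K. contraction_mat (dB * dC) K \<and> local K (z T) = \<tau>)"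
  proof (cases "T > 0")
    case True
    then show ?thesis unfolding \<delta>_def by (rule ideal_trajectory[OF \<xi> \<tau> f \<psi>]) blast
  qed simp
  obtain z where Z: "T > 0 \<longrightarrow> (\<forall>j\<le>T. z j \<in> states \<and> nsq (nid (z j)) = \<delta>) \<and> (\<forall>j<T. mg (query (z j)) = mg (z (Suc j))) \<and>
     (\<exists>K. contraction_mat (dB * dC) K \<and> nsq (z 0 - local K \<xi>) \<le> \<delta>) \<and>
     (\<exists>K. contraction_mat (dB * dC) K \<and> local K (z T) = \<tau>)"
    using ex by (rule exE)
  have z: "\<And>j. T > 0 \<Longrightarrow> j \<le> T \<Longrightarrow> z j \<in> states"
    and nz: "\<And>j. T > 0 \<Longrightarrow> j \<le> T \<Longrightarrow> nsq (nid (z j)) = \<delta>"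
    and mz: "\<And>j. j < T \<Longrightarrow> mg (query (z j)) = mg (z (Suc j))"
    and z0: "T > 0 \<Longrightarrow> \<exists>K. contraction_mat (dB * dC) K \<and> nsq (z 0 - local K \<xi>) \<le> \<delta>"
    and zT: "T > 0 \<Longrightarrow> \<exists>K. contraction_mat (dB * dC) K \<and> local K (z T) = \<tau>"
    using Z by auto
  \<comment> \<open>Before time \<open>T\<close> the state tracks the trajectory with bounded
    non-idle part, at time \<open>T\<close> it is close to \<open>\<tau>\<close>, and later nothing
    is asked.\<close>
  define good where "good j y \<longleftrightarrow> (j < T \<longrightarrow> nsq (z j - y) \<le> \<delta> \<and> nsq (nid y) \<le> \<delta>) \<and> (j = T \<longrightarrow> nsq (y - \<tau>) \<le> \<delta>)" for j y
  \<comment> \<open>One competitor within \<delta> of the trajectory suffices: the closest point is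
    then also within \<delta>, and first-order optimality bounds its non-idle part.\<close>
  have closest: "\<exists>K. contraction_mat (dB * dC) K \<and> nsq (z j - local K x) \<le> \<delta> \<and> nsq (nid (local K x)) \<le> \<delta>"
    if "j < T" "x \<in> states" and V: "contraction_mat (dB * dC) V" "nsq (z j - local V x) \<le> \<delta>" for j x V
  proof -
    have zj: "z j \<in> states" "nsq (nid (z j)) = \<delta>" using z nz that(1) by auto
    show ?thesis
      using closest_contraction_non_idle[OF idle that(2) zj(1)] V zj(2) by (metis order_trans)
  qed
  have start: "\<exists>K. contraction_mat (dB * dC) K \<and> good 0 (local K \<xi>)"
  proof (cases "T = 0")
    \<comment> \<open>Without queries \<open>\<psi>\<close> is zero, so \<open>\<xi>\<close> and
      \<open>\<tau>\<close> have the same reduced operator and one local unitary is exact.\<close>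
    case True
    then have "\<psi> = 0\<^sub>v (dA * dB * dC)" using T0 nsq_eq_0[OF \<psi>s] by simp
    then have "query \<psi> = \<psi>" using query_put[of "0\<^sub>v (dA * dC)"] by simp
    then have e: "mg \<psi> + mg \<xi> = mg \<tau> + mg \<psi>" using f by (simp add: feasible_def)
    have "mg \<xi> = mg \<tau>"
    proof (rule eq_matI)
      fix i k assume "i < dim_row (mg \<tau>)" "k < dim_col (mg \<tau>)"
      moreover have "(mg \<psi> + mg \<xi>) $$ (i, k) = (mg \<tau> + mg \<psi>) $$ (i, k)" by (simp only: e)
      ultimately show "mg \<xi> $$ (i, k) = mg \<tau> $$ (i, k)" by simp
    qed auto
    then obtain V where V: "contraction_mat (dB * dC) V" "local V \<xi> = \<tau>"
      using local_of_mg_eq[OF \<xi> \<tau>] by metis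
    moreover have "nsq (\<tau> - \<tau>) = 0" using \<tau> nsq_eq_0[of "\<tau> - \<tau>" "dA * dB * dC"] by simp
    ultimately show ?thesis using True by (intro exI[of _ V]) (simp add: good_def \<delta>_def)
  next
    case False
    then show ?thesis using z0 closest[of 0 \<xi>] \<xi> by (auto simp: good_def)
  qed
  have step: "\<exists>K. contraction_mat (dB * dC) K \<and> good (Suc j) (local K (query y))"
    if y: "y \<in> states" and g: "good j y" for j y
  proof (cases "j < T")
    \<comment> \<open>The next index exceeds \<open>T\<close>, where \<open>good\<close> is void;
      any contraction continues the sequence.\<close>
    case False
    have "contraction_mat (dB * dC) (1\<^sub>m (dB * dC))" by (auto simp: contraction_mat_def)
    then show ?thesis using False by (auto simp: good_def)
  next
    case True
    then have zj: "z j \<in> states" "z (Suc j) \<in> states" and d: "nsq (z j - y) \<le> \<delta>"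
      using z g by (auto simp: good_def)
    obtain V where V: "contraction_mat (dB * dC) V" "local V (query (z j)) = z (Suc j)"
      using local_of_mg_eq[OF query_carrier[OF zj(1)] zj(2) mz[OF True]] by blast
    \<comment> \<open>The operation that advances the ideal state, applied to the actual one, does
      not increase the distance; it is the competitor for the closest point.\<close>
    have "nsq (z (Suc j) - local V (query y)) \<le> nsq (query (z j) - query y)"
      using local_contract_dist[OF V(1) query_carrier[OF zj(1)] query_carrier[OF y]] V(2) by simp
    also have "\<dots> \<le> nsq (z j - y)" by (rule query_contract_dist[OF zj(1) y])
    finally have dV: "nsq (z (Suc j) - local V (query y)) \<le> \<delta>" using d by simp
    show ?thesis
    proof (cases "Suc j < T")
      case True
      then show ?thesis using closest[OF True query_carrier[OF y] V(1) dV] by (auto simp: good_def)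
    next
      case False
      \<comment> \<open>At the end \<open>V\<close> is followed by \<open>W\<close>, which turns the
        final ideal state into \<open>\<tau>\<close>; the distance bound carries over.\<close>
      then have j: "Suc j = T" using True by simp
      obtain W where W: "contraction_mat (dB * dC) W" "local W (z T) = \<tau>" using zT True by auto
      have Vc: "V \<in> carrier_mat (dB * dC) (dB * dC)" and Wc: "W \<in> carrier_mat (dB * dC) (dB * dC)"
        using V W by (auto simp: contraction_mat_def)
      have Vy: "local V (query y) \<in> states" by (rule local_carrier[OF Vc query_carrier[OF y]])
      have WV: "local (W * V) (query y) = local W (local V (query y))"
        using Wc Vc query_carrier[OF y] unfolding states_assoc by (rule kron_one_left_mult)
      have "nsq (\<tau> - local (W * V) (query y)) \<le> \<delta>"
        using local_contract_dist[OF W(1) zj(2) Vy] W(2) dV j by (simp add: WV)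
      moreover have "local (W * V) (query y) \<in> states" unfolding WV by (rule local_carrier[OF Wc Vy])
      ultimately have "nsq (local (W * V) (query y) - \<tau>) \<le> \<delta>"
        using nsq_sub_commute[OF \<tau>] by simp
      then show ?thesis using contraction_mat_mult[OF W(1) V(1)] j by (auto simp: good_def)
    qed
  qed
  \<comment> \<open>Dependent choice carries a unitary, the branch with flag 0 and the parked idle
    vector. The clause for \<open>j = 0\<close> reflects that the first unitary precedes all
    queries; \<open>Q\<close> describes a query followed by a unitary.\<close>
  define P where "P j s \<longleftrightarrow> (case s of (U, y, J) \<Rightarrow> unitary_mat (dB * (dC * 2)) U \<and> y \<in> states \<and>
      J \<in> carrier_vec (dA * dC) \<and> good j y \<and>
      (j = 0 \<longrightarrow> kron (1\<^sub>m dA) U *\<^sub>v kron_vec \<xi> (unit_vec 2 0) = flag y (put J)))" for j s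
  define Q where "Q s s' \<longleftrightarrow> (case s of (U, y, J) \<Rightarrow> case s' of (U', y', J') \<Rightarrow>
      kron (1\<^sub>m dA) U' *\<^sub>v (kron L (1\<^sub>m (dC * 2)) *\<^sub>v flag y (put J)) = flag y' (put J'))" for s s' :: "complex mat \<times> complex vec \<times> complex vec"
  have "\<exists>s. \<forall>j. P j (s j) \<and> Q (s j) (s (Suc j))"
  proof (rule dependent_nat_choice[of P "\<lambda>_. Q"])
    obtain K where K: "contraction_mat (dB * dC) K" "good 0 (local K \<xi>)" using start by blast
    obtain U J where U: "unitary_mat (dB * (dC * 2)) U" "J \<in> carrier_vec (dA * dC)"
      "kron (1\<^sub>m dA) U *\<^sub>v flag \<xi> (put (0\<^sub>v (dA * dC))) = flag (local K \<xi>) (put J)"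
      using dilate_contraction[OF K(1) \<xi> zero_carrier_vec] by blast
    \<comment> \<open>The input with flag 0 is the flagged state with nothing parked.\<close>
    have "flag \<xi> (put (0\<^sub>v (dA * dC))) = kron_vec \<xi> (unit_vec 2 0)"
      using \<xi> by (simp add: flag_def) (auto simp: kron_vec_def less_mult_imp_div_less intro!: eq_vecI)
    moreover have "local K \<xi> \<in> states"
      using K(1) \<xi> by (auto simp: contraction_mat_def intro!: local_carrier)
    ultimately show "\<exists>s. P 0 s" using U K by (intro exI[of _ "(U, local K \<xi>, J)"]) (simp add: P_def)
  next
    fix s j assume "P j s"
    then obtain U y J where s: "s = (U, y, J)" "y \<in> states" "J \<in> carrier_vec (dA * dC)" "good j y"
      by (cases s) (auto simp: P_def)
    obtain K where K: "contraction_mat (dB * dC) K" "good (Suc j) (local K (query y))"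
      using step[OF s(2,4)] by blast
    obtain U' J' where U': "unitary_mat (dB * (dC * 2)) U'" "J' \<in> carrier_vec (dA * dC)"
      "kron (1\<^sub>m dA) U' *\<^sub>v flag (query y) (put J) = flag (local K (query y)) (put J')"
      using dilate_contraction[OF K(1) query_carrier[OF s(2)] s(3)] by blast
    have "local K (query y) \<in> states"
      using K(1) s(2) by (auto simp: contraction_mat_def intro!: local_carrier)
    then show "\<exists>s'. P (Suc j) s' \<and> Q s s'"
      using U' K s(1) query_flag[OF s(2), of J]
      by (intro exI[of _ "(U', local K (query y), J')"]) (simp add: P_def Q_def)
  qed
  then obtain s where s: "\<And>j. P j (s j)" "\<And>j. Q (s j) (s (Suc j))" by blast
  define U where "U j = fst (s j)" for j
  define y where "y j = fst (snd (s j))" for j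
  define J where "J j = snd (snd (s j))" for j
  have P: "unitary_mat (dB * (dC * 2)) (U j)" "y j \<in> states" "J j \<in> carrier_vec (dA * dC)" "good j (y j)" for j
    using s(1)[of j] by (auto simp: P_def U_def y_def J_def split: prod.splits)
  have "alg_state dA (dC * 2) L U j (kron_vec \<xi> (unit_vec 2 0)) = flag (y j) (put (J j))" for j
  proof (induction j)
    case 0
    show ?case using s(1)[of 0] by (auto simp: P_def U_def y_def J_def split: prod.splits)
  next
    case (Suc j)
    then show ?case using s(2)[of j] by (auto simp: Q_def U_def y_def J_def split: prod.splits)
  qed
  then show ?thesis using that[of U y J] P unfolding good_def \<delta>_def by blast
qed

end

section \<open>Both claims, the second from an optimal feasible vector reduced to its non-idle
  part\<close>

theorem theorem1:
  fixes dA dB dC :: nat and idle :: "complex vec" and L :: "complex mat"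
    and \<xi> \<tau> :: "complex vec"
  assumes dimC: "dC \<ge> dA * dB"
    and idle: "idle \<in> carrier_vec dB" "cnorm idle = 1"
    and L: "L \<in> carrier_mat (dA*dB) (dA*dB)"
    and subunitary: "\<forall>v\<in>carrier_vec (dA*dB). cnorm (L *\<^sub>v v) \<le> cnorm v"
    and idle_fix: "\<forall>\<phi>\<in>carrier_vec dA. L *\<^sub>v kron_vec \<phi> idle = kron_vec \<phi> idle"
    and xi: "\<xi> \<in> carrier_vec (dA*dB*dC)" "\<xi> \<noteq> 0\<^sub>v (dA*dB*dC)"
    and tau: "\<tau> \<in> carrier_vec (dA*dB*dC)"
  shows
    "(\<forall>T U. is_algorithm dB dC T U \<and> alg_output dA dC L U T \<xi> = \<tau>
        \<longrightarrow> Adv dA dB dC L \<xi> \<tau> \<le> ereal (real T))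
     \<and>
     (Adv dA dB dC L \<xi> \<tau> < \<infinity> \<longrightarrow>
       (\<forall>\<epsilon>>0. let T' = nat \<lceil>real_of_ereal (Adv dA dB dC L \<xi> \<tau>) / \<epsilon>\<^sup>2\<rceil> in
          \<exists>U \<tau>' \<Delta>. is_algorithm dB (dC*2) T' U
            \<and> \<tau>' \<in> carrier_vec (dA*dB*dC) \<and> \<Delta> \<in> carrier_vec (dA*dB*dC)
            \<and> alg_output dA (dC*2) L U T' (kron_vec \<xi> (unit_vec 2 0))
                = kron_vec \<tau>' (unit_vec 2 0) + kron_vec \<Delta> (unit_vec 2 1)
            \<and> cnorm (\<tau>' - \<tau>) / cnorm \<xi> \<le> \<epsilon>
            \<and> ereal ((\<Sum>j<T'. Re (cinner (alg_state dA (dC*2) L U j (kron_vec \<xi> (unit_vec 2 0)))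
                    ((1\<^sub>m (dA*dB*(dC*2)) - P_idle dA (dC*2) idle)
                      *\<^sub>v alg_state dA (dC*2) L U j (kron_vec \<xi> (unit_vec 2 0)))))
                  / Re (cinner \<xi> \<xi>))
                \<le> Adv dA dB dC L \<xi> \<tau>))"
proof -
  interpret idle_query dA dB dC idle L
    using dimC idle L subunitary idle_fix
    by unfold_locales (auto simp: contraction_mat_def cnorm_le_iff)
  have \<xi>0: "nsq \<xi> > 0" using nsq_eq_0[OF xi(1)] xi(2) nsq_nonneg[of \<xi>] by linarith
  show ?thesis
  proof (intro conjI impI allI, goal_cases)
    case (1 T U)
    then show ?case using Adv_le_timesteps[OF xi] by blast
  next
    case (2 \<epsilon>)
    then have \<epsilon>: "\<epsilon> > 0" by simp
    obtain \<phi> where \<phi>: "feasible \<xi> \<tau> \<phi>" "Adv dA dB dC L \<xi> \<tau> = ereal (nsq \<phi> / nsq \<xi>)"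
      using Adv_attained[OF xi(1) tau 2(1)] by blast
    define w where "w = nsq \<phi> / nsq \<xi>"
    define T where "T = nat \<lceil>w / \<epsilon>\<^sup>2\<rceil>"
    define \<psi> where "\<psi> = nid \<phi>"
    have \<psi>: "feasible \<xi> \<tau> \<psi>" "take' \<psi> = 0\<^sub>v (dA * dC)" "nsq \<psi> \<le> nsq \<phi>"
      using feasible_non_idle[OF \<phi>(1)] by (auto simp: \<psi>_def)
    have w: "w \<ge> 0" "nsq \<phi> = w * nsq \<xi>" using \<xi>0 by (auto simp: w_def)
    have wT: "w / \<epsilon>\<^sup>2 \<le> real T" unfolding T_def by linarith
    \<comment> \<open>A vanishing rounded-up quotient forces the optimal value to be 0, hence
      \<open>\<psi>\<close> to be zero.\<close>
    have T0: "nsq \<psi> = 0" if "T = 0"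
    proof -
      have "w \<le> 0" using wT that \<epsilon> by (simp add: divide_le_0_iff)
      then show ?thesis using w \<psi>(3) nsq_nonneg[of \<psi>] by simp
    qed
    \<comment> \<open>Rounding up gives \<open>w \<le> T * \<epsilon>\<^sup>2\<close>; for
      \<open>T = 0\<close> the left side is 0 by convention.\<close>
    have le: "nsq \<psi> / real T \<le> \<epsilon>\<^sup>2 * nsq \<xi>"
    proof (cases "T = 0")
      case False
      have "nsq \<psi> \<le> w * nsq \<xi>" using \<psi>(3) w by simp
      also have "\<dots> \<le> (real T * \<epsilon>\<^sup>2) * nsq \<xi>"
        using wT \<epsilon> \<xi>0 by (intro mult_right_mono) (auto simp: pos_divide_le_eq)
      finally show ?thesis using False by (simp add: pos_divide_le_eq mult_ac)
    qed simp
    obtain U y J where U: "\<And>j. unitary_mat (dB * (dC * 2)) (U j)"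
      and y: "\<And>j. y j \<in> states" and J: "\<And>j. J j \<in> carrier_vec (dA * dC)"
      and st: "\<And>j. alg_state dA (dC * 2) L U j (kron_vec \<xi> (unit_vec 2 0)) = flag (y j) (put (J j))"
      and nid: "\<And>j. j < T \<Longrightarrow> nsq (nid (y j)) \<le> nsq \<psi> / real T"
      and fin: "nsq (y T - \<tau>) \<le> nsq \<psi> / real T"
      using algorithm_of_feasible[OF xi(1) tau \<psi>(1,2) T0] by metis
    have "cnorm (y T - \<tau>) \<le> sqrt (\<epsilon>\<^sup>2 * nsq \<xi>)"
      unfolding cnorm_sqrt using fin le by (intro real_sqrt_le_mono) linarith
    also have "\<dots> = \<epsilon> * cnorm \<xi>" using \<epsilon> by (simp add: cnorm_sqrt real_sqrt_mult)
    finally have err: "cnorm (y T - \<tau>) / cnorm \<xi> \<le> \<epsilon>"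
      using \<xi>0 by (simp add: cnorm_sqrt pos_divide_le_eq)
    \<comment> \<open>Each of the \<open>T\<close> non-idle weights is at most a \<open>T\<close>-th
      of \<open>nsq \<psi>\<close>, so the total is at most the optimal value times
      \<open>nsq \<xi>\<close>.\<close>
    have "(\<Sum>j<T. nsq (nid (y j))) \<le> real T * (nsq \<psi> / real T)"
      using sum_bounded_above[of "{..<T}" "\<lambda>j. nsq (nid (y j))" "nsq \<psi> / real T"] nid by simp
    also have "\<dots> \<le> nsq \<phi>" using \<psi>(3) by (cases "T = 0") auto
    finally have "(\<Sum>j<T. nsq (nid (y j))) / nsq \<xi> \<le> w"
      using \<xi>0 by (simp add: w_def divide_right_mono)
    then have las: "ereal ((\<Sum>j<T. Re (cinner (alg_state dA (dC*2) L U j (kron_vec \<xi> (unit_vec 2 0)))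
          ((1\<^sub>m (dA*dB*(dC*2)) - P_idle dA (dC*2) idle)
            *\<^sub>v alg_state dA (dC*2) L U j (kron_vec \<xi> (unit_vec 2 0))))) / Re (cinner \<xi> \<xi>))
        \<le> Adv dA dB dC L \<xi> \<tau>"
      unfolding st non_idle_weight_flag[OF y J] \<phi>(2) by (simp add: w_def cinner_self)
    have T: "nat \<lceil>real_of_ereal (Adv dA dB dC L \<xi> \<tau>) / \<epsilon>\<^sup>2\<rceil> = T" by (simp add: \<phi>(2) T_def w_def)
    have "is_algorithm dB (dC * 2) T U" using U by (simp add: is_algorithm_def)
    moreover have "alg_output dA (dC * 2) L U T (kron_vec \<xi> (unit_vec 2 0))
        = kron_vec (y T) (unit_vec 2 0) + kron_vec (put (J T)) (unit_vec 2 1)"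
      unfolding alg_output_def st flag_def ..
    ultimately show ?case
      unfolding T Let_def using y[of T] err las
      by (intro exI[of _ U] exI[of _ "y T"] exI[of _ "put (J T)"]) simp
  qed
qed

end
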